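(* Let $\mathcal{L}$ be a left bialgebroid over $B$, let $\Gamma$ be an invertible normalised 2-cocycle on $\mathcal{L}$, and let $N\subseteq P$ be a faithfully flat left $\mathcal{L}$-Galois extension. Then $N\subseteq{}_{\Gamma}P$ is a left $\mathcal{L}^{\Gamma}$-Galois extension, with twisted left translation map $${}^{\mathcal{L}^{\Gamma}}\tau(X)=X_{(1)+}{}^{<1>}\otimes_N\Gamma^{-1}(X_{(1)-},X_{(2)})\,X_{(1)+}{}^{<2>}$$ for all $X\in\mathcal{L}$ (i.e. this is the preimage of $X\diamond_B1$ under the left canonical map of ${}_\Gamma P$ over $\mathcal{L}^\Gamma$).
   Context: $k$ is a field, $B$ a unital $k$-algebra, $\overline B$ its opposite algebra with canonical anti-isomorphism $B\to\overline B$, $b\mapsto\bar b$, and $B^e=B\otimes\overline B$. $M\diamond_B N:=M\otimes N/\langle \bar bm\otimes n-m\otimes bn\rangle$; $M\times_BN:=\{\sum m_i\otimes n_i\in M\diamond_BN:\ \sum m_i\bar a\otimes n_i=\sum m_i\otimes n_ia\ \forall a\in B\}$. A $B$-ring is an algebra $P$ with an algebra map $B\to P$. A left bialgebroid over $B$ is an algebra $\mathcal{L}$ with algebra maps $s:B\to\mathcal{L}$, $t:\overline B\to\mathcal{L}$ with commuting images (one writes $b,\bar b$ for $s(b),t(\bar b)$), with left $B^e$-module maps $\Delta:\mathcal{L}\to\mathcal{L}\times_B\mathcal{L}$, $\Delta(X)=X_{(1)}\otimes X_{(2)}$ (so $\Delta(b\bar cX)=bX_{(1)}\otimes\bar cX_{(2)}$)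 and $\varepsilon:\mathcal{L}\to B$ (so $\varepsilon(b\bar cX)=b\varepsilon(X)c$), coassociative and counital ($\varepsilon(X_{(1)})X_{(2)}=\overline{\varepsilon(X_{(2)})}X_{(1)}=X$), such that $\Delta$ is an algebra map (componentwise product on $\mathcal{L}\times_B\mathcal{L}$), $\varepsilon(1)=1$ and $\varepsilon(X\varepsilon(Y))=\varepsilon(XY)=\varepsilon(X\overline{\varepsilon(Y)})$. Standing assumption: all $B$-module and $\overline B$-module structures are faithfully flat. $\mathcal{L}$ is a left Hopf algebroid if $\lambda:\mathcal{L}\otimes_{\overline B}\mathcal{L}\to\mathcal{L}\diamond_B\mathcal{L}$, $\lambda(X\otimes Y)=X_{(1)}\otimes X_{(2)}Y$, is bijective; then $X_+\otimes_{\overline B}X_-:=\lambda^{-1}(X\diamond1)$. (A left bialgebroid admitting a faithfully flat left Galois extension is a left Hopf algebroid, so this notation is available.) A left $\mathcal{L}$-comodule is a $B$-bimodule $P$ with a coassociative, counital ($\varepsilon(p_{(-1)})p_{(0)}=p$) map $P\to\mathcal{L}\times_BP$, $p\mapsto p_{(-1)}\otimes p_{(0)}$, with $bpb'\mapsto bp_{(-1)}b'\otimes p_{(0)}$. A left $\mathcal{L}$-comodule algebra is a $B$-ring $P$ that is a left $\mathcal{L}$-comodule (with the $B$-bimodule structure of the $B$-ring) whose coaction $P\to\mathcal{L}\times_BP$ is a map of $B$-rings. With $N={}^{co\mathcal{L}}P=\{p: p_{(-1)}\otimes p_{(0)}=1\otimes p\}$, $N\subseteq P$ is a left $\mathcal{L}$-Galois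 extension if ${}^L\mathrm{can}:P\otimes_NP\to\mathcal{L}\diamond_BP$, $p\otimes q\mapsto p_{(-1)}\otimes p_{(0)}q$, is bijective; the left translation map is $X\mapsto X^{<1>}\otimes_NX^{<2>}:=({}^L\mathrm{can})^{-1}(X\diamond1)$. It is faithfully flat if $P$ is a faithfully flat left $N$-module. An invertible normalised 2-cocycle on $\mathcal{L}$ is a left $B^e$-linear map $\Gamma:\mathcal{L}\otimes_{B^e}\mathcal{L}\to B$ (so $\Gamma(b\bar cX,Y)=b\Gamma(X,Y)c$), invertible for the convolution $(f*g)(X,Y)=f(X_{(1)},Y_{(1)})g(X_{(2)},Y_{(2)})$ with unit $\varepsilon(XY)$, such that $\Gamma(X,\Gamma(Y_{(1)},Z_{(1)})Y_{(2)}Z_{(2)})=\Gamma(\Gamma(X_{(1)},Y_{(1)})X_{(2)}Y_{(2)},Z)$, $\Gamma(1,X)=\varepsilon(X)=\Gamma(X,1)$ and $\Gamma(X,Yb)=\Gamma(X,Y\bar b)$. $\mathcal{L}^\Gamma$ is the left bialgebroid with product $X\cdot_\Gamma Y=\Gamma(X_{(1)},Y_{(1)})\overline{\Gamma^{-1}(X_{(3)},Y_{(3)})}X_{(2)}Y_{(2)}$ and the original coproduct, counit, source and target. ${}_\Gamma P$ is the comodule $P$ with product $p\cdot_\Gamma q=\Gamma(p_{(-1)},q_{(-1)})p_{(0)}q_{(0)}$; it is a left $\mathcal{L}^\Gamma$-comodule algebra. *)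

theory Defs
  imports HOL.Vector_Spaces "HOL-Algebra.Free_Abelian_Groups" "HOL-Algebra.Module"
begin

section \<open>Tensor products of modules over a noncommutative ring\<close>

text \<open>
  HOL-Algebra's \<open>module\<close> locale needs a commutative ring of scalars, so only its record type is
  used.  For a right module \<open>V\<close> the product \<open>v r\<close> is written \<open>r \<odot>\<^bsub>V\<^esub> v\<close>.
\<close>

definition right_mod :: "'r ring \<Rightarrow> ('r, 'm) module \<Rightarrow> bool" where
  "right_mod R V \<longleftrightarrow> ring R \<and> abelian_group V \<and>
    (\<forall>r\<in>carrier R. \<forall>v\<in>carrier V. r \<odot>\<^bsub>V\<^esub> v \<in> carrier V) \<and>
    (\<forall>r\<in>carrier R. \<forall>v\<in>carrier V. \<forall>w\<in>carrier V.
        r \<odot>\<^bsub>V\<^esub> (v \<oplus>\<^bsub>V\<^esub> w) = (r \<odot>\<^bsub>V\<^esub> v) \<oplus>\<^bsub>V\<^esub> (r \<odot>\<^bsub>V\<^esub> w)) \<and>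
    (\<forall>r\<in>carrier R. \<forall>r'\<in>carrier R. \<forall>v\<in>carrier V.
        (r \<oplus>\<^bsub>R\<^esub> r') \<odot>\<^bsub>V\<^esub> v = (r \<odot>\<^bsub>V\<^esub> v) \<oplus>\<^bsub>V\<^esub> (r' \<odot>\<^bsub>V\<^esub> v)) \<and>
    (\<forall>r\<in>carrier R. \<forall>r'\<in>carrier R. \<forall>v\<in>carrier V.
        (r \<otimes>\<^bsub>R\<^esub> r') \<odot>\<^bsub>V\<^esub> v = r' \<odot>\<^bsub>V\<^esub> (r \<odot>\<^bsub>V\<^esub> v)) \<and>
    (\<forall>v\<in>carrier V. \<one>\<^bsub>R\<^esub> \<odot>\<^bsub>V\<^esub> v = v)"

definition left_mod :: "'r ring \<Rightarrow> ('r, 'm) module \<Rightarrow> bool" where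
  "left_mod R V \<longleftrightarrow> ring R \<and> abelian_group V \<and>
    (\<forall>r\<in>carrier R. \<forall>v\<in>carrier V. r \<odot>\<^bsub>V\<^esub> v \<in> carrier V) \<and>
    (\<forall>r\<in>carrier R. \<forall>v\<in>carrier V. \<forall>w\<in>carrier V.
        r \<odot>\<^bsub>V\<^esub> (v \<oplus>\<^bsub>V\<^esub> w) = (r \<odot>\<^bsub>V\<^esub> v) \<oplus>\<^bsub>V\<^esub> (r \<odot>\<^bsub>V\<^esub> w)) \<and>
    (\<forall>r\<in>carrier R. \<forall>r'\<in>carrier R. \<forall>v\<in>carrier V.
        (r \<oplus>\<^bsub>R\<^esub> r') \<odot>\<^bsub>V\<^esub> v = (r \<odot>\<^bsub>V\<^esub> v) \<oplus>\<^bsub>V\<^esub> (r' \<odot>\<^bsub>V\<^esub> v)) \<and>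
    (\<forall>r\<in>carrier R. \<forall>r'\<in>carrier R. \<forall>v\<in>carrier V.
        (r \<otimes>\<^bsub>R\<^esub> r') \<odot>\<^bsub>V\<^esub> v = r \<odot>\<^bsub>V\<^esub> (r' \<odot>\<^bsub>V\<^esub> v)) \<and>
    (\<forall>v\<in>carrier V. \<one>\<^bsub>R\<^esub> \<odot>\<^bsub>V\<^esub> v = v)"

definition right_mod_hom :: "'r ring \<Rightarrow> ('r, 'm) module \<Rightarrow> ('r, 'n) module \<Rightarrow> ('m \<Rightarrow> 'n) set" where
  "right_mod_hom R V W = {f \<in> hom (add_monoid V) (add_monoid W).
     \<forall>r\<in>carrier R. \<forall>v\<in>carrier V. f (r \<odot>\<^bsub>V\<^esub> v) = r \<odot>\<^bsub>W\<^esub> f v}"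

text \<open>
  \<open>M \<otimes>\<^sub>R N\<close> is the free abelian group on \<open>M \<times> N\<close> modulo the biadditivity and balancing relations.
  Only the set of scalars enters.  Whenever a field \<open>k\<close> acts through \<open>R\<close>, as it does below,
  \<open>k\<close>-balancedness follows from \<open>R\<close>-balancedness, so this is also the quotient of \<open>M \<otimes>\<^sub>k N\<close>.
\<close>

definition ten_rels :: "'r set \<Rightarrow> ('r, 'm) module \<Rightarrow> ('r, 'n) module \<Rightarrow> ('m \<times> 'n \<Rightarrow>\<^sub>0 int) set" where
  "ten_rels R M N =
     {frag_of (m \<oplus>\<^bsub>M\<^esub> m', n) - frag_of (m, n) - frag_of (m', n) | m m' n.
        m \<in> carrier M \<and> m' \<in> carrier M \<and> n \<in> carrier N} \<union>
     {frag_of (m, n \<oplus>\<^bsub>N\<^esub> n') - frag_of (m, n) - frag_of (m, n') | m n n'.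
        m \<in> carrier M \<and> n \<in> carrier N \<and> n' \<in> carrier N} \<union>
     {frag_of (r \<odot>\<^bsub>M\<^esub> m, n) - frag_of (m, r \<odot>\<^bsub>N\<^esub> n) | r m n.
        r \<in> R \<and> m \<in> carrier M \<and> n \<in> carrier N}"

definition ten_null :: "'r set \<Rightarrow> ('r, 'm) module \<Rightarrow> ('r, 'n) module \<Rightarrow> ('m \<times> 'n \<Rightarrow>\<^sub>0 int) set" where
  "ten_null R M N = generate (free_Abelian_group (carrier M \<times> carrier N)) (ten_rels R M N)"

definition tensor :: "'r set \<Rightarrow> ('r, 'm) module \<Rightarrow> ('r, 'n) module \<Rightarrow> ('m \<times> 'n \<Rightarrow>\<^sub>0 int) set monoid" where
  "tensor R M N = free_Abelian_group (carrier M \<times> carrier N) Mod ten_null R M N"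

definition tcls :: "'r set \<Rightarrow> ('r, 'm) module \<Rightarrow> ('r, 'n) module \<Rightarrow>
    ('m \<times> 'n \<Rightarrow>\<^sub>0 int) \<Rightarrow> ('m \<times> 'n \<Rightarrow>\<^sub>0 int) set" where
  "tcls R M N x = ten_null R M N #>\<^bsub>free_Abelian_group (carrier M \<times> carrier N)\<^esub> x"

text \<open>
  A formal sum \<open>\<Sum> m\<^sub>i \<otimes> n\<^sub>i\<close> representing an element of a tensor product; this is how Sweedler
  notation is rendered.  All expressions in which \<open>rep\<close> is used below are independent of the choice.
\<close>

definition rep :: "'x set \<Rightarrow> 'x" where
  "rep c = (SOME x. x \<in> c)"

definition fmap2 :: "('m \<Rightarrow> 'm') \<Rightarrow> ('n \<Rightarrow> 'n') \<Rightarrow> ('m \<times> 'n \<Rightarrow>\<^sub>0 int) \<Rightarrow> ('m' \<times> 'n' \<Rightarrow>\<^sub>0 int)" where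
  "fmap2 f g = frag_extend (\<lambda>(m, n). frag_of (f m, g n))"

text \<open>
  HOL cannot quantify over all types of modules, so the test sequences have carriers in a universe
  \<open>'u\<close>.  The notion does not depend on \<open>'u\<close> as soon as the right ideals of \<open>R\<close> and their quotients
  \<open>R/I\<close> have copies in \<open>'u\<close>: exactness on the sequences \<open>0 \<rightarrow> I \<rightarrow> R\<close> gives flatness, and reflection on
  \<open>0 \<rightarrow> R/I \<rightarrow> 0\<close> gives faithfulness.
\<close>

definition faithfully_flat :: "'u itself \<Rightarrow> 'r ring \<Rightarrow> ('r, 'm) module \<Rightarrow> bool" where
  "faithfully_flat _ R M \<longleftrightarrow> left_mod R M \<and>
    (\<forall>(U :: ('r, 'u) module) V W f g.
       right_mod R U \<longrightarrow> right_mod R V \<longrightarrow> right_mod R W \<longrightarrow>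
       f \<in> right_mod_hom R U V \<longrightarrow> g \<in> right_mod_hom R V W \<longrightarrow>
       (let T = (\<lambda>X. tensor (carrier R) X M);
            ind = (\<lambda>Y h c. tcls (carrier R) Y M (fmap2 h id (rep c)))
        in f ` carrier U = kernel (add_monoid V) (add_monoid W) g \<longleftrightarrow>
           ind V f ` carrier (T U) = kernel (T V) (T W) (ind W g)))"

text \<open>Contains all subsets of \<open>'a\<close> (up to a copy), and the tensor products of \<open>'a\<close> with itself.\<close>

type_synonym 'a universe = "('a \<times> 'a \<Rightarrow>\<^sub>0 int) set"


section \<open>Algebras\<close>

text \<open>
  The underlying additive group is the whole type.  The multiplication is a record field because
  two products on the same space have to be compared.
\<close>

record ('k, 'a) alg =
  scl :: "'k \<Rightarrow> 'a \<Rightarrow> 'a"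
  prd :: "'a \<Rightarrow> 'a \<Rightarrow> 'a" (infixl \<open>\<cdot>\<index>\<close> 70)
  unt :: 'a

definition k_algebra :: "('k::field, 'a::ab_group_add, 'z) alg_scheme \<Rightarrow> bool" where
  "k_algebra A \<longleftrightarrow> vector_space (scl A) \<and>
    (\<forall>x y z. (x \<cdot>\<^bsub>A\<^esub> y) \<cdot>\<^bsub>A\<^esub> z = x \<cdot>\<^bsub>A\<^esub> (y \<cdot>\<^bsub>A\<^esub> z)) \<and>
    (\<forall>x. unt A \<cdot>\<^bsub>A\<^esub> x = x \<and> x \<cdot>\<^bsub>A\<^esub> unt A = x) \<and>
    (\<forall>x y z. x \<cdot>\<^bsub>A\<^esub> (y + z) = x \<cdot>\<^bsub>A\<^esub> y + x \<cdot>\<^bsub>A\<^esub> z \<and> (x + y) \<cdot>\<^bsub>A\<^esub> z = x \<cdot>\<^bsub>A\<^esub> z + y \<cdot>\<^bsub>A\<^esub> z) \<and>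
    (\<forall>c x y. scl A c x \<cdot>\<^bsub>A\<^esub> y = scl A c (x \<cdot>\<^bsub>A\<^esub> y) \<and> x \<cdot>\<^bsub>A\<^esub> scl A c y = scl A c (x \<cdot>\<^bsub>A\<^esub> y))"

definition op_alg :: "('k, 'a) alg \<Rightarrow> ('k, 'a) alg" where
  "op_alg A = A\<lparr>prd := \<lambda>x y. y \<cdot>\<^bsub>A\<^esub> x\<rparr>"

definition alg_hom :: "('k::field, 'a::ab_group_add, 'y) alg_scheme \<Rightarrow>
    ('k, 'c::ab_group_add, 'z) alg_scheme \<Rightarrow> ('a \<Rightarrow> 'c) \<Rightarrow> bool" where
  "alg_hom A C f \<longleftrightarrow> Vector_Spaces.linear (scl A) (scl C) f \<and> f (unt A) = unt C \<and>
    (\<forall>x y. f (x \<cdot>\<^bsub>A\<^esub> y) = f x \<cdot>\<^bsub>C\<^esub> f y)"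

definition ring_of :: "('k, 'a::ab_group_add, 'z) alg_scheme \<Rightarrow> 'a set \<Rightarrow> 'a ring" where
  "ring_of A S = \<lparr>carrier = S, monoid.mult = prd A, one = unt A, zero = 0, add = (+)\<rparr>"

text \<open>The fields \<open>mult\<close> and \<open>one\<close> of the \<open>module\<close> record play no role.\<close>

definition tmod :: "('r \<Rightarrow> 'm \<Rightarrow> 'm) \<Rightarrow> ('r, 'm::ab_group_add) module" where
  "tmod act = \<lparr>carrier = UNIV, monoid.mult = undefined, one = undefined, zero = 0, add = (+),
     smult = act\<rparr>"

text \<open>The value \<open>\<Sum> f m\<^sub>i n\<^sub>i\<close> of an \<open>A\<close>-valued function on a formal sum \<open>\<Sum> m\<^sub>i \<otimes> n\<^sub>i\<close>.\<close>

definition vsum :: "('k::field, 'a::ab_group_add, 'z) alg_scheme \<Rightarrow> ('x \<Rightarrow> 'a) \<Rightarrow> ('x \<Rightarrow>\<^sub>0 int) \<Rightarrow> 'a" where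
  "vsum A f c = (\<Sum>x\<in>Poly_Mapping.keys c. scl A (of_int (Poly_Mapping.lookup c x)) (f x))"


section \<open>Left bialgebroids\<close>

text \<open>
  \<open>tgt L b\<close> is the image of \<open>\<bar>b\<close>, so \<open>tgt L\<close> is an algebra map on the opposite algebra.
  The coproduct takes values in the quotient \<open>\<L> \<diamond>\<^sub>B \<L>\<close>, i.e. in cosets of formal sums.
\<close>

record ('k, 'b, 'l) bialgd = "('k, 'l) alg" +
  src :: "'b \<Rightarrow> 'l"
  tgt :: "'b \<Rightarrow> 'l"
  cop :: "'l \<Rightarrow> ('l \<times> 'l \<Rightarrow>\<^sub>0 int) set"
  cou :: "'l \<Rightarrow> 'b"

text \<open>\<open>\<L> \<diamond>\<^sub>B N\<close> for a left \<open>B\<close>-module \<open>N\<close> with action \<open>lact\<close>, and the class of a formal sum in it.\<close>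

definition diamond :: "('k, 'b, 'l::ab_group_add) bialgd \<Rightarrow> ('b \<Rightarrow> 'n \<Rightarrow> 'n) \<Rightarrow>
    ('l \<times> 'n::ab_group_add \<Rightarrow>\<^sub>0 int) set monoid" where
  "diamond L lact = tensor UNIV (tmod (\<lambda>b X. tgt L b \<cdot>\<^bsub>L\<^esub> X)) (tmod lact)"

definition dcls :: "('k, 'b, 'l::ab_group_add) bialgd \<Rightarrow> ('b \<Rightarrow> 'n \<Rightarrow> 'n) \<Rightarrow>
    ('l \<times> 'n::ab_group_add \<Rightarrow>\<^sub>0 int) \<Rightarrow> ('l \<times> 'n \<Rightarrow>\<^sub>0 int) set" where
  "dcls L lact = tcls UNIV (tmod (\<lambda>b X. tgt L b \<cdot>\<^bsub>L\<^esub> X)) (tmod lact)"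

text \<open>\<open>\<L> \<times>\<^sub>B N\<close>, where \<open>ract a n\<close> is the right action \<open>n a\<close>.\<close>

definition takeuchi :: "('k, 'b, 'l::ab_group_add) bialgd \<Rightarrow> ('b \<Rightarrow> 'n \<Rightarrow> 'n) \<Rightarrow> ('b \<Rightarrow> 'n \<Rightarrow> 'n) \<Rightarrow>
    ('l \<times> 'n::ab_group_add \<Rightarrow>\<^sub>0 int) set set" where
  "takeuchi L lact ract = {c \<in> carrier (diamond L lact).
     \<forall>a. dcls L lact (fmap2 (\<lambda>X. X \<cdot>\<^bsub>L\<^esub> tgt L a) id (rep c)) = dcls L lact (fmap2 id (ract a) (rep c))}"

text \<open>The subgroup of formal sums that vanish in \<open>\<L> \<diamond>\<^sub>B \<L> \<diamond>\<^sub>B N\<close>.\<close>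

definition diamond3_null :: "('k, 'b, 'l::ab_group_add) bialgd \<Rightarrow> ('b \<Rightarrow> 'n \<Rightarrow> 'n) \<Rightarrow>
    ('l \<times> 'l \<times> 'n::ab_group_add \<Rightarrow>\<^sub>0 int) set" where
  "diamond3_null L lact = generate (free_Abelian_group UNIV)
     ({frag_of (X + X', Y, n) - frag_of (X, Y, n) - frag_of (X', Y, n) | X X' Y n. True} \<union>
      {frag_of (X, Y + Y', n) - frag_of (X, Y, n) - frag_of (X, Y', n) | X Y Y' n. True} \<union>
      {frag_of (X, Y, n + n') - frag_of (X, Y, n) - frag_of (X, Y, n') | X Y n n'. True} \<union>
      {frag_of (tgt L b \<cdot>\<^bsub>L\<^esub> X, Y, n) - frag_of (X, src L b \<cdot>\<^bsub>L\<^esub> Y, n) | b X Y n. True} \<union>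
      {frag_of (X, tgt L b \<cdot>\<^bsub>L\<^esub> Y, n) - frag_of (X, Y, lact b n) | b X Y n. True})"

text \<open>\<open>(\<Delta> \<otimes> id) \<circ> \<delta> = (id \<otimes> \<delta>) \<circ> \<delta>\<close> as maps to \<open>\<L> \<diamond>\<^sub>B \<L> \<diamond>\<^sub>B N\<close>.\<close>

definition coassociative :: "('k, 'b, 'l::ab_group_add) bialgd \<Rightarrow> ('b \<Rightarrow> 'n \<Rightarrow> 'n) \<Rightarrow>
    ('n::ab_group_add \<Rightarrow> ('l \<times> 'n \<Rightarrow>\<^sub>0 int) set) \<Rightarrow> bool" where
  "coassociative L lact \<delta> \<longleftrightarrow> (\<forall>p.
     frag_extend (\<lambda>(X, q). frag_extend (\<lambda>(X1, X2). frag_of (X1, X2, q)) (rep (cop L X))) (rep (\<delta> p)) -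
     frag_extend (\<lambda>(X, q). frag_extend (\<lambda>(Y, r). frag_of (X, Y, r)) (rep (\<delta> q))) (rep (\<delta> p))
       \<in> diamond3_null L lact)"

text \<open>The componentwise product of formal sums.\<close>

definition fprod :: "('l \<Rightarrow> 'l \<Rightarrow> 'l) \<Rightarrow> ('n \<Rightarrow> 'n \<Rightarrow> 'n) \<Rightarrow>
    ('l \<times> 'n \<Rightarrow>\<^sub>0 int) \<Rightarrow> ('l \<times> 'n \<Rightarrow>\<^sub>0 int) \<Rightarrow> ('l \<times> 'n \<Rightarrow>\<^sub>0 int)" where
  "fprod f g x y = frag_extend (\<lambda>(X, p). fmap2 (f X) (g p) y) x"

definition left_bialgebroid :: "('k::field, 'b::ab_group_add) alg \<Rightarrow>
    ('k, 'b, 'l::ab_group_add) bialgd \<Rightarrow> bool" where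
  "left_bialgebroid B L \<longleftrightarrow>
     (let lact = (\<lambda>b X. src L b \<cdot>\<^bsub>L\<^esub> X); ract = (\<lambda>b X. X \<cdot>\<^bsub>L\<^esub> src L b) in
     k_algebra B \<and> k_algebra L \<and>
     alg_hom B L (src L) \<and> alg_hom (op_alg B) L (tgt L) \<and>
     (\<forall>b c. src L b \<cdot>\<^bsub>L\<^esub> tgt L c = tgt L c \<cdot>\<^bsub>L\<^esub> src L b) \<and>
     \<comment> \<open>coproduct\<close>
     (\<forall>X. cop L X \<in> takeuchi L lact ract) \<and>
     (\<forall>X Y. cop L (X + Y) = cop L X \<otimes>\<^bsub>diamond L lact\<^esub> cop L Y) \<and>
     (\<forall>b c X. cop L (src L b \<cdot>\<^bsub>L\<^esub> tgt L c \<cdot>\<^bsub>L\<^esub> X) =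
        dcls L lact (fmap2 (\<lambda>X1. src L b \<cdot>\<^bsub>L\<^esub> X1) (\<lambda>X2. tgt L c \<cdot>\<^bsub>L\<^esub> X2) (rep (cop L X)))) \<and>
     coassociative L lact (cop L) \<and>
     cop L (unt L) = dcls L lact (frag_of (unt L, unt L)) \<and>
     (\<forall>X Y. cop L (X \<cdot>\<^bsub>L\<^esub> Y) = dcls L lact (fprod (prd L) (prd L) (rep (cop L X)) (rep (cop L Y)))) \<and>
     \<comment> \<open>counit\<close>
     (\<forall>X Y. cou L (X + Y) = cou L X + cou L Y) \<and>
     (\<forall>b c X. cou L (src L b \<cdot>\<^bsub>L\<^esub> tgt L c \<cdot>\<^bsub>L\<^esub> X) = b \<cdot>\<^bsub>B\<^esub> cou L X \<cdot>\<^bsub>B\<^esub> c) \<and>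
     (\<forall>X. vsum L (\<lambda>(X1, X2). src L (cou L X1) \<cdot>\<^bsub>L\<^esub> X2) (rep (cop L X)) = X) \<and>
     (\<forall>X. vsum L (\<lambda>(X1, X2). tgt L (cou L X2) \<cdot>\<^bsub>L\<^esub> X1) (rep (cop L X)) = X) \<and>
     cou L (unt L) = unt B \<and>
     (\<forall>X Y. cou L (X \<cdot>\<^bsub>L\<^esub> src L (cou L Y)) = cou L (X \<cdot>\<^bsub>L\<^esub> Y) \<and>
            cou L (X \<cdot>\<^bsub>L\<^esub> Y) = cou L (X \<cdot>\<^bsub>L\<^esub> tgt L (cou L Y))))"


subsection \<open>The map \<open>\<lambda>\<close> and its inverse\<close>

definition tens_Bop :: "('k, 'b, 'l::ab_group_add) bialgd \<Rightarrow> ('l \<times> 'l \<Rightarrow>\<^sub>0 int) set monoid" where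
  "tens_Bop L = tensor UNIV (tmod (\<lambda>b X. X \<cdot>\<^bsub>L\<^esub> tgt L b)) (tmod (\<lambda>b Y. tgt L b \<cdot>\<^bsub>L\<^esub> Y))"

definition hopf_map :: "('k, 'b, 'l::ab_group_add) bialgd \<Rightarrow>
    ('l \<times> 'l \<Rightarrow>\<^sub>0 int) set \<Rightarrow> ('l \<times> 'l \<Rightarrow>\<^sub>0 int) set" where
  "hopf_map L c = dcls L (\<lambda>b X. src L b \<cdot>\<^bsub>L\<^esub> X)
     (frag_extend (\<lambda>(X, Y). fmap2 id (\<lambda>X2. X2 \<cdot>\<^bsub>L\<^esub> Y) (rep (cop L X))) (rep c))"

text \<open>\<open>X\<^sub>+ \<otimes> X\<^sub>-\<close>; meaningful when \<open>hopf_map L\<close> is a bijection from \<open>tens_Bop L\<close>.\<close>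

definition plus_minus :: "('k, 'b, 'l::ab_group_add) bialgd \<Rightarrow> 'l \<Rightarrow> ('l \<times> 'l \<Rightarrow>\<^sub>0 int) set" where
  "plus_minus L X = inv_into (carrier (tens_Bop L)) (hopf_map L)
     (dcls L (\<lambda>b X. src L b \<cdot>\<^bsub>L\<^esub> X) (frag_of (X, unt L)))"


section \<open>Comodule algebras and Galois extensions\<close>

record ('k, 'b, 'l, 'p) comodalg = "('k, 'p) alg" +
  emb :: "'b \<Rightarrow> 'p"
  coact :: "'p \<Rightarrow> ('l \<times> 'p \<Rightarrow>\<^sub>0 int) set"

abbreviation blact :: "('k, 'b, 'l, 'p) comodalg \<Rightarrow> 'b \<Rightarrow> 'p \<Rightarrow> 'p" where
  "blact P \<equiv> \<lambda>b p. emb P b \<cdot>\<^bsub>P\<^esub> p"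

abbreviation bract :: "('k, 'b, 'l, 'p) comodalg \<Rightarrow> 'b \<Rightarrow> 'p \<Rightarrow> 'p" where
  "bract P \<equiv> \<lambda>b p. p \<cdot>\<^bsub>P\<^esub> emb P b"

definition comodule_algebra :: "('k::field, 'b::ab_group_add) alg \<Rightarrow>
    ('k, 'b, 'l::ab_group_add) bialgd \<Rightarrow> ('k, 'b, 'l, 'p::ab_group_add) comodalg \<Rightarrow> bool" where
  "comodule_algebra B L P \<longleftrightarrow>
     k_algebra P \<and> alg_hom B P (emb P) \<and>
     \<comment> \<open>left comodule\<close>
     (\<forall>p. coact P p \<in> takeuchi L (blact P) (bract P)) \<and>
     (\<forall>p q. coact P (p + q) = coact P p \<otimes>\<^bsub>diamond L (blact P)\<^esub> coact P q) \<and>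
     (\<forall>b b' p. coact P (emb P b \<cdot>\<^bsub>P\<^esub> p \<cdot>\<^bsub>P\<^esub> emb P b') =
        dcls L (blact P) (fmap2 (\<lambda>X. src L b \<cdot>\<^bsub>L\<^esub> X \<cdot>\<^bsub>L\<^esub> src L b') id (rep (coact P p)))) \<and>
     coassociative L (blact P) (coact P) \<and>
     (\<forall>p. vsum P (\<lambda>(X, q). emb P (cou L X) \<cdot>\<^bsub>P\<^esub> q) (rep (coact P p)) = p) \<and>
     \<comment> \<open>the coaction is a map of \<open>B\<close>-rings\<close>
     (\<forall>b. coact P (emb P b) = dcls L (blact P) (frag_of (src L b, unt P))) \<and>
     coact P (unt P) = dcls L (blact P) (frag_of (unt L, unt P)) \<and>
     (\<forall>p q. coact P (p \<cdot>\<^bsub>P\<^esub> q) =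
        dcls L (blact P) (fprod (prd L) (prd P) (rep (coact P p)) (rep (coact P q))))"

definition coinvariants :: "('k, 'b, 'l::ab_group_add) bialgd \<Rightarrow>
    ('k, 'b, 'l, 'p::ab_group_add) comodalg \<Rightarrow> 'p set" where
  "coinvariants L P = {p. coact P p = dcls L (blact P) (frag_of (unt L, p))}"

text \<open>\<open>P \<otimes>\<^sub>N P\<close>, and the class of a formal sum in it.\<close>

definition tens_N :: "('k, 'b, 'l, 'p::ab_group_add) comodalg \<Rightarrow> 'p set \<Rightarrow> ('p \<times> 'p \<Rightarrow>\<^sub>0 int) set monoid" where
  "tens_N P N = tensor N (tmod (\<lambda>n p. p \<cdot>\<^bsub>P\<^esub> n)) (tmod (\<lambda>n q. n \<cdot>\<^bsub>P\<^esub> q))"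

definition ncls :: "('k, 'b, 'l, 'p::ab_group_add) comodalg \<Rightarrow> 'p set \<Rightarrow>
    ('p \<times> 'p \<Rightarrow>\<^sub>0 int) \<Rightarrow> ('p \<times> 'p \<Rightarrow>\<^sub>0 int) set" where
  "ncls P N = tcls N (tmod (\<lambda>n p. p \<cdot>\<^bsub>P\<^esub> n)) (tmod (\<lambda>n q. n \<cdot>\<^bsub>P\<^esub> q))"

definition left_can :: "('k, 'b, 'l::ab_group_add) bialgd \<Rightarrow> ('k, 'b, 'l, 'p::ab_group_add) comodalg \<Rightarrow>
    ('p \<times> 'p \<Rightarrow>\<^sub>0 int) set \<Rightarrow> ('l \<times> 'p \<Rightarrow>\<^sub>0 int) set" where
  "left_can L P c = dcls L (blact P)
     (frag_extend (\<lambda>(p, q). fmap2 id (\<lambda>p0. p0 \<cdot>\<^bsub>P\<^esub> q) (rep (coact P p))) (rep c))"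

definition left_galois :: "('k::field, 'b::ab_group_add) alg \<Rightarrow>
    ('k, 'b, 'l::ab_group_add) bialgd \<Rightarrow> ('k, 'b, 'l, 'p::ab_group_add) comodalg \<Rightarrow> 'p set \<Rightarrow> bool" where
  "left_galois B L P N \<longleftrightarrow> left_bialgebroid B L \<and> comodule_algebra B L P \<and>
     N = coinvariants L P \<and>
     bij_betw (left_can L P) (carrier (tens_N P N)) (carrier (diamond L (blact P)))"

definition left_trans :: "('k, 'b, 'l::ab_group_add) bialgd \<Rightarrow> ('k, 'b, 'l, 'p::ab_group_add) comodalg \<Rightarrow>
    'p set \<Rightarrow> 'l \<Rightarrow> ('p \<times> 'p \<Rightarrow>\<^sub>0 int) set" where
  "left_trans L P N X = inv_into (carrier (tens_N P N)) (left_can L P)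
     (dcls L (blact P) (frag_of (X, unt P)))"

text \<open>
  The blanket assumption on \<open>B\<close>- and \<open>B\<^sup>o\<^sup>p\<close>-module structures.  A right module over a ring is a left
  module over the opposite ring; \<open>op_alg (op_alg B) = B\<close>.  Since \<open>cou L (src L b) = b\<close>, \<open>B\<close> embeds
  into \<open>'l\<close>, so \<open>'l universe\<close> is large enough for modules over \<open>B\<close>.
\<close>

definition base_faithfully_flat :: "('k::field, 'b::ab_group_add) alg \<Rightarrow>
    ('k, 'b, 'l::ab_group_add) bialgd \<Rightarrow> ('k, 'b, 'l, 'p::ab_group_add) comodalg \<Rightarrow> bool" where
  "base_faithfully_flat B L P \<longleftrightarrow>
     (let R = ring_of B UNIV; R' = ring_of (op_alg B) UNIV; U = TYPE('l universe) in
     faithfully_flat U R (tmod (\<lambda>b X. src L b \<cdot>\<^bsub>L\<^esub> X)) \<and>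
     faithfully_flat U R' (tmod (\<lambda>b X. tgt L b \<cdot>\<^bsub>L\<^esub> X)) \<and>
     faithfully_flat U R' (tmod (\<lambda>b X. X \<cdot>\<^bsub>L\<^esub> src L b)) \<and>
     faithfully_flat U R (tmod (\<lambda>b X. X \<cdot>\<^bsub>L\<^esub> tgt L b)) \<and>
     faithfully_flat U R (tmod (blact P)) \<and>
     faithfully_flat U R' (tmod (bract P)))"

text \<open>\<open>P\<close> is a faithfully flat left \<open>N\<close>-module.\<close>

definition N_faithfully_flat :: "('k, 'b, 'l, 'p::ab_group_add) comodalg \<Rightarrow> 'p set \<Rightarrow> bool" where
  "N_faithfully_flat P N \<longleftrightarrow>
     faithfully_flat TYPE('p universe) (ring_of P N) (tmod (\<lambda>n p. n \<cdot>\<^bsub>P\<^esub> p))"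


section \<open>Cocycles and twisting\<close>

text \<open>
  Left \<open>B\<^sup>e\<close>-linear maps \<open>\<L> \<otimes>\<^bsub>B\<^sup>e\<^esub> \<L> \<rightarrow> B\<close>, given as balanced biadditive maps on \<open>\<L> \<times> \<L>\<close>.
\<close>

definition Be_maps :: "('k, 'b::ab_group_add) alg \<Rightarrow> ('k, 'b, 'l::ab_group_add) bialgd \<Rightarrow>
    ('l \<Rightarrow> 'l \<Rightarrow> 'b) set" where
  "Be_maps B L = {f.
     (\<forall>X X' Y. f (X + X') Y = f X Y + f X' Y) \<and>
     (\<forall>X Y Y'. f X (Y + Y') = f X Y + f X Y') \<and>
     (\<forall>b c X Y. f (X \<cdot>\<^bsub>L\<^esub> (src L b \<cdot>\<^bsub>L\<^esub> tgt L c)) Y = f X ((src L b \<cdot>\<^bsub>L\<^esub> tgt L c) \<cdot>\<^bsub>L\<^esub> Y)) \<and>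
     (\<forall>b c X Y. f (src L b \<cdot>\<^bsub>L\<^esub> tgt L c \<cdot>\<^bsub>L\<^esub> X) Y = b \<cdot>\<^bsub>B\<^esub> f X Y \<cdot>\<^bsub>B\<^esub> c)}"

definition conv :: "('k::field, 'b::ab_group_add) alg \<Rightarrow> ('k, 'b, 'l::ab_group_add) bialgd \<Rightarrow>
    ('l \<Rightarrow> 'l \<Rightarrow> 'b) \<Rightarrow> ('l \<Rightarrow> 'l \<Rightarrow> 'b) \<Rightarrow> 'l \<Rightarrow> 'l \<Rightarrow> 'b" where
  "conv B L f g X Y =
     vsum B (\<lambda>(X1, X2). vsum B (\<lambda>(Y1, Y2). f X1 Y1 \<cdot>\<^bsub>B\<^esub> g X2 Y2) (rep (cop L Y))) (rep (cop L X))"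

definition is_conv_inverse :: "('k::field, 'b::ab_group_add) alg \<Rightarrow> ('k, 'b, 'l::ab_group_add) bialgd \<Rightarrow>
    ('l \<Rightarrow> 'l \<Rightarrow> 'b) \<Rightarrow> ('l \<Rightarrow> 'l \<Rightarrow> 'b) \<Rightarrow> bool" where
  "is_conv_inverse B L f g \<longleftrightarrow> g \<in> Be_maps B L \<and>
     (\<forall>X Y. conv B L f g X Y = cou L (X \<cdot>\<^bsub>L\<^esub> Y)) \<and> (\<forall>X Y. conv B L g f X Y = cou L (X \<cdot>\<^bsub>L\<^esub> Y))"

text \<open>Convolution inverses are unique, so this is the inverse whenever there is one.\<close>

definition conv_inv :: "('k::field, 'b::ab_group_add) alg \<Rightarrow> ('k, 'b, 'l::ab_group_add) bialgd \<Rightarrow>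
    ('l \<Rightarrow> 'l \<Rightarrow> 'b) \<Rightarrow> 'l \<Rightarrow> 'l \<Rightarrow> 'b" where
  "conv_inv B L f = (SOME g. is_conv_inverse B L f g)"

definition invertible_normalised_cocycle :: "('k::field, 'b::ab_group_add) alg \<Rightarrow>
    ('k, 'b, 'l::ab_group_add) bialgd \<Rightarrow> ('l \<Rightarrow> 'l \<Rightarrow> 'b) \<Rightarrow> bool" where
  "invertible_normalised_cocycle B L \<Gamma> \<longleftrightarrow>
     \<Gamma> \<in> Be_maps B L \<and>
     (\<exists>g. is_conv_inverse B L \<Gamma> g) \<and>
     (\<forall>X Y Z.
        \<Gamma> X (vsum L (\<lambda>(Y1, Y2). vsum L (\<lambda>(Z1, Z2). src L (\<Gamma> Y1 Z1) \<cdot>\<^bsub>L\<^esub> Y2 \<cdot>\<^bsub>L\<^esub> Z2) (rep (cop L Z)))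
               (rep (cop L Y))) =
        \<Gamma> (vsum L (\<lambda>(X1, X2). vsum L (\<lambda>(Y1, Y2). src L (\<Gamma> X1 Y1) \<cdot>\<^bsub>L\<^esub> X2 \<cdot>\<^bsub>L\<^esub> Y2) (rep (cop L Y)))
               (rep (cop L X))) Z) \<and>
     (\<forall>X. \<Gamma> (unt L) X = cou L X \<and> \<Gamma> X (unt L) = cou L X) \<and>
     (\<forall>X Y b. \<Gamma> X (Y \<cdot>\<^bsub>L\<^esub> src L b) = \<Gamma> X (Y \<cdot>\<^bsub>L\<^esub> tgt L b))"

text \<open>A formal sum representing \<open>X\<^sub>1 \<otimes> X\<^sub>2 \<otimes> X\<^sub>3\<close>.\<close>

definition cop2 :: "('k, 'b, 'l) bialgd \<Rightarrow> 'l \<Rightarrow> ('l \<times> 'l \<times> 'l \<Rightarrow>\<^sub>0 int)" where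
  "cop2 L X = frag_extend (\<lambda>(X12, X3). frag_extend (\<lambda>(X1, X2). frag_of (X1, X2, X3)) (rep (cop L X12)))
     (rep (cop L X))"

definition twist_bialgd :: "('k::field, 'b::ab_group_add) alg \<Rightarrow> ('l \<Rightarrow> 'l \<Rightarrow> 'b) \<Rightarrow>
    ('k, 'b, 'l::ab_group_add) bialgd \<Rightarrow> ('k, 'b, 'l) bialgd" where
  "twist_bialgd B \<Gamma> L = L\<lparr>prd := \<lambda>X Y.
     vsum L (\<lambda>(X1, X2, X3). vsum L (\<lambda>(Y1, Y2, Y3).
         src L (\<Gamma> X1 Y1) \<cdot>\<^bsub>L\<^esub> tgt L (conv_inv B L \<Gamma> X3 Y3) \<cdot>\<^bsub>L\<^esub> X2 \<cdot>\<^bsub>L\<^esub> Y2)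
       (cop2 L Y)) (cop2 L X)\<rparr>"

definition twist_comodalg :: "('l \<Rightarrow> 'l \<Rightarrow> 'b) \<Rightarrow>
    ('k::field, 'b, 'l, 'p::ab_group_add) comodalg \<Rightarrow> ('k, 'b, 'l, 'p) comodalg" where
  "twist_comodalg \<Gamma> P = P\<lparr>prd := \<lambda>p q.
     vsum P (\<lambda>(X, p0). vsum P (\<lambda>(Y, q0). emb P (\<Gamma> X Y) \<cdot>\<^bsub>P\<^esub> p0 \<cdot>\<^bsub>P\<^esub> q0) (rep (coact P q)))
       (rep (coact P p))\<rparr>"

end

theory Submission
  imports Defs
begin

text \<open>
  The canonical map of \<open>\<^sub>\<Gamma>P\<close> sends \<open>p \<otimes> q\<close> to \<open>p\<^sub>-\<^sub>1 \<otimes> p\<^sub>0 \<cdot>\<^sub>\<Gamma> q\<close>, and its inverse can be written down: it sends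
  \<open>X \<otimes> r\<close> to \<open>X\<^sub>1\<^sup><\<^sup>1\<^sup>> \<otimes> (\<Gamma>\<^sup>-\<^sup>1(X\<^sub>1\<^sup><\<^sup>2\<^sup>>\<^sub>-\<^sub>1, X\<^sub>2) X\<^sub>1\<^sup><\<^sup>2\<^sup>>\<^sub>0) \<cdot>\<^sub>\<Gamma> r\<close>.  One composite is the identity because
  \<open>p\<^sub>-\<^sub>1\<^sup><\<^sup>1\<^sup>> \<otimes> p\<^sub>-\<^sub>1\<^sup><\<^sup>2\<^sup>>p\<^sub>0 = p \<otimes> 1\<close> and \<open>\<Gamma>\<^sup>-\<^sup>1 * \<Gamma> = \<epsilon>\<close> (\<open>twisted_can_left_inverse\<close>).  The other one needs the
  cocycle condition, in the form \<open>\<Gamma>(X, \<Gamma>\<^sup>-\<^sup>1(Y\<^sub>1, Z)Y\<^sub>2) = \<Gamma>(X\<^sub>1, Y\<^sub>1Z\<^sub>1) \<Gamma>\<^sup>-\<^sup>1(X\<^sub>2Y\<^sub>2, Z\<^sub>2)\<close> (\<open>\<Gamma>_utw\<close>).  With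
  \<open>p \<otimes> q\<close> the translation of \<open>X\<^sub>1\<close>, the identity \<open>p\<^sub>-\<^sub>1 \<otimes> q\<^sub>-\<^sub>1X\<^sub>2 \<otimes> p\<^sub>0q\<^sub>0 = X \<otimes> 1 \<otimes> 1\<close> (\<open>T_coact_cancel\<close>)
  then leaves only values of \<open>\<Gamma>\<close> and \<open>\<Gamma>\<^sup>-\<^sup>1\<close> at \<open>1\<close>, which are counits (\<open>twisted_can_right_inverse\<close>).

  The theorem states the inverse with \<open>X\<^sub>+ \<otimes> X\<^sub>-\<close>.  The two forms agree by
  \<open>X\<^sub>+\<^sup><\<^sup>1\<^sup>> \<otimes> X\<^sub>- \<otimes> X\<^sub>+\<^sup><\<^sup>2\<^sup>> = X\<^sup><\<^sup>1\<^sup>> \<otimes> X\<^sup><\<^sup>2\<^sup>>\<^sub>-\<^sub>1 \<otimes> X\<^sup><\<^sup>2\<^sup>>\<^sub>0\<close> (\<open>T_plus_minus\<close>), which presupposes that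
  \<open>X \<otimes> 1\<close> has a preimage under \<open>\<lambda>\<close>.  After tensoring with \<open>P\<close>, preimages under \<open>\<lambda>\<close> are built from the translation
  map (\<open>cover_eq\<close>), and \<open>P\<close> is a faithfully flat left \<open>B\<close>-module, so \<open>\<lambda>\<close> itself is onto (\<open>hopf_map_onto\<close>).

  That \<open>\<L>\<^sup>\<Gamma>\<close> is a left bialgebroid with comodule algebra \<open>\<^sub>\<Gamma>P\<close> is part of the claim.  The twist from the left
  is associative by the cocycle condition (\<open>tw_assoc\<close>).  The twist of \<open>\<L>\<close> from the right,
  \<open>X \<rhd> Y = \<Gamma>\<^sup>-\<^sup>1(X\<^sub>2, Y\<^sub>2) X\<^sub>1Y\<^sub>1\<close> with the scalar acting through the target, is associative by the mirrored condition for
  \<open>\<Gamma>\<^sup>-\<^sup>1\<close> (\<open>\<Gamma>i_cocycle\<close>), a consequence of the uniqueness of inverses in a three-variable convolution algebra.  Since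
  \<open>(\<L>, \<rhd>)\<close> is again an \<open>\<L>\<close>-comodule algebra and \<open>\<L>\<^sup>\<Gamma>\<close> is its twist from the left, associativity of \<open>\<L>\<^sup>\<Gamma>\<close> and
  multiplicativity of its coproduct are instances of what holds for \<open>\<^sub>\<Gamma>P\<close> (\<open>C_tw_stw\<close>).

  All identities between tensors are proved as equations \<open>\<ointegral>x y\<in>c. \<beta> x y = \<ointegral>x y\<in>d. \<beta> x y\<close> for arbitrary
  balanced maps \<open>\<beta>\<close> into an abelian group.  A Sweedler expression in several variables is usually balanced in one
  of them only after summation over another one, by the Takeuchi condition; \<open>coaction_on_pair\<close> proves
  coassociativity for such expressions once and for all.
\<close>

section \<open>Additive maps on formal sums\<close>

text \<open>
  The integer multiples of an element; they turn an \<open>'a\<close>-valued function on generators into an additive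
  map on formal sums.
\<close>

definition zmul :: "int \<Rightarrow> 'a::ab_group_add \<Rightarrow> 'a" where
  "zmul n x = (if 0 \<le> n then ((+) x ^^ nat n) 0 else - (((+) x ^^ nat (- n)) 0))"

lemma zmul_0 [simp]: "zmul 0 x = 0"
  by (simp add: zmul_def)

lemma zmul_Suc: "zmul (n + 1) x = zmul n x + x"
proof (cases "0 \<le> n")
  case True
  then have "nat (n + 1) = Suc (nat n)" by simp
  then show ?thesis using True by (simp add: zmul_def add.commute)
next
  case False
  then have *: "nat (- n) = Suc (nat (- n - 1))" by linarith
  show ?thesis
  proof (cases "n = - 1")
    case True then show ?thesis by (simp add: zmul_def)
  next
    case False
    with \<open>\<not> 0 \<le> n\<close> have "\<not> 0 \<le> n + 1" "nat (- (n + 1)) = nat (- n - 1)" by auto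
    then show ?thesis using \<open>\<not> 0 \<le> n\<close> unfolding zmul_def * by (simp del: minus_add_distrib)
  qed
qed

lemma zmul_pred: "zmul (n - 1) x = zmul n x - x"
  using zmul_Suc[of "n - 1" x] by (simp add: algebra_simps)

lemma zmul_1 [simp]: "zmul 1 x = x"
  using zmul_Suc[of 0 x] by simp

lemma zmul_add: "zmul (m + n) x = zmul m x + zmul n x"
proof (induction n rule: int_induct[where k = 0])
  case (step1 i)
  have "zmul (m + (i + 1)) x = zmul ((m + i) + 1) x" by (simp add: add.assoc)
  also have "\<dots> = zmul m x + zmul (i + 1) x" unfolding zmul_Suc step1 by (rule add.assoc)
  finally show ?case .
next
  case (step2 i)
  have "zmul (m + (i - 1)) x = zmul ((m + i) - 1) x" by (simp add: algebra_simps)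
  also have "\<dots> = zmul m x + zmul (i - 1) x" by (simp only: zmul_pred step2 add_diff_eq)
  finally show ?case .
qed simp

lemma zmul_hom:
  assumes "\<And>x y. h (x + y) = h x + h y"
  shows "h (zmul n x) = zmul n (h x)"
proof -
  have 0: "h 0 = 0" using assms[of 0 0] by simp
  have d: "h (x - y) = h x - h y" for x y using assms[of "x - y" y] by (simp add: algebra_simps)
  show ?thesis
    by (induction n rule: int_induct[where k = 0]) (simp_all add: 0 d zmul_Suc zmul_pred assms)
qed

lemma zmul_plus: "zmul n (x + y) = zmul n x + zmul n y"
  by (induction n rule: int_induct[where k = 0]) (simp_all add: zmul_Suc zmul_pred algebra_simps)

lemma zmul_zero [simp]: "zmul n 0 = 0"
  using zmul_hom[of "\<lambda>x. 0" n 0] by simp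

definition isum :: "('x \<Rightarrow> 'g::ab_group_add) \<Rightarrow> ('x \<Rightarrow>\<^sub>0 int) \<Rightarrow> 'g" where
  "isum f c = (\<Sum>x\<in>Poly_Mapping.keys c. zmul (Poly_Mapping.lookup c x) (f x))"

lemma isum_superset:
  assumes "finite K" "Poly_Mapping.keys c \<subseteq> K"
  shows "isum f c = (\<Sum>x\<in>K. zmul (Poly_Mapping.lookup c x) (f x))"
  unfolding isum_def by (rule sum.mono_neutral_left) (use assms in \<open>auto simp: in_keys_iff\<close>)

lemma isum_add: "isum f (c + d) = isum f c + isum f d"
proof -
  let ?K = "Poly_Mapping.keys c \<union> Poly_Mapping.keys d"
  have "isum f (c + d) = (\<Sum>x\<in>?K. zmul (Poly_Mapping.lookup (c + d) x) (f x))"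
    by (rule isum_superset) (use Poly_Mapping.keys_add[of c d] in auto)
  also have "\<dots> = (\<Sum>x\<in>?K. zmul (Poly_Mapping.lookup c x) (f x)) + (\<Sum>x\<in>?K. zmul (Poly_Mapping.lookup d x) (f x))"
    by (simp add: lookup_add zmul_add sum.distrib)
  finally show ?thesis by (simp add: isum_superset[of ?K c] isum_superset[of ?K d])
qed

lemma isum_0 [simp]: "isum f 0 = 0"
  by (simp add: isum_def)

lemma isum_uminus: "isum f (- c) = - isum f c"
  using isum_add[of f "- c" c] by (simp add: eq_neg_iff_add_eq_0)

lemma isum_diff: "isum f (c - d) = isum f c - isum f d"
  using isum_add[of f c "- d"] by (simp add: isum_uminus)

lemma isum_of [simp]: "isum f (frag_of x) = f x"
  by (simp add: isum_def)

lemma isum_plus: "isum (\<lambda>x. f x + g x) c = isum f c + isum g c"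
  by (simp add: isum_def zmul_plus sum.distrib)

lemma isum_cong: "(\<And>x. x \<in> Poly_Mapping.keys c \<Longrightarrow> f x = g x) \<Longrightarrow> isum f c = isum g c"
  by (simp add: isum_def)

lemma isum_hom:
  assumes "\<And>x y. h (x + y) = h x + h y"
  shows "h (isum f c) = isum (\<lambda>x. h (f x)) c"
proof -
  have 0: "h 0 = 0" using assms[of 0 0] by simp
  have "h (\<Sum>x\<in>K. zmul (Poly_Mapping.lookup c x) (f x)) = (\<Sum>x\<in>K. zmul (Poly_Mapping.lookup c x) (h (f x)))"
    if "finite K" for K
    using that by (induction K rule: finite_induct) (simp_all add: 0 assms zmul_hom[OF assms])
  then show ?thesis by (simp add: isum_def)
qed

lemma frag_ind [case_names zero one diff]:
  assumes "P 0" "\<And>x. P (frag_of x)" "\<And>a b. P a \<Longrightarrow> P b \<Longrightarrow> P (a - b)"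
  shows "P c"
  using frag_induction[of c UNIV P] assms by simp

lemma isum_minus: "isum (\<lambda>x. f x - g x) c = isum f c - isum g c"
  using isum_plus[of "\<lambda>x. f x - g x" g c] by (simp add: algebra_simps)

lemma isum_zero_fun [simp]: "isum (\<lambda>y. 0) d = 0"
  using isum_minus[of "\<lambda>y. 0" "\<lambda>y. 0" d] by simp

lemma isum_swap: "isum (\<lambda>x. isum (f x) d) c = isum (\<lambda>y. isum (\<lambda>x. f x y) c) d"
  by (induction c rule: frag_ind) (simp_all add: isum_diff isum_minus)

lemma isum_frag_extend: "isum f (frag_extend g c) = isum (\<lambda>x. isum f (g x)) c"
  by (induction c rule: frag_ind) (simp_all add: isum_diff frag_extend_diff)

lemma vsum_eq_isum:
  assumes "vector_space (scl A)"
  shows "vsum A f c = isum f c"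
proof -
  interpret vector_space "scl A" by fact
  have "scl A (of_int n) x = zmul n x" for n x
    by (induction n rule: int_induct[where k = 0])
       (simp_all add: zmul_Suc zmul_pred scale_left_distrib scale_left_diff_distrib)
  then show ?thesis by (simp add: vsum_def isum_def)
qed


section \<open>A type that contains all quotients of an abelian group\<close>

text \<open>
  A subgroup of the additive group of a type; kept apart from the subgroups of monoid records
  because the quotient below is formed with the type-class operations.
\<close>

definition sgrp :: "'g::ab_group_add set \<Rightarrow> bool" where
  "sgrp S \<longleftrightarrow> 0 \<in> S \<and> (\<forall>x\<in>S. \<forall>y\<in>S. x - y \<in> S)"

lemma sgrp_add: "sgrp S \<Longrightarrow> x \<in> S \<Longrightarrow> y \<in> S \<Longrightarrow> x + y \<in> S"
proof -
  assume S: "sgrp S" "x \<in> S" "y \<in> S"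
  then have "0 - y \<in> S" unfolding sgrp_def by blast
  then have "x - (0 - y) \<in> S" using S unfolding sgrp_def by blast
  then show ?thesis by simp
qed

lemma sgrp_uminus: "sgrp S \<Longrightarrow> x \<in> S \<Longrightarrow> - x \<in> S"
  unfolding sgrp_def by (metis diff_0)

text \<open>
  The product of the quotients \<open>G/S\<close> over all subgroups \<open>S\<close> of \<open>G\<close>: tuples of representatives indexed by
  \<open>S\<close>, modulo componentwise congruence.  A single quotient \<open>G/S\<close> depends on the term \<open>S\<close> and cannot be a
  type, but it embeds into this one type by \<open>proj S\<close>.  Equality in a quotient thereby becomes equality
  between values in a type of class \<open>ab_group_add\<close>, where sums and rewriting are available.
\<close>

quotient_type (overloaded) 'g quo = "'g::ab_group_add set \<Rightarrow> 'g" /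
  "\<lambda>f g. \<forall>S. sgrp S \<longrightarrow> f S - g S \<in> S"
proof (rule equivpI)
  show "reflp (\<lambda>f g :: 'g set \<Rightarrow> 'g. \<forall>S. sgrp S \<longrightarrow> f S - g S \<in> S)"
    by (rule reflpI) (simp add: sgrp_def)
  show "symp (\<lambda>f g :: 'g set \<Rightarrow> 'g. \<forall>S. sgrp S \<longrightarrow> f S - g S \<in> S)"
    by (rule sympI) (metis minus_diff_eq sgrp_uminus)
  show "transp (\<lambda>f g :: 'g set \<Rightarrow> 'g. \<forall>S. sgrp S \<longrightarrow> f S - g S \<in> S)"
  proof (rule transpI, intro allI impI)
    fix f g h :: "'g set \<Rightarrow> 'g" and S :: "'g set"
    assume "\<forall>S. sgrp S \<longrightarrow> f S - g S \<in> S" "\<forall>S. sgrp S \<longrightarrow> g S - h S \<in> S" "sgrp S"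
    then have "(f S - g S) + (g S - h S) \<in> S" by (blast intro: sgrp_add)
    then show "f S - h S \<in> S" by simp
  qed
qed

instantiation quo :: (ab_group_add) ab_group_add
begin

lift_definition zero_quo :: "'a quo" is "\<lambda>S. 0" .

lift_definition plus_quo :: "'a quo \<Rightarrow> 'a quo \<Rightarrow> 'a quo" is "\<lambda>f g S. f S + g S"
proof -
  fix f g h k :: "'a set \<Rightarrow> 'a" and S :: "'a set"
  assume a: "\<And>S. sgrp S \<Longrightarrow> f S - g S \<in> S" "\<And>S. sgrp S \<Longrightarrow> h S - k S \<in> S" "sgrp S"
  then have "(f S - g S) + (h S - k S) \<in> S" by (blast intro: sgrp_add)
  then show "f S + h S - (g S + k S) \<in> S" by (simp add: algebra_simps)
qed

lift_definition uminus_quo :: "'a quo \<Rightarrow> 'a quo" is "\<lambda>f S. - f S"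
proof -
  fix f g :: "'a set \<Rightarrow> 'a" and S :: "'a set"
  assume a: "\<And>S. sgrp S \<Longrightarrow> f S - g S \<in> S" "sgrp S"
  then have "- (f S - g S) \<in> S" by (blast intro: sgrp_uminus)
  then show "- f S - (- g S) \<in> S" by (simp add: algebra_simps)
qed

lift_definition minus_quo :: "'a quo \<Rightarrow> 'a quo \<Rightarrow> 'a quo" is "\<lambda>f g S. f S - g S"
proof -
  fix f g h k :: "'a set \<Rightarrow> 'a" and S :: "'a set"
  assume a: "\<And>S. sgrp S \<Longrightarrow> f S - g S \<in> S" "\<And>S. sgrp S \<Longrightarrow> h S - k S \<in> S" "sgrp S"
  then have "(f S - g S) - (h S - k S) \<in> S" unfolding sgrp_def by blast
  then show "f S - h S - (g S - k S) \<in> S" by (simp add: algebra_simps)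
qed

instance
  by standard (transfer; simp add: algebra_simps sgrp_def)+

end

lift_definition proj :: "'g::ab_group_add set \<Rightarrow> 'g \<Rightarrow> 'g quo" is "\<lambda>S x S'. if S' = S then x else 0" .

lemma proj_add: "proj S (x + y) = proj S x + proj S y"
  by transfer (simp add: sgrp_def)

lemma proj_eq_iff: "sgrp S \<Longrightarrow> proj S x = proj S y \<longleftrightarrow> x - y \<in> S"
  by transfer (auto simp: sgrp_def)


section \<open>Presented abelian groups and tensor products\<close>

lemma sgrp_generate:
  assumes "rels \<subseteq> carrier (free_Abelian_group A)"
  shows "sgrp (generate (free_Abelian_group A) rels)"
proof -
  interpret group "free_Abelian_group A" by simp
  have "subgroup (generate (free_Abelian_group A) rels) (free_Abelian_group A)"
    using assms by (rule generate_is_subgroup)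
  then interpret H: subgroup "generate (free_Abelian_group A) rels" "free_Abelian_group A" .
  show ?thesis unfolding sgrp_def
  proof (intro conjI ballI)
    show "0 \<in> generate (free_Abelian_group A) rels" using H.one_closed by simp
    fix x y assume x: "x \<in> generate (free_Abelian_group A) rels" and y: "y \<in> generate (free_Abelian_group A) rels"
    have "y \<in> carrier (free_Abelian_group A)" using y H.subset by blast
    then have "inv\<^bsub>free_Abelian_group A\<^esub> y = - y" by simp
    then show "x - y \<in> generate (free_Abelian_group A) rels"
      using H.m_closed[OF x H.m_inv_closed[OF y]] by simp
  qed
qed

definition kills :: "('x \<Rightarrow>\<^sub>0 int) set \<Rightarrow> ('x \<Rightarrow> 'g::ab_group_add) \<Rightarrow> bool" where
  "kills S \<phi> \<longleftrightarrow> (\<forall>r\<in>S. isum \<phi> r = 0)"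

lemma isum_generate:
  assumes "rels \<subseteq> carrier (free_Abelian_group A)" "kills rels f"
    and "x \<in> generate (free_Abelian_group A) rels"
  shows "isum f x = 0"
  using assms(3)
proof (induction rule: generate.induct)
  case one then show ?case by simp
next
  case (incl h) then show ?case using assms(2) by (simp add: kills_def)
next
  case (inv h)
  then have "inv\<^bsub>free_Abelian_group A\<^esub> h = - h"
    using assms(1) by (intro inv_free_Abelian_group) (auto simp: subset_iff)
  then show ?case using inv assms(2) by (simp add: isum_uminus kills_def)
next
  case (eng h1 h2) then show ?case by (simp add: isum_add)
qed

text \<open>
  The universal property of a group given by generators and relations, with one target type.  That
  target suffices because the projection onto the quotient by the relations is itself one of the
  functions tested.
\<close>

lemma generate_iff:
  fixes rels :: "('x \<Rightarrow>\<^sub>0 int) set"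
  assumes rels: "rels \<subseteq> carrier (free_Abelian_group A)"
  shows "x - y \<in> generate (free_Abelian_group A) rels \<longleftrightarrow>
    (\<forall>f :: 'x \<Rightarrow> ('x \<Rightarrow>\<^sub>0 int) quo. kills rels f \<longrightarrow> isum f x = isum f y)"
proof
  assume "x - y \<in> generate (free_Abelian_group A) rels"
  then show "\<forall>f :: 'x \<Rightarrow> ('x \<Rightarrow>\<^sub>0 int) quo. kills rels f \<longrightarrow> isum f x = isum f y"
    using isum_generate[OF rels] by (fastforce simp: isum_diff)
next
  let ?S = "generate (free_Abelian_group A) rels"
  let ?f = "\<lambda>x. proj ?S (frag_of x)"
  have S: "sgrp ?S" using rels by (rule sgrp_generate)
  have id: "isum frag_of c = c" for c :: "'x \<Rightarrow>\<^sub>0 int"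
    by (induction c rule: frag_ind) (simp_all add: isum_diff)
  have f: "isum ?f c = proj ?S c" for c
    using isum_hom[of "proj ?S" frag_of c] by (simp add: proj_add id)
  assume *: "\<forall>f :: 'x \<Rightarrow> ('x \<Rightarrow>\<^sub>0 int) quo. kills rels f \<longrightarrow> isum f x = isum f y"
  have "isum ?f r = 0" if "r \<in> rels" for r
  proof -
    have "r - 0 \<in> ?S" using that by (simp add: generate.incl)
    then have "proj ?S r = proj ?S 0" by (simp only: proj_eq_iff[OF S])
    also have "\<dots> = 0" using f[of 0] by simp
    finally show ?thesis by (simp add: f)
  qed
  then have "isum ?f x = isum ?f y" using * unfolding kills_def by blast
  then show "x - y \<in> ?S" by (simp add: f proj_eq_iff[OF S])
qed


subsection \<open>Sweedler sums\<close>

text \<open>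
  \<open>\<ointegral>x y\<in>c. F x y\<close> is the value of \<open>F\<close> on the formal sum \<open>c\<close>, additively extended.  With \<open>c\<close> a
  representative of \<open>\<Delta>(X)\<close> it renders Sweedler notation: \<open>\<ointegral>X1 X2\<in>D X. F X1 X2\<close> is
  \<open>F(X\<^sub>1, X\<^sub>2)\<close>.
\<close>

definition sw :: "('m \<times> 'n \<Rightarrow>\<^sub>0 int) \<Rightarrow> ('m \<Rightarrow> 'n \<Rightarrow> 'g::ab_group_add) \<Rightarrow> 'g" where
  "sw c F = isum (case_prod F) c"

syntax
  "_sw" :: "pttrn \<Rightarrow> pttrn \<Rightarrow> ('m \<times> 'n \<Rightarrow>\<^sub>0 int) \<Rightarrow> 'g \<Rightarrow> 'g"
    (\<open>(3\<ointegral>_ _\<in>_./ _)\<close> [1000, 1000, 0, 10] 10)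
translations
  "\<ointegral>x y\<in>c. F" \<rightleftharpoons> "CONST sw c (\<lambda>x y. F)"

lemma sw_of [simp]: "(\<ointegral>x y\<in>frag_of (a, b). F x y) = F a b"
  by (simp add: sw_def)

lemma sw_add: "(\<ointegral>x y\<in>c + d. F x y) = (\<ointegral>x y\<in>c. F x y) + (\<ointegral>x y\<in>d. F x y)"
  by (simp add: sw_def isum_add)

lemma sw_diff: "(\<ointegral>x y\<in>c - d. F x y) = (\<ointegral>x y\<in>c. F x y) - (\<ointegral>x y\<in>d. F x y)"
  by (simp add: sw_def isum_diff)

lemma sw_0 [simp]: "(\<ointegral>x y\<in>0. F x y) = 0"
  by (simp add: sw_def)

lemma sw_plus: "(\<ointegral>x y\<in>c. F x y + G x y) = (\<ointegral>x y\<in>c. F x y) + (\<ointegral>x y\<in>c. G x y)"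
  using isum_plus[of "case_prod F" "case_prod G" c] by (simp add: sw_def case_prod_unfold)

lemma sw_swap:
  "(\<ointegral>x y\<in>c. \<ointegral>v w\<in>d. F x y v w) = (\<ointegral>v w\<in>d. \<ointegral>x y\<in>c. F x y v w)"
  using isum_swap[of "\<lambda>(x, y) (v, w). F x y v w" d c] by (simp add: sw_def case_prod_unfold)

lemma sw_hom:
  assumes "\<And>x y. h (x + y) = h x + h y"
  shows "h (\<ointegral>x y\<in>c. F x y) = (\<ointegral>x y\<in>c. h (F x y))"
  using isum_hom[of h "case_prod F" c] assms by (simp add: sw_def case_prod_unfold)

lemma sw_extend: "(\<ointegral>x y\<in>frag_extend (\<lambda>(a, b). g a b) c. F x y) = (\<ointegral>a b\<in>c. \<ointegral>x y\<in>g a b. F x y)"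
  by (simp add: sw_def isum_frag_extend case_prod_unfold)

lemma sw_fmap2 [simp]: "(\<ointegral>x y\<in>fmap2 f g c. F x y) = (\<ointegral>x y\<in>c. F (f x) (g y))"
  unfolding fmap2_def sw_extend by simp

lemma sw_fprod [simp]:
  "(\<ointegral>x y\<in>fprod f g c d. F x y) = (\<ointegral>X p\<in>c. \<ointegral>Y q\<in>d. F (f X Y) (g p q))"
  unfolding fprod_def sw_extend by simp

definition biadd :: "('m::ab_group_add \<Rightarrow> 'n::ab_group_add \<Rightarrow> 'g::ab_group_add) \<Rightarrow> bool" where
  "biadd \<beta> \<longleftrightarrow> (\<forall>m m' n. \<beta> (m + m') n = \<beta> m n + \<beta> m' n) \<and> (\<forall>m n n'. \<beta> m (n + n') = \<beta> m n + \<beta> m n')"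

text \<open>
  The biadditive maps that factor through the tensor product over \<open>R\<close>.
\<close>

definition bal :: "'r set \<Rightarrow> ('r \<Rightarrow> 'm \<Rightarrow> 'm) \<Rightarrow> ('r \<Rightarrow> 'n \<Rightarrow> 'n) \<Rightarrow>
    ('m::ab_group_add \<Rightarrow> 'n::ab_group_add \<Rightarrow> 'g::ab_group_add) \<Rightarrow> bool" where
  "bal R am an \<beta> \<longleftrightarrow> biadd \<beta> \<and> (\<forall>r\<in>R. \<forall>m n. \<beta> (am r m) n = \<beta> m (an r n))"

lemma balI [intro?]:
  assumes "\<And>m m' n. \<beta> (m + m') n = \<beta> m n + \<beta> m' n" "\<And>m n n'. \<beta> m (n + n') = \<beta> m n + \<beta> m n'"
    and "\<And>r m n. r \<in> R \<Longrightarrow> \<beta> (am r m) n = \<beta> m (an r n)"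
  shows "bal R am an \<beta>"
  using assms by (simp add: bal_def biadd_def)

lemma balD:
  assumes "bal R am an \<beta>"
  shows "\<beta> (m + m') n = \<beta> m n + \<beta> m' n" "\<beta> m (n + n') = \<beta> m n + \<beta> m n'"
    "r \<in> R \<Longrightarrow> \<beta> (am r m) n = \<beta> m (an r n)"
  using assms by (auto simp: bal_def biadd_def)


subsection \<open>Classes in tensor products\<close>

lemma tmod_simps [simp]:
  "carrier (tmod act) = UNIV" "add (tmod act) = (+)" "smult (tmod act) = act" "zero (tmod act) = 0"
  by (simp_all add: tmod_def)

lemma free_UNIV [simp]: "carrier (free_Abelian_group UNIV) = UNIV"
  by (simp add: free_Abelian_group_def)

lemma tcls_eq_null_iff:
  assumes "ten_rels R M N \<subseteq> carrier (free_Abelian_group (carrier M \<times> carrier N))"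
  shows "tcls R M N x = tcls R M N y \<longleftrightarrow> x - y \<in> ten_null R M N"
proof -
  have S: "sgrp (ten_null R M N)"
    unfolding ten_null_def using assms by (rule sgrp_generate)
  have cls: "z \<in> tcls R M N x \<longleftrightarrow> z - x \<in> ten_null R M N" for x z
    unfolding tcls_def r_coset_def by (auto intro!: bexI[of _ "z - x"])
  show ?thesis
  proof
    assume "tcls R M N x = tcls R M N y"
    moreover have "x \<in> tcls R M N x" using S by (simp add: cls sgrp_def)
    ultimately show "x - y \<in> ten_null R M N" by (simp add: cls)
  next
    assume xy: "x - y \<in> ten_null R M N"
    have "z - x \<in> ten_null R M N \<longleftrightarrow> z - y \<in> ten_null R M N" for z
    proof
      assume "z - x \<in> ten_null R M N"
      from sgrp_add[OF S this xy] show "z - y \<in> ten_null R M N" by simp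
    next
      assume "z - y \<in> ten_null R M N"
      with xy S have "(z - y) - (x - y) \<in> ten_null R M N" unfolding sgrp_def by blast
      then show "z - x \<in> ten_null R M N" by simp
    qed
    then show "tcls R M N x = tcls R M N y" by (auto simp: cls)
  qed
qed

lemma rep_tcls:
  assumes "ten_rels R M N \<subseteq> carrier (free_Abelian_group (carrier M \<times> carrier N))"
  shows "tcls R M N (rep (tcls R M N x)) = tcls R M N x"
proof -
  have S: "sgrp (ten_null R M N)"
    unfolding ten_null_def using assms by (rule sgrp_generate)
  have cls: "z \<in> tcls R M N x \<longleftrightarrow> z - x \<in> ten_null R M N" for z
    unfolding tcls_def r_coset_def by (auto intro!: bexI[of _ "z - x"])
  have "x \<in> tcls R M N x" using S by (simp add: cls sgrp_def)
  then have "rep (tcls R M N x) \<in> tcls R M N x" unfolding rep_def by (rule someI)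
  then show ?thesis by (simp add: cls tcls_eq_null_iff[OF assms])
qed

lemma carrier_tensor:
  "carrier (tensor R M N) = tcls R M N ` carrier (free_Abelian_group (carrier M \<times> carrier N))"
  by (auto simp: tensor_def FactGroup_def RCOSETS_def tcls_def)

lemma tensor_mult:
  assumes "ten_rels R M N \<subseteq> carrier (free_Abelian_group (carrier M \<times> carrier N))"
    and "x \<in> carrier (free_Abelian_group (carrier M \<times> carrier N))"
      "y \<in> carrier (free_Abelian_group (carrier M \<times> carrier N))"
  shows "tcls R M N x \<otimes>\<^bsub>tensor R M N\<^esub> tcls R M N y = tcls R M N (x + y)"
proof -
  interpret G: comm_group "free_Abelian_group (carrier M \<times> carrier N)" by (rule abelian_free_Abelian_group)
  have "subgroup (ten_null R M N) (free_Abelian_group (carrier M \<times> carrier N))"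
    unfolding ten_null_def using assms(1) by (rule G.generate_is_subgroup)
  then have "ten_null R M N \<lhd> free_Abelian_group (carrier M \<times> carrier N)"
    by (rule G.subgroup_imp_normal)
  then interpret N: normal "ten_null R M N" "free_Abelian_group (carrier M \<times> carrier N)" .
  show ?thesis using N.rcos_sum[OF assms(2,3)] by (simp add: tensor_def FactGroup_def tcls_def)
qed

lemma kills_ten_relsD:
  assumes "kills (ten_rels R M N) \<phi>"
  shows "m \<in> carrier M \<Longrightarrow> m' \<in> carrier M \<Longrightarrow> n \<in> carrier N \<Longrightarrow> \<phi> (m \<oplus>\<^bsub>M\<^esub> m', n) = \<phi> (m, n) + \<phi> (m', n)"
    "m \<in> carrier M \<Longrightarrow> n \<in> carrier N \<Longrightarrow> n' \<in> carrier N \<Longrightarrow> \<phi> (m, n \<oplus>\<^bsub>N\<^esub> n') = \<phi> (m, n) + \<phi> (m, n')"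
    "r \<in> R \<Longrightarrow> m \<in> carrier M \<Longrightarrow> n \<in> carrier N \<Longrightarrow> \<phi> (r \<odot>\<^bsub>M\<^esub> m, n) = \<phi> (m, r \<odot>\<^bsub>N\<^esub> n)"
proof -
  assume *: "m \<in> carrier M" "m' \<in> carrier M" "n \<in> carrier N"
  have "frag_of (m \<oplus>\<^bsub>M\<^esub> m', n) - frag_of (m, n) - frag_of (m', n) \<in> ten_rels R M N"
    unfolding ten_rels_def Un_iff mem_Collect_eq using * by blast
  with assms have "isum \<phi> (frag_of (m \<oplus>\<^bsub>M\<^esub> m', n) - frag_of (m, n) - frag_of (m', n)) = 0"
    unfolding kills_def by (rule bspec)
  then show "\<phi> (m \<oplus>\<^bsub>M\<^esub> m', n) = \<phi> (m, n) + \<phi> (m', n)"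
    unfolding isum_diff isum_of isum_add diff_diff_eq right_minus_eq .
next
  assume *: "m \<in> carrier M" "n \<in> carrier N" "n' \<in> carrier N"
  have "frag_of (m, n \<oplus>\<^bsub>N\<^esub> n') - frag_of (m, n) - frag_of (m, n') \<in> ten_rels R M N"
    unfolding ten_rels_def Un_iff mem_Collect_eq using * by blast
  with assms have "isum \<phi> (frag_of (m, n \<oplus>\<^bsub>N\<^esub> n') - frag_of (m, n) - frag_of (m, n')) = 0"
    unfolding kills_def by (rule bspec)
  then show "\<phi> (m, n \<oplus>\<^bsub>N\<^esub> n') = \<phi> (m, n) + \<phi> (m, n')"
    unfolding isum_diff isum_of isum_add diff_diff_eq right_minus_eq .
next
  assume *: "r \<in> R" "m \<in> carrier M" "n \<in> carrier N"
  have "frag_of (r \<odot>\<^bsub>M\<^esub> m, n) - frag_of (m, r \<odot>\<^bsub>N\<^esub> n) \<in> ten_rels R M N"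
    unfolding ten_rels_def Un_iff mem_Collect_eq using * by blast
  with assms have "isum \<phi> (frag_of (r \<odot>\<^bsub>M\<^esub> m, n) - frag_of (m, r \<odot>\<^bsub>N\<^esub> n)) = 0"
    unfolding kills_def by (rule bspec)
  then show "\<phi> (r \<odot>\<^bsub>M\<^esub> m, n) = \<phi> (m, r \<odot>\<^bsub>N\<^esub> n)"
    unfolding isum_diff isum_of right_minus_eq .
qed

lemma kills_ten_relsI:
  assumes "\<And>m m' n. m \<in> carrier M \<Longrightarrow> m' \<in> carrier M \<Longrightarrow> n \<in> carrier N \<Longrightarrow> \<phi> (m \<oplus>\<^bsub>M\<^esub> m', n) = \<phi> (m, n) + \<phi> (m', n)"
    "\<And>m n n'. m \<in> carrier M \<Longrightarrow> n \<in> carrier N \<Longrightarrow> n' \<in> carrier N \<Longrightarrow> \<phi> (m, n \<oplus>\<^bsub>N\<^esub> n') = \<phi> (m, n) + \<phi> (m, n')"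
    "\<And>r m n. r \<in> R \<Longrightarrow> m \<in> carrier M \<Longrightarrow> n \<in> carrier N \<Longrightarrow> \<phi> (r \<odot>\<^bsub>M\<^esub> m, n) = \<phi> (m, r \<odot>\<^bsub>N\<^esub> n)"
  shows "kills (ten_rels R M N) \<phi>"
  unfolding kills_def ten_rels_def Un_iff Ball_def mem_Collect_eq
  by (intro allI impI, elim disjE exE conjE; hypsubst)
     (simp_all only: isum_diff isum_of isum_add diff_diff_eq right_minus_eq assms)

lemma tcls_eq_iff_kills:
  fixes M :: "('r, 'm) module" and N :: "('r, 'n) module"
  assumes rels: "ten_rels R M N \<subseteq> carrier (free_Abelian_group (carrier M \<times> carrier N))"
  shows "tcls R M N x = tcls R M N y \<longleftrightarrow>
    (\<forall>\<phi> :: 'm \<times> 'n \<Rightarrow> ('m \<times> 'n \<Rightarrow>\<^sub>0 int) quo. kills (ten_rels R M N) \<phi> \<longrightarrow> isum \<phi> x = isum \<phi> y)"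
  unfolding tcls_eq_null_iff[OF rels] ten_null_def generate_iff[OF rels] ..

lemma tcls_eqD_kills:
  assumes rels: "ten_rels R M N \<subseteq> carrier (free_Abelian_group (carrier M \<times> carrier N))"
    and k: "kills (ten_rels R M N) \<phi>" and eq: "tcls R M N x = tcls R M N y"
  shows "isum \<phi> x = isum \<phi> y"
proof -
  have d: "x - y \<in> generate (free_Abelian_group (carrier M \<times> carrier N)) (ten_rels R M N)"
    using eq unfolding tcls_eq_null_iff[OF rels] ten_null_def .
  have "isum \<phi> (x - y) = 0"
    by (rule isum_generate[OF rels k d])
  then show ?thesis unfolding isum_diff right_minus_eq .
qed

context
  fixes R :: "'r set" and am :: "'r \<Rightarrow> 'm::ab_group_add \<Rightarrow> 'm" and an :: "'r \<Rightarrow> 'n::ab_group_add \<Rightarrow> 'n"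
begin

lemma ten_rels_tmod [simp]:
  "ten_rels R (tmod am) (tmod an) \<subseteq> carrier (free_Abelian_group (carrier (tmod am) \<times> carrier (tmod an)))"
  by simp

lemma kills_iff_bal: "kills (ten_rels R (tmod am) (tmod an)) (\<lambda>(m, n). \<beta> m n) \<longleftrightarrow> bal R am an \<beta>"
proof
  assume k: "kills (ten_rels R (tmod am) (tmod an)) (\<lambda>(m, n). \<beta> m n)"
  from kills_ten_relsD[OF k] show "bal R am an \<beta>" by (intro balI) simp_all
next
  assume "bal R am an \<beta>"
  note b = balD[OF this]
  show "kills (ten_rels R (tmod am) (tmod an)) (\<lambda>(m, n). \<beta> m n)"
    by (rule kills_ten_relsI) (simp_all add: b)
qed

lemma tcls_eqD:
  assumes "tcls R (tmod am) (tmod an) x = tcls R (tmod am) (tmod an) y" "bal R am an \<beta>"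
  shows "(\<ointegral>m n\<in>x. \<beta> m n) = (\<ointegral>m n\<in>y. \<beta> m n)"
  using tcls_eqD_kills[OF ten_rels_tmod iffD2[OF kills_iff_bal assms(2)] assms(1)] by (simp add: sw_def)

text \<open>
  Two formal sums are equal in a tensor product as soon as all balanced maps into one fixed type agree on
  them.  Together with its converse for arbitrary targets this lets every identity between tensors be
  proved as an equation between Sweedler sums.
\<close>

lemma tcls_eqI:
  assumes "\<And>\<beta> :: 'm \<Rightarrow> 'n \<Rightarrow> ('m \<times> 'n \<Rightarrow>\<^sub>0 int) quo. bal R am an \<beta> \<Longrightarrow>
    (\<ointegral>m n\<in>x. \<beta> m n) = (\<ointegral>m n\<in>y. \<beta> m n)"
  shows "tcls R (tmod am) (tmod an) x = tcls R (tmod am) (tmod an) y"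
  unfolding tcls_eq_iff_kills[OF ten_rels_tmod]
proof (intro allI impI)
  fix f :: "'m \<times> 'n \<Rightarrow> ('m \<times> 'n \<Rightarrow>\<^sub>0 int) quo"
  assume "kills (ten_rels R (tmod am) (tmod an)) f"
  then have "bal R am an (curry f)" by (simp flip: kills_iff_bal)
  from assms[OF this] show "isum f x = isum f y" by (simp add: sw_def)
qed

lemma sw_rep_tcls:
  assumes "bal R am an \<beta>"
  shows "(\<ointegral>m n\<in>rep (tcls R (tmod am) (tmod an) x). \<beta> m n) = (\<ointegral>m n\<in>x. \<beta> m n)"
  by (rule tcls_eqD[OF rep_tcls[OF ten_rels_tmod] assms])

lemma carrier_tensor_tmod: "carrier (tensor R (tmod am) (tmod an)) = range (tcls R (tmod am) (tmod an))"
  by (simp add: carrier_tensor)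

lemma tcls_rep:
  assumes "c \<in> carrier (tensor R (tmod am) (tmod an))"
  shows "tcls R (tmod am) (tmod an) (rep c) = c"
  using assms rep_tcls[OF ten_rels_tmod] by (auto simp: carrier_tensor_tmod)

lemma tensor_tmod_mult:
  "tcls R (tmod am) (tmod an) x \<otimes>\<^bsub>tensor R (tmod am) (tmod an)\<^esub> tcls R (tmod am) (tmod an) y
    = tcls R (tmod am) (tmod an) (x + y)"
  by (rule tensor_mult) simp_all

end

section \<open>Products of coactions\<close>

definition pr :: "('c \<times> 'v \<Rightarrow>\<^sub>0 int) \<Rightarrow> ('d \<times> 'w \<Rightarrow>\<^sub>0 int) \<Rightarrow> (('c \<times> 'd) \<times> ('v \<times> 'w) \<Rightarrow>\<^sub>0 int)" where
  "pr x y = frag_extend (\<lambda>(c, v). frag_extend (\<lambda>(d, w). frag_of ((c, d), (v, w))) y) x"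

lemma sw_pr [simp]: "sw (pr x y) F = (\<ointegral>c v\<in>x. \<ointegral>d w\<in>y. F (c, d) (v, w))"
proof -
  have "(\<ointegral>a b\<in>pr x y. F a b) = (\<ointegral>c v\<in>x. \<ointegral>d w\<in>y. F (c, d) (v, w))"
    unfolding pr_def sw_extend by simp
  then show ?thesis by simp
qed

text \<open>
  A coaction \<open>Cv\<close> on \<open>'v\<close> of a comonoid \<open>'c\<close> with coproduct \<open>Dc\<close>.  Coassociativity and the Takeuchi
  conditions (\<open>rt\<close>, \<open>rs\<close>, \<open>re\<close> are the right actions through target, source and on \<open>'v\<close>) hold only in
  tensor products over \<open>B\<close>, so they are claimed for test functions from a class \<open>K\<close>.
\<close>

definition coaction_on :: "('v \<Rightarrow> ('c \<times> 'v \<Rightarrow>\<^sub>0 int)) \<Rightarrow> ('c \<Rightarrow> ('c \<times> 'c \<Rightarrow>\<^sub>0 int)) \<Rightarrow>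
    ('b \<Rightarrow> 'c \<Rightarrow> 'c) \<Rightarrow> ('b \<Rightarrow> 'c \<Rightarrow> 'c) \<Rightarrow> ('b \<Rightarrow> 'v \<Rightarrow> 'v) \<Rightarrow> (('c \<Rightarrow> 'c \<Rightarrow> 'v \<Rightarrow> 'g::ab_group_add) \<Rightarrow> bool) \<Rightarrow> bool"
where
  "coaction_on Cv Dc rt rs re K \<longleftrightarrow> (\<forall>F v. K F \<longrightarrow>
     (\<ointegral>c w\<in>Cv v. \<ointegral>c1 c2\<in>Dc c. F c1 c2 w) = (\<ointegral>c w\<in>Cv v. \<ointegral>d u\<in>Cv w. F c d u) \<and>
     (\<forall>b. (\<ointegral>c w\<in>Cv v. \<ointegral>d u\<in>Cv w. F (rt b c) d u) = (\<ointegral>c w\<in>Cv v. \<ointegral>d u\<in>Cv w. F c (rs b d) u)) \<and>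
     (\<forall>b. (\<ointegral>c w\<in>Cv v. \<ointegral>d u\<in>Cv w. F c (rt b d) u) = (\<ointegral>c w\<in>Cv v. \<ointegral>d u\<in>Cv w. F c d (re b u))))"

definition triadd :: "('x::ab_group_add \<Rightarrow> 'y::ab_group_add \<Rightarrow> 'z::ab_group_add \<Rightarrow> 'g::ab_group_add) \<Rightarrow> bool" where
  "triadd F \<longleftrightarrow> (\<forall>x x' y z. F (x + x') y z = F x y z + F x' y z) \<and>
     (\<forall>x y y' z. F x (y + y') z = F x y z + F x y' z) \<and>
     (\<forall>x y z z'. F x y (z + z') = F x y z + F x y z')"

text \<open>
  The test functions on \<open>\<L> \<diamond> \<L> \<diamond> P\<close>; \<open>lt\<close>, \<open>ls\<close> and \<open>la\<close> are the left actions through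
  target, source and on \<open>P\<close>.
\<close>

definition tri_bal :: "('b \<Rightarrow> 'l \<Rightarrow> 'l) \<Rightarrow> ('b \<Rightarrow> 'l \<Rightarrow> 'l) \<Rightarrow> ('b \<Rightarrow> 'p \<Rightarrow> 'p) \<Rightarrow>
    ('l::ab_group_add \<Rightarrow> 'l \<Rightarrow> 'p::ab_group_add \<Rightarrow> 'g::ab_group_add) \<Rightarrow> bool" where
  "tri_bal lt ls la F \<longleftrightarrow> triadd F \<and> (\<forall>b X Y p. F (lt b X) Y p = F X (ls b Y) p) \<and>
     (\<forall>b X Y p. F X (lt b Y) p = F X Y (la b p))"

text \<open>
  Test functions for a product of coactions.  The functions that occur are not balanced in their second
  variables; they only satisfy the middle relations that move a scalar from the second variables to
  the right of the first ones.  After summation over the first variables the Takeuchi conditions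
  move that scalar across, which gives balancedness in the second variables.
\<close>

definition pair_class :: "(('c \<Rightarrow> 'c \<Rightarrow> 'v \<Rightarrow> 'g::ab_group_add) \<Rightarrow> bool) \<Rightarrow>
    ('b \<Rightarrow> 'c \<Rightarrow> 'c) \<Rightarrow> ('b \<Rightarrow> 'c \<Rightarrow> 'c) \<Rightarrow> ('b \<Rightarrow> 'v \<Rightarrow> 'v) \<Rightarrow>
    ('b \<Rightarrow> 'l \<Rightarrow> 'l) \<Rightarrow> ('b \<Rightarrow> 'l \<Rightarrow> 'l) \<Rightarrow> ('b \<Rightarrow> 'p \<Rightarrow> 'p) \<Rightarrow>
    ('c \<times> 'l::ab_group_add \<Rightarrow> 'c \<times> 'l \<Rightarrow> 'v \<times> 'p::ab_group_add \<Rightarrow> 'g) \<Rightarrow> bool" where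
  "pair_class K rt rs re lt ls la F \<longleftrightarrow>
     (\<forall>Y1 Y2 q. K (\<lambda>c1 c2 v. F (c1, Y1) (c2, Y2) (v, q))) \<and>
     (\<forall>c1 c2 v. triadd (\<lambda>Y1 Y2 q. F (c1, Y1) (c2, Y2) (v, q))) \<and>
     (\<forall>b c1 c2 v Y1 Y2 q. F (c1, lt b Y1) (c2, Y2) (v, q) = F (rt b c1, Y1) (c2, Y2) (v, q)) \<and>
     (\<forall>b c1 c2 v Y1 Y2 q. F (c1, Y1) (c2, ls b Y2) (v, q) = F (c1, Y1) (rs b c2, Y2) (v, q)) \<and>
     (\<forall>b c1 c2 v Y1 Y2 q. F (c1, Y1) (c2, lt b Y2) (v, q) = F (c1, Y1) (rt b c2, Y2) (v, q)) \<and>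
     (\<forall>b c1 c2 v Y1 Y2 q. F (c1, Y1) (c2, Y2) (v, la b q) = F (c1, Y1) (c2, Y2) (re b v, q))"

lemma coaction_onD:
  assumes "coaction_on Cv Dc rt rs re K" "K F"
  shows "(\<ointegral>c w\<in>Cv v. \<ointegral>c1 c2\<in>Dc c. F c1 c2 w) = (\<ointegral>c w\<in>Cv v. \<ointegral>d u\<in>Cv w. F c d u)"
    "(\<ointegral>c w\<in>Cv v. \<ointegral>d u\<in>Cv w. F (rt b c) d u) = (\<ointegral>c w\<in>Cv v. \<ointegral>d u\<in>Cv w. F c (rs b d) u)"
    "(\<ointegral>c w\<in>Cv v. \<ointegral>d u\<in>Cv w. F c (rt b d) u) = (\<ointegral>c w\<in>Cv v. \<ointegral>d u\<in>Cv w. F c d (re b u))"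
  using assms unfolding coaction_on_def by simp_all

text \<open>
  Coassociativity in two variables at once.  For fixed second variables the first coaction applies by
  the class \<open>K\<close>; once the first variables are summed, the result \<open>?F\<close> is a balanced function of the second
  variables by the Takeuchi conditions, and the second coaction applies.  The product satisfies the
  same kind of conditions, so the lemma can be iterated to any number of variables.
\<close>

lemma coaction_on_pair:
  fixes K :: "('c \<Rightarrow> 'c \<Rightarrow> 'v \<Rightarrow> 'g::ab_group_add) \<Rightarrow> bool"
  assumes v: "coaction_on Cv Dc rt rs re K"
    and p: "coaction_on C D rt' rs' re' (tri_bal lt ls la :: ('l::ab_group_add \<Rightarrow> 'l \<Rightarrow> 'p::ab_group_add \<Rightarrow> 'g) \<Rightarrow> bool)"
  shows "coaction_on (\<lambda>(v, q). pr (Cv v) (C q)) (\<lambda>(c, Y). pr (Dc c) (D Y))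
    (\<lambda>b (c, Y). (c, rt' b Y)) (\<lambda>b (c, Y). (c, rs' b Y)) (\<lambda>b (v, q). (v, re' b q))
    (pair_class K rt rs re lt ls la)"
  unfolding coaction_on_def
proof (intro allI impI)
  fix F :: "'c \<times> 'l \<Rightarrow> 'c \<times> 'l \<Rightarrow> 'v \<times> 'p \<Rightarrow> 'g" and vq :: "'v \<times> 'p"
  assume F: "pair_class K rt rs re lt ls la F"
  obtain v q where vq: "vq = (v, q)" by (cases vq)
  note Fp = F[unfolded pair_class_def]
  have K: "K (\<lambda>c1 c2 v. F (c1, Y1) (c2, Y2) (v, q))" for Y1 Y2 q
    by (rule Fp[THEN conjunct1, rule_format])
  have add: "triadd (\<lambda>Y1 Y2 q. F (c1, Y1) (c2, Y2) (v, q))" for c1 c2 v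
    by (rule Fp[THEN conjunct2, THEN conjunct1, rule_format])
  note Fd = Fp[THEN conjunct2, THEN conjunct2, THEN conjunct1, rule_format]
    Fp[THEN conjunct2, THEN conjunct2, THEN conjunct2, THEN conjunct1, rule_format]
    Fp[THEN conjunct2, THEN conjunct2, THEN conjunct2, THEN conjunct2, THEN conjunct1, rule_format]
    Fp[THEN conjunct2, THEN conjunct2, THEN conjunct2, THEN conjunct2, THEN conjunct2, rule_format]
  let ?F = "\<lambda>Y1 Y2 q. \<ointegral>c w\<in>Cv v. \<ointegral>d u\<in>Cv w. F (c, Y1) (d, Y2) (u, q)"
  have T: "tri_bal lt ls la ?F"
    unfolding tri_bal_def
  proof (intro conjI allI)
    show "triadd ?F"
      using add unfolding triadd_def by (simp add: sw_plus)
  next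
    fix b X Y p
    have "?F (lt b X) Y p = (\<ointegral>c w\<in>Cv v. \<ointegral>d u\<in>Cv w. F (rt b c, X) (d, Y) (u, p))" by (simp add: Fd)
    also have "\<dots> = (\<ointegral>c w\<in>Cv v. \<ointegral>d u\<in>Cv w. F (c, X) (rs b d, Y) (u, p))"
      by (rule coaction_onD(2)[OF v, OF K])
    also have "\<dots> = ?F X (ls b Y) p" by (simp add: Fd)
    finally show "?F (lt b X) Y p = ?F X (ls b Y) p" .
  next
    fix b X Y p
    have "?F X (lt b Y) p = (\<ointegral>c w\<in>Cv v. \<ointegral>d u\<in>Cv w. F (c, X) (rt b d, Y) (u, p))" by (simp add: Fd)
    also have "\<dots> = (\<ointegral>c w\<in>Cv v. \<ointegral>d u\<in>Cv w. F (c, X) (d, Y) (re b u, p))"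
      by (rule coaction_onD(3)[OF v, OF K])
    also have "\<dots> = ?F X Y (la b p)" by (simp add: Fd)
    finally show "?F X (lt b Y) p = ?F X Y (la b p)" .
  qed
  have split: "(\<ointegral>c w\<in>Cv v. \<ointegral>Y r\<in>C q. \<ointegral>d u\<in>Cv w. \<ointegral>Z s\<in>C r. G c Y d Z u s) =
      (\<ointegral>Y r\<in>C q. \<ointegral>Z s\<in>C r. \<ointegral>c w\<in>Cv v. \<ointegral>d u\<in>Cv w. G c Y d Z u s)" for G :: "_ \<Rightarrow> _ \<Rightarrow> _ \<Rightarrow> _ \<Rightarrow> _ \<Rightarrow> _ \<Rightarrow> 'g"
  proof -
    have "(\<ointegral>c w\<in>Cv v. \<ointegral>Y r\<in>C q. \<ointegral>d u\<in>Cv w. \<ointegral>Z s\<in>C r. G c Y d Z u s) =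
      (\<ointegral>Y r\<in>C q. \<ointegral>c w\<in>Cv v. \<ointegral>d u\<in>Cv w. \<ointegral>Z s\<in>C r. G c Y d Z u s)" by (rule sw_swap)
    also have "\<dots> = (\<ointegral>Y r\<in>C q. \<ointegral>c w\<in>Cv v. \<ointegral>Z s\<in>C r. \<ointegral>d u\<in>Cv w. G c Y d Z u s)"
      by (simp only: sw_swap[of "Cv _" "C _"])
    also have "\<dots> = (\<ointegral>Y r\<in>C q. \<ointegral>Z s\<in>C r. \<ointegral>c w\<in>Cv v. \<ointegral>d u\<in>Cv w. G c Y d Z u s)"
      by (simp only: sw_swap[of "Cv _" "C _"])
    finally show ?thesis .
  qed
  note pT = coaction_onD[OF p, OF T, where v = q]
  have "(\<ointegral>c w\<in>Cv v. \<ointegral>Y r\<in>C q. \<ointegral>c1 c2\<in>Dc c. \<ointegral>Y1 Y2\<in>D Y. F (c1, Y1) (c2, Y2) (w, r))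
     = (\<ointegral>Y r\<in>C q. \<ointegral>Y1 Y2\<in>D Y. \<ointegral>c w\<in>Cv v. \<ointegral>c1 c2\<in>Dc c. F (c1, Y1) (c2, Y2) (w, r))"
  proof -
    have "(\<ointegral>c w\<in>Cv v. \<ointegral>Y r\<in>C q. \<ointegral>c1 c2\<in>Dc c. \<ointegral>Y1 Y2\<in>D Y. F (c1, Y1) (c2, Y2) (w, r))
      = (\<ointegral>Y r\<in>C q. \<ointegral>c w\<in>Cv v. \<ointegral>c1 c2\<in>Dc c. \<ointegral>Y1 Y2\<in>D Y. F (c1, Y1) (c2, Y2) (w, r))" by (rule sw_swap)
    also have "\<dots> = (\<ointegral>Y r\<in>C q. \<ointegral>c w\<in>Cv v. \<ointegral>Y1 Y2\<in>D Y. \<ointegral>c1 c2\<in>Dc c. F (c1, Y1) (c2, Y2) (w, r))"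
      by (simp only: sw_swap[of "Dc _" "D _"])
    also have "\<dots> = (\<ointegral>Y r\<in>C q. \<ointegral>Y1 Y2\<in>D Y. \<ointegral>c w\<in>Cv v. \<ointegral>c1 c2\<in>Dc c. F (c1, Y1) (c2, Y2) (w, r))"
      by (simp only: sw_swap[of "Cv _" "D _"])
    finally show ?thesis .
  qed
  also have "\<dots> = (\<ointegral>Y r\<in>C q. \<ointegral>Y1 Y2\<in>D Y. ?F Y1 Y2 r)"
  proof -
    have "(\<ointegral>c w\<in>Cv v. \<ointegral>c1 c2\<in>Dc c. F (c1, Y1) (c2, Y2) (w, r)) = ?F Y1 Y2 r" for Y1 Y2 r
      by (rule coaction_onD(1)[OF v, OF K])
    then show ?thesis by simp
  qed
  finally have one: "(\<ointegral>c w\<in>Cv v. \<ointegral>Y r\<in>C q. \<ointegral>c1 c2\<in>Dc c. \<ointegral>Y1 Y2\<in>D Y. F (c1, Y1) (c2, Y2) (w, r))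
     = (\<ointegral>c w\<in>Cv v. \<ointegral>Y r\<in>C q. \<ointegral>d u\<in>Cv w. \<ointegral>Z s\<in>C r. F (c, Y) (d, Z) (u, s))"
    by (simp only: pT(1) split)
  show "(\<ointegral>c w\<in>case vq of (v, q) \<Rightarrow> pr (Cv v) (C q).
            \<ointegral>c1 c2\<in>case c of (c, Y) \<Rightarrow> pr (Dc c) (D Y). F c1 c2 w) =
        (\<ointegral>c w\<in>case vq of (v, q) \<Rightarrow> pr (Cv v) (C q).
            \<ointegral>d u\<in>case w of (v, q) \<Rightarrow> pr (Cv v) (C q). F c d u) \<and>
      (\<forall>b. (\<ointegral>c w\<in>case vq of (v, q) \<Rightarrow> pr (Cv v) (C q).
            \<ointegral>d u\<in>case w of (v, q) \<Rightarrow> pr (Cv v) (C q). F (case c of (c, Y) \<Rightarrow> (c, rt' b Y)) d u) =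
        (\<ointegral>c w\<in>case vq of (v, q) \<Rightarrow> pr (Cv v) (C q).
            \<ointegral>d u\<in>case w of (v, q) \<Rightarrow> pr (Cv v) (C q). F c (case d of (c, Y) \<Rightarrow> (c, rs' b Y)) u)) \<and>
      (\<forall>b. (\<ointegral>c w\<in>case vq of (v, q) \<Rightarrow> pr (Cv v) (C q).
            \<ointegral>d u\<in>case w of (v, q) \<Rightarrow> pr (Cv v) (C q). F c (case d of (c, Y) \<Rightarrow> (c, rt' b Y)) u) =
        (\<ointegral>c w\<in>case vq of (v, q) \<Rightarrow> pr (Cv v) (C q).
            \<ointegral>d u\<in>case w of (v, q) \<Rightarrow> pr (Cv v) (C q). F c d (case u of (v, q) \<Rightarrow> (v, re' b q))))"
  proof (intro conjI allI, goal_cases)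
    case 1
    show ?case unfolding vq prod.case sw_pr by (rule one)
  next
    case (2 b)
    show ?case unfolding vq prod.case sw_pr split by (rule pT(2))
  next
    case (3 b)
    show ?case unfolding vq prod.case sw_pr split by (rule pT(3))
  qed
qed


section \<open>Comodule algebras through test functions\<close>

subsection \<open>Triple tensor products\<close>

text \<open>
  Balanced maps vanish on the relations of \<open>\<L> \<diamond> \<L> \<diamond> N\<close>.
\<close>

lemma tri_bal_kills:
  assumes "tri_bal lt ls la \<gamma>"
  shows "kills ({frag_of (X + X', Y, n) - frag_of (X, Y, n) - frag_of (X', Y, n) | X X' Y n. True} \<union>
      {frag_of (X, Y + Y', n) - frag_of (X, Y, n) - frag_of (X, Y', n) | X Y Y' n. True} \<union>
      {frag_of (X, Y, n + n') - frag_of (X, Y, n) - frag_of (X, Y, n') | X Y n n'. True} \<union>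
      {frag_of (lt b X, Y, n) - frag_of (X, ls b Y, n) | b X Y n. True} \<union>
      {frag_of (X, lt b Y, n) - frag_of (X, Y, la b n) | b X Y n. True}) (\<lambda>(X, Y, n). \<gamma> X Y n)"
proof -
  have *: "\<gamma> (X + X') Y n = \<gamma> X Y n + \<gamma> X' Y n" "\<gamma> X (Y + Y') n = \<gamma> X Y n + \<gamma> X Y' n"
    "\<gamma> X Y (n + n') = \<gamma> X Y n + \<gamma> X Y n'" "\<gamma> (lt b X) Y n = \<gamma> X (ls b Y) n" "\<gamma> X (lt b Y) n = \<gamma> X Y (la b n)"
    for X X' Y Y' n n' b
    using assms unfolding tri_bal_def triadd_def by blast+
  show ?thesis
    unfolding kills_def
    by (rule ballI, unfold Un_iff mem_Collect_eq, elim disjE exE conjE; hypsubst)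
       (simp_all only: isum_diff isum_add isum_of prod.case * diff_diff_eq right_minus_eq)
qed

lemma coassociativeD:
  assumes "coassociative L lact \<delta>"
    and g: "tri_bal (\<lambda>b X. tgt L b \<cdot>\<^bsub>L\<^esub> X) (\<lambda>b X. src L b \<cdot>\<^bsub>L\<^esub> X) lact \<gamma>"
  shows "(\<ointegral>X q\<in>rep (\<delta> p). \<ointegral>X1 X2\<in>rep (cop L X). \<gamma> X1 X2 q) = (\<ointegral>X q\<in>rep (\<delta> p). \<ointegral>Y r\<in>rep (\<delta> q). \<gamma> X Y r)"
proof -
  let ?d = "frag_extend (\<lambda>(X, q). frag_extend (\<lambda>(X1, X2). frag_of (X1, X2, q)) (rep (cop L X))) (rep (\<delta> p))
    - frag_extend (\<lambda>(X, q). frag_extend (\<lambda>(Y, r). frag_of (X, Y, r)) (rep (\<delta> q))) (rep (\<delta> p))"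
  have "?d \<in> diamond3_null L lact" using assms(1) unfolding coassociative_def ..
  from isum_generate[OF _ tri_bal_kills[OF g] this[unfolded diamond3_null_def]]
  have "isum (\<lambda>(X, Y, n). \<gamma> X Y n) ?d = 0" by simp
  then show ?thesis
    by (simp add: isum_diff sw_def isum_frag_extend case_prod_unfold)
qed


subsection \<open>Balanced maps on \<open>\<L> \<diamond> N\<close>\<close>

abbreviation dbal :: "('k, 'b, 'l::ab_group_add) bialgd \<Rightarrow> ('b \<Rightarrow> 'n \<Rightarrow> 'n) \<Rightarrow>
    ('l \<Rightarrow> 'n::ab_group_add \<Rightarrow> 'g::ab_group_add) \<Rightarrow> bool" where
  "dbal L lact \<equiv> bal UNIV (\<lambda>b X. tgt L b \<cdot>\<^bsub>L\<^esub> X) lact"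

lemma dcls_eqD: "dcls L lact x = dcls L lact y \<Longrightarrow> dbal L lact \<beta> \<Longrightarrow> (\<ointegral>m n\<in>x. \<beta> m n) = (\<ointegral>m n\<in>y. \<beta> m n)"
  unfolding dcls_def by (rule tcls_eqD)

lemma dcls_eqI:
  fixes lact :: "'b \<Rightarrow> 'n::ab_group_add \<Rightarrow> 'n" and L :: "('k, 'b, 'l::ab_group_add) bialgd"
  assumes "\<And>\<beta> :: 'l \<Rightarrow> 'n \<Rightarrow> ('l \<times> 'n \<Rightarrow>\<^sub>0 int) quo. dbal L lact \<beta> \<Longrightarrow> (\<ointegral>m n\<in>x. \<beta> m n) = (\<ointegral>m n\<in>y. \<beta> m n)"
  shows "dcls L lact x = dcls L lact y"
  unfolding dcls_def using assms by (rule tcls_eqI)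

lemma carrier_diamond: "carrier (diamond L lact) = range (dcls L lact)"
  unfolding dcls_def diamond_def by (rule carrier_tensor_tmod)

lemma dcls_rep: "c \<in> carrier (diamond L lact) \<Longrightarrow> dcls L lact (rep c) = c"
  unfolding dcls_def diamond_def by (rule tcls_rep)

lemma diamond_mult: "dcls L lact x \<otimes>\<^bsub>diamond L lact\<^esub> dcls L lact y = dcls L lact (x + y)"
  unfolding dcls_def diamond_def by (rule tensor_tmod_mult)

lemma sw_rep_dcls: "dbal L lact \<beta> \<Longrightarrow> (\<ointegral>m n\<in>rep (dcls L lact x). \<beta> m n) = (\<ointegral>m n\<in>x. \<beta> m n)"
  unfolding dcls_def by (rule sw_rep_tcls)

subsection \<open>Bialgebroids and comodule algebras\<close>

lemma k_algebraD:
  assumes "k_algebra A"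
  shows "(x \<cdot>\<^bsub>A\<^esub> y) \<cdot>\<^bsub>A\<^esub> z = x \<cdot>\<^bsub>A\<^esub> (y \<cdot>\<^bsub>A\<^esub> z)" "unt A \<cdot>\<^bsub>A\<^esub> x = x" "x \<cdot>\<^bsub>A\<^esub> unt A = x"
    "x \<cdot>\<^bsub>A\<^esub> (y + z) = x \<cdot>\<^bsub>A\<^esub> y + x \<cdot>\<^bsub>A\<^esub> z" "(x + y) \<cdot>\<^bsub>A\<^esub> z = x \<cdot>\<^bsub>A\<^esub> z + y \<cdot>\<^bsub>A\<^esub> z"
    "scl A c x \<cdot>\<^bsub>A\<^esub> y = scl A c (x \<cdot>\<^bsub>A\<^esub> y)" "x \<cdot>\<^bsub>A\<^esub> scl A c y = scl A c (x \<cdot>\<^bsub>A\<^esub> y)"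
    "vector_space (scl A)"
  using assms unfolding k_algebra_def by blast+

lemma alg_homD:
  assumes "alg_hom A C f"
  shows "f (unt A) = unt C" "f (x \<cdot>\<^bsub>A\<^esub> y) = f x \<cdot>\<^bsub>C\<^esub> f y" "f (x + y) = f x + f y" "f (scl A c x) = scl C c (f x)"
  using assms unfolding alg_hom_def Vector_Spaces.linear_def module_hom_def module_hom_axioms_def by blast+

text \<open>
  A bialgebroid is a comodule algebra over itself by its coproduct, so whatever is shown for comodule
  algebras also holds for bialgebroids.
\<close>

definition self :: "('k, 'b, 'l) bialgd \<Rightarrow> ('k, 'b, 'l, 'l) comodalg" where
  "self L = \<lparr>scl = scl L, prd = prd L, unt = unt L, emb = src L, coact = cop L\<rparr>"

lemma self_simps [simp]:
  "scl (self L) = scl L" "prd (self L) = prd L" "unt (self L) = unt L" "emb (self L) = src L" "coact (self L) = cop L"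
  by (simp_all add: self_def)

locale bialgebroid =
  fixes B :: "('k::field, 'b::ab_group_add) alg" and L :: "('k, 'b, 'l::ab_group_add) bialgd"
  assumes lb: "left_bialgebroid B L"
begin

abbreviation multB (infixl \<open>\<cdot>\<^sub>B\<close> 70) where "b \<cdot>\<^sub>B c \<equiv> prd B b c"
abbreviation multL (infixl \<open>\<cdot>\<^sub>L\<close> 70) where "X \<cdot>\<^sub>L Y \<equiv> prd L X Y"
abbreviation s where "s \<equiv> src L"
abbreviation t where "t \<equiv> tgt L"
abbreviation \<epsilon> where "\<epsilon> \<equiv> cou L"
abbreviation D where "D X \<equiv> rep (cop L X)"
abbreviation lbal where "lbal \<equiv> dbal L (\<lambda>b X. s b \<cdot>\<^sub>L X)"

lemmas lb' = lb[unfolded left_bialgebroid_def Let_def]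

lemmas kB = lb'[THEN conjunct1, rule_format]
lemmas kL = lb'[THEN conjunct2, THEN conjunct1, rule_format]
lemmas s_hom = lb'[THEN conjunct2, THEN conjunct2, THEN conjunct1, rule_format]
lemmas t_hom = lb'[THEN conjunct2, THEN conjunct2, THEN conjunct2, THEN conjunct1, rule_format]
lemmas s_t = lb'[THEN conjunct2, THEN conjunct2, THEN conjunct2, THEN conjunct2, THEN conjunct1, rule_format]
lemmas lb_tak = lb'[THEN conjunct2, THEN conjunct2, THEN conjunct2, THEN conjunct2, THEN conjunct2, THEN conjunct1, rule_format]
lemmas lb_add = lb'[THEN conjunct2, THEN conjunct2, THEN conjunct2, THEN conjunct2, THEN conjunct2, THEN conjunct2, THEN conjunct1, rule_format]
lemmas lb_lin = lb'[THEN conjunct2, THEN conjunct2, THEN conjunct2, THEN conjunct2, THEN conjunct2, THEN conjunct2, THEN conjunct2, THEN conjunct1, rule_format]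
lemmas lb_coassoc = lb'[THEN conjunct2, THEN conjunct2, THEN conjunct2, THEN conjunct2, THEN conjunct2, THEN conjunct2, THEN conjunct2, THEN conjunct2, THEN conjunct1, rule_format]
lemmas lb_one = lb'[THEN conjunct2, THEN conjunct2, THEN conjunct2, THEN conjunct2, THEN conjunct2, THEN conjunct2, THEN conjunct2, THEN conjunct2, THEN conjunct2, THEN conjunct1, rule_format]
lemmas lb_mult = lb'[THEN conjunct2, THEN conjunct2, THEN conjunct2, THEN conjunct2, THEN conjunct2, THEN conjunct2, THEN conjunct2, THEN conjunct2, THEN conjunct2, THEN conjunct2, THEN conjunct1, rule_format]
lemmas lb_\<epsilon>_add = lb'[THEN conjunct2, THEN conjunct2, THEN conjunct2, THEN conjunct2, THEN conjunct2, THEN conjunct2, THEN conjunct2, THEN conjunct2, THEN conjunct2, THEN conjunct2, THEN conjunct2, THEN conjunct1, rule_format]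
lemmas \<epsilon>_st = lb'[THEN conjunct2, THEN conjunct2, THEN conjunct2, THEN conjunct2, THEN conjunct2, THEN conjunct2, THEN conjunct2, THEN conjunct2, THEN conjunct2, THEN conjunct2, THEN conjunct2, THEN conjunct2, THEN conjunct1, rule_format]
lemmas lb_counit_s = lb'[THEN conjunct2, THEN conjunct2, THEN conjunct2, THEN conjunct2, THEN conjunct2, THEN conjunct2, THEN conjunct2, THEN conjunct2, THEN conjunct2, THEN conjunct2, THEN conjunct2, THEN conjunct2, THEN conjunct2, THEN conjunct1, rule_format]
lemmas lb_counit_t = lb'[THEN conjunct2, THEN conjunct2, THEN conjunct2, THEN conjunct2, THEN conjunct2, THEN conjunct2, THEN conjunct2, THEN conjunct2, THEN conjunct2, THEN conjunct2, THEN conjunct2, THEN conjunct2, THEN conjunct2, THEN conjunct2, THEN conjunct1, rule_format]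
lemmas lb_\<epsilon>_one = lb'[THEN conjunct2, THEN conjunct2, THEN conjunct2, THEN conjunct2, THEN conjunct2, THEN conjunct2, THEN conjunct2, THEN conjunct2, THEN conjunct2, THEN conjunct2, THEN conjunct2, THEN conjunct2, THEN conjunct2, THEN conjunct2, THEN conjunct2, THEN conjunct1, rule_format]
lemmas lb_\<epsilon>_mult = lb'[THEN conjunct2, THEN conjunct2, THEN conjunct2, THEN conjunct2, THEN conjunct2, THEN conjunct2, THEN conjunct2, THEN conjunct2, THEN conjunct2, THEN conjunct2, THEN conjunct2, THEN conjunct2, THEN conjunct2, THEN conjunct2, THEN conjunct2, THEN conjunct2, rule_format]

lemmas B_simps [simp] = k_algebraD(1-5)[OF kB]
lemmas L_simps [simp] = k_algebraD(1-5)[OF kL]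

lemma s_simps [simp]: "s (unt B) = unt L" "s (b \<cdot>\<^sub>B c) = s b \<cdot>\<^sub>L s c" "s (b + c) = s b + s c"
  using alg_homD[OF s_hom] by auto

lemma t_simps [simp]: "t (unt B) = unt L" "t (b \<cdot>\<^sub>B c) = t c \<cdot>\<^sub>L t b" "t (b + c) = t b + t c"
  using alg_homD[OF t_hom] by (auto simp: op_alg_def)

lemma s_t_simps [simp]: "s b \<cdot>\<^sub>L t c = t c \<cdot>\<^sub>L s b" "s b \<cdot>\<^sub>L (t c \<cdot>\<^sub>L X) = t c \<cdot>\<^sub>L (s b \<cdot>\<^sub>L X)"
proof -
  show "s b \<cdot>\<^sub>L t c = t c \<cdot>\<^sub>L s b" by (rule s_t)
  have "s b \<cdot>\<^sub>L (t c \<cdot>\<^sub>L X) = (s b \<cdot>\<^sub>L t c) \<cdot>\<^sub>L X" by simp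
  also have "\<dots> = (t c \<cdot>\<^sub>L s b) \<cdot>\<^sub>L X" by (simp only: s_t)
  finally show "s b \<cdot>\<^sub>L (t c \<cdot>\<^sub>L X) = t c \<cdot>\<^sub>L (s b \<cdot>\<^sub>L X)" by simp
qed

lemma vsumL: "vsum L f c = isum f c" and vsumB: "vsum B g d = isum g d"
  using vsum_eq_isum k_algebraD(8) kL kB by blast+

lemma \<epsilon>_add [simp]: "\<epsilon> (X + Y) = \<epsilon> X + \<epsilon> Y" and \<epsilon>_one [simp]: "\<epsilon> (unt L) = unt B"
  by (rule lb_\<epsilon>_add lb_\<epsilon>_one)+

lemma \<epsilon>_s [simp]: "\<epsilon> (s b \<cdot>\<^sub>L X) = b \<cdot>\<^sub>B \<epsilon> X"
  using \<epsilon>_st[of b "unt B" X] by simp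

lemma \<epsilon>_t [simp]: "\<epsilon> (t b \<cdot>\<^sub>L X) = \<epsilon> X \<cdot>\<^sub>B b"
  using \<epsilon>_st[of "unt B" b X] by simp

lemma \<epsilon>_mult_s: "\<epsilon> (X \<cdot>\<^sub>L s (\<epsilon> Y)) = \<epsilon> (X \<cdot>\<^sub>L Y)" and \<epsilon>_mult_t: "\<epsilon> (X \<cdot>\<^sub>L t (\<epsilon> Y)) = \<epsilon> (X \<cdot>\<^sub>L Y)"
  using lb_\<epsilon>_mult[of X Y] by simp_all


text \<open>
  The compatibility of the coaction with \<open>p \<mapsto> b p b'\<close> and its value at \<open>1\<close> follow
  from multiplicativity and the value at elements of \<open>B\<close>.
\<close>

lemma comodule_algebraI:
  fixes P :: "('k, 'b, 'l, 'p::ab_group_add) comodalg"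
  defines "C \<equiv> \<lambda>p. rep (coact P p)"
  assumes alg: "k_algebra P" "alg_hom B P (emb P)"
    and tak: "\<And>p. coact P p \<in> takeuchi L (blact P) (bract P)"
    and add: "\<And>p q (\<beta> :: 'l \<Rightarrow> 'p \<Rightarrow> ('l \<times> 'p \<Rightarrow>\<^sub>0 int) quo). dbal L (blact P) \<beta> \<Longrightarrow>
      (\<ointegral>X r\<in>C (p + q). \<beta> X r) = (\<ointegral>X r\<in>C p. \<beta> X r) + (\<ointegral>X r\<in>C q. \<beta> X r)"
    and emb: "\<And>b (\<beta> :: 'l \<Rightarrow> 'p \<Rightarrow> ('l \<times> 'p \<Rightarrow>\<^sub>0 int) quo). dbal L (blact P) \<beta> \<Longrightarrow>
      (\<ointegral>X r\<in>C (emb P b). \<beta> X r) = \<beta> (s b) (unt P)"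
    and mult: "\<And>p q (\<beta> :: 'l \<Rightarrow> 'p \<Rightarrow> ('l \<times> 'p \<Rightarrow>\<^sub>0 int) quo). dbal L (blact P) \<beta> \<Longrightarrow>
      (\<ointegral>X r\<in>C (p \<cdot>\<^bsub>P\<^esub> q). \<beta> X r) = (\<ointegral>X p'\<in>C p. \<ointegral>Y q'\<in>C q. \<beta> (X \<cdot>\<^sub>L Y) (p' \<cdot>\<^bsub>P\<^esub> q'))"
    and coassoc: "coassociative L (blact P) (coact P)"
    and counit: "\<And>p. (\<ointegral>X q\<in>C p. emb P (\<epsilon> X) \<cdot>\<^bsub>P\<^esub> q) = p"
  shows "comodule_algebra B L P"
proof -
  note [simp] = k_algebraD(1-5)[OF alg(1)] alg_homD(1-3)[OF alg(2)]
  have car: "coact P p \<in> carrier (diamond L (blact P))" for p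
    using tak unfolding takeuchi_def by blast
  have one: "emb P (unt B) = unt P" by simp
  have eqI: "coact P p = dcls L (blact P) y"
    if "\<And>\<beta> :: 'l \<Rightarrow> 'p \<Rightarrow> ('l \<times> 'p \<Rightarrow>\<^sub>0 int) quo. dbal L (blact P) \<beta> \<Longrightarrow> (\<ointegral>X r\<in>C p. \<beta> X r) = (\<ointegral>X r\<in>y. \<beta> X r)" for p y
  proof -
    have "dcls L (blact P) (C p) = dcls L (blact P) y" by (rule dcls_eqI) (rule that)
    moreover have "dcls L (blact P) (C p) = coact P p" unfolding C_def by (rule dcls_rep[OF car])
    ultimately show ?thesis by simp
  qed
  have Ctak: "(\<ointegral>X r\<in>C p. \<beta> (X \<cdot>\<^sub>L t a) r) = (\<ointegral>X r\<in>C p. \<beta> X (r \<cdot>\<^bsub>P\<^esub> emb P a))"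
    if "dbal L (blact P) \<beta>" for p a and \<beta> :: "'l \<Rightarrow> 'p \<Rightarrow> ('l \<times> 'p \<Rightarrow>\<^sub>0 int) quo"
  proof -
    have "dcls L (blact P) (fmap2 (\<lambda>X. X \<cdot>\<^sub>L t a) id (C p)) = dcls L (blact P) (fmap2 id (bract P a) (C p))"
      using tak[of p] unfolding takeuchi_def C_def by blast
    from dcls_eqD[OF this that] show ?thesis by simp
  qed
  have lin: "(\<ointegral>X r\<in>C (emb P b \<cdot>\<^bsub>P\<^esub> p \<cdot>\<^bsub>P\<^esub> emb P b'). \<beta> X r) = (\<ointegral>X r\<in>C p. \<beta> (s b \<cdot>\<^sub>L X \<cdot>\<^sub>L s b') r)"
    if b: "dbal L (blact P) \<beta>" for b b' p and \<beta> :: "'l \<Rightarrow> 'p \<Rightarrow> ('l \<times> 'p \<Rightarrow>\<^sub>0 int) quo"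
  proof -
    note [simp] = balD(1,2)[OF b]
    have bal: "\<beta> (t c \<cdot>\<^sub>L X) r = \<beta> X (emb P c \<cdot>\<^bsub>P\<^esub> r)" for c X r using balD(3)[OF b] by simp
    have "dbal L (blact P) (\<lambda>Y r. \<ointegral>X q\<in>C p. \<beta> (s b \<cdot>\<^sub>L (X \<cdot>\<^sub>L Y)) (q \<cdot>\<^bsub>P\<^esub> r))"
    proof
      fix c Y r
      have "dbal L (blact P) (\<lambda>X q. \<beta> (s b \<cdot>\<^sub>L (X \<cdot>\<^sub>L Y)) (q \<cdot>\<^bsub>P\<^esub> r))" by standard (simp_all flip: bal)
      from Ctak[OF this, of p c] show "(\<ointegral>X q\<in>C p. \<beta> (s b \<cdot>\<^sub>L (X \<cdot>\<^sub>L (t c \<cdot>\<^sub>L Y))) (q \<cdot>\<^bsub>P\<^esub> r)) =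
        (\<ointegral>X q\<in>C p. \<beta> (s b \<cdot>\<^sub>L (X \<cdot>\<^sub>L Y)) (q \<cdot>\<^bsub>P\<^esub> (emb P c \<cdot>\<^bsub>P\<^esub> r)))" by simp
    qed (simp_all add: sw_plus)
    note r = emb[OF this, of b']
    have "dbal L (blact P) (\<lambda>X q. \<ointegral>Y r\<in>C (p \<cdot>\<^bsub>P\<^esub> emb P b'). \<beta> (X \<cdot>\<^sub>L Y) (q \<cdot>\<^bsub>P\<^esub> r))"
      by standard (simp_all add: sw_plus bal)
    note l = emb[OF this, of b]
    have "(\<ointegral>X r\<in>C (emb P b \<cdot>\<^bsub>P\<^esub> (p \<cdot>\<^bsub>P\<^esub> emb P b')). \<beta> X r) =
        (\<ointegral>Y r\<in>C (p \<cdot>\<^bsub>P\<^esub> emb P b'). \<beta> (s b \<cdot>\<^sub>L Y) r)"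
      using l by (simp add: mult[OF b])
    also have "\<dots> = (\<ointegral>X q\<in>C p. \<ointegral>Y r\<in>C (emb P b'). \<beta> (s b \<cdot>\<^sub>L (X \<cdot>\<^sub>L Y)) (q \<cdot>\<^bsub>P\<^esub> r))"
      by (rule mult) (rule balI; simp flip: bal)
    also have "\<dots> = (\<ointegral>X r\<in>C p. \<beta> (s b \<cdot>\<^sub>L X \<cdot>\<^sub>L s b') r)"
      unfolding sw_swap[of "C p"] r by simp
    finally show ?thesis by simp
  qed
  show ?thesis
    unfolding comodule_algebra_def
  proof (intro conjI allI)
    show "coact P (p + q) = coact P p \<otimes>\<^bsub>diamond L (blact P)\<^esub> coact P q" for p q
    proof -
      have "coact P p \<otimes>\<^bsub>diamond L (blact P)\<^esub> coact P q = dcls L (blact P) (C p + C q)"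
        unfolding C_def diamond_mult[symmetric] by (simp add: dcls_rep car)
      moreover have "coact P (p + q) = dcls L (blact P) (C p + C q)"
        by (rule eqI) (simp add: add sw_add)
      ultimately show ?thesis by simp
    qed
    show "coact P (emb P b \<cdot>\<^bsub>P\<^esub> p \<cdot>\<^bsub>P\<^esub> emb P b') =
        dcls L (blact P) (fmap2 (\<lambda>X. s b \<cdot>\<^sub>L X \<cdot>\<^sub>L s b') id (rep (coact P p)))" for b b' p
      by (rule eqI) (use lin in \<open>simp add: C_def\<close>)
    show "vsum P (\<lambda>(X, q). emb P (\<epsilon> X) \<cdot>\<^bsub>P\<^esub> q) (rep (coact P p)) = p" for p
      using counit[of p] by (simp add: vsum_eq_isum[OF k_algebraD(8)[OF alg(1)]] sw_def C_def)
    show "coact P (emb P b) = dcls L (blact P) (frag_of (s b, unt P))" for b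
      by (rule eqI) (simp add: emb)
    show "coact P (unt P) = dcls L (blact P) (frag_of (unt L, unt P))"
      by (rule eqI) (simp add: emb flip: one)
    show "coact P (p \<cdot>\<^bsub>P\<^esub> q) = dcls L (blact P) (fprod (prd L) (prd P) (rep (coact P p)) (rep (coact P q)))" for p q
      by (rule eqI) (simp add: mult, simp add: C_def)
  qed (use alg tak coassoc in auto)
qed

lemma self_comodule_algebra: "comodule_algebra B L (self L)"
proof (rule comodule_algebraI)
  let ?lact = "\<lambda>b X. s b \<cdot>\<^sub>L X"
  have tak: "cop L X \<in> takeuchi L ?lact (\<lambda>b X. X \<cdot>\<^sub>L s b)" for X by (rule lb_tak)
  then have car: "cop L X \<in> carrier (diamond L ?lact)" for X unfolding takeuchi_def by blast
  have vs: "vector_space (scl L)" using kL by (rule k_algebraD)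
  show "k_algebra (self L)" using kL unfolding k_algebra_def by simp
  show "alg_hom B (self L) (emb (self L))" using s_hom unfolding alg_hom_def by simp
  show "coact (self L) X \<in> takeuchi L (blact (self L)) (bract (self L))" for X using tak by simp
  show "coassociative L (blact (self L)) (coact (self L))" using lb_coassoc by simp
  have "vsum L (\<lambda>(X1, X2). s (\<epsilon> X1) \<cdot>\<^sub>L X2) (D X) = X" for X by (rule lb_counit_s)
  then show "(\<ointegral>X q\<in>rep (coact (self L) p). emb (self L) (\<epsilon> X) \<cdot>\<^bsub>self L\<^esub> q) = p" for p
    by (simp add: vsumL sw_def)
  fix X Y :: 'l and \<beta> :: "'l \<Rightarrow> 'l \<Rightarrow> ('l \<times> 'l \<Rightarrow>\<^sub>0 int) quo"
  assume "dbal L (blact (self L)) \<beta>"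
  then have b: "dbal L ?lact \<beta>" by simp
  have "cop L (X + Y) = dcls L ?lact (D X + D Y)"
    unfolding diamond_mult[symmetric] dcls_rep[OF car] by (rule lb_add)
  then show "(\<ointegral>X r\<in>rep (coact (self L) (X + Y)). \<beta> X r) =
      (\<ointegral>X r\<in>rep (coact (self L) X). \<beta> X r) + (\<ointegral>X r\<in>rep (coact (self L) Y). \<beta> X r)"
    by (simp add: sw_rep_dcls[OF b] sw_add)
  have "cop L (X \<cdot>\<^sub>L Y) = dcls L ?lact (fprod (prd L) (prd L) (D X) (D Y))" by (rule lb_mult)
  then show "(\<ointegral>X r\<in>rep (coact (self L) (X \<cdot>\<^bsub>self L\<^esub> Y)). \<beta> X r) =
    (\<ointegral>X p'\<in>rep (coact (self L) X). \<ointegral>Y q'\<in>rep (coact (self L) Y). \<beta> (X \<cdot>\<^sub>L Y) (p' \<cdot>\<^bsub>self L\<^esub> q'))"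
    by (simp add: sw_rep_dcls[OF b])
next
  let ?lact = "\<lambda>b X. s b \<cdot>\<^sub>L X"
  fix b and \<beta> :: "'l \<Rightarrow> 'l \<Rightarrow> ('l \<times> 'l \<Rightarrow>\<^sub>0 int) quo"
  assume "dbal L (blact (self L)) \<beta>"
  then have b: "dbal L ?lact \<beta>" by simp
  have b2: "dbal L ?lact (\<lambda>X Y. \<beta> (s b \<cdot>\<^sub>L X) Y)"
  proof
    show "\<beta> (s b \<cdot>\<^sub>L (t r \<cdot>\<^sub>L m)) n = \<beta> (s b \<cdot>\<^sub>L m) (s r \<cdot>\<^sub>L n)" for r m n
      using balD(3)[OF b, of r "s b \<cdot>\<^sub>L m"] by simp
  qed (simp_all add: balD(1,2)[OF b])
  have "cop L (s b \<cdot>\<^sub>L t (unt B) \<cdot>\<^sub>L unt L) =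
      dcls L ?lact (fmap2 (\<lambda>X1. s b \<cdot>\<^sub>L X1) (\<lambda>X2. t (unt B) \<cdot>\<^sub>L X2) (D (unt L)))"
    by (rule lb_lin)
  then have "cop L (s b) = dcls L ?lact (fmap2 (\<lambda>X1. s b \<cdot>\<^sub>L X1) (\<lambda>X2. X2) (D (unt L)))" by simp
  moreover have "cop L (unt L) = dcls L ?lact (frag_of (unt L, unt L))" by (rule lb_one)
  ultimately show "(\<ointegral>X r\<in>rep (coact (self L) (emb (self L) b)). \<beta> X r) = \<beta> (s b) (unt (self L))"
    by (simp add: sw_rep_dcls[OF b] sw_rep_dcls[OF b2])
qed

end

locale comodalg = bialgebroid B L for B :: "('k::field, 'b::ab_group_add) alg"
    and L :: "('k, 'b, 'l::ab_group_add) bialgd" +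
  fixes P :: "('k, 'b, 'l, 'p::ab_group_add) comodalg"
  assumes ca: "comodule_algebra B L P"
begin

abbreviation multP (infixl \<open>\<cdot>\<^sub>P\<close> 70) where "p \<cdot>\<^sub>P q \<equiv> prd P p q"
abbreviation e where "e \<equiv> emb P"
abbreviation C where "C p \<equiv> rep (coact P p)"
abbreviation pbal where "pbal \<equiv> dbal L (blact P)"

lemmas ca' = ca[unfolded comodule_algebra_def]

lemmas kP = ca'[THEN conjunct1, rule_format]
lemmas e_hom = ca'[THEN conjunct2, THEN conjunct1, rule_format]
lemmas tak_C = ca'[THEN conjunct2, THEN conjunct2, THEN conjunct1, rule_format]
lemmas ca_add = ca'[THEN conjunct2, THEN conjunct2, THEN conjunct2, THEN conjunct1, rule_format]
lemmas ca_bimod = ca'[THEN conjunct2, THEN conjunct2, THEN conjunct2, THEN conjunct2, THEN conjunct1, rule_format]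
lemmas coassociative_C = ca'[THEN conjunct2, THEN conjunct2, THEN conjunct2, THEN conjunct2, THEN conjunct2, THEN conjunct1, rule_format]
lemmas ca_counit = ca'[THEN conjunct2, THEN conjunct2, THEN conjunct2, THEN conjunct2, THEN conjunct2, THEN conjunct2, THEN conjunct1, rule_format]
lemmas ca_emb = ca'[THEN conjunct2, THEN conjunct2, THEN conjunct2, THEN conjunct2, THEN conjunct2, THEN conjunct2, THEN conjunct2, THEN conjunct1, rule_format]
lemmas ca_mult = ca'[THEN conjunct2, THEN conjunct2, THEN conjunct2, THEN conjunct2, THEN conjunct2, THEN conjunct2, THEN conjunct2, THEN conjunct2, THEN conjunct2, rule_format]

lemmas P_simps [simp] = k_algebraD(1-5)[OF kP]

lemma e_simps [simp]: "e (unt B) = unt P" "e (b \<cdot>\<^sub>B c) = e b \<cdot>\<^sub>P e c" "e (b + c) = e b + e c"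
  using alg_homD[OF e_hom] by auto

lemma vsumP: "vsum P f c = isum f c"
  using vsum_eq_isum k_algebraD(8) kP by blast

lemma C_carrier: "coact P p \<in> carrier (diamond L (blact P))"
  using tak_C unfolding takeuchi_def by blast

lemma C_cls: "dcls L (blact P) (C p) = coact P p"
  by (rule dcls_rep[OF C_carrier])

context
  fixes \<beta> :: "'l \<Rightarrow> 'p \<Rightarrow> 'g::ab_group_add"
  assumes b: "pbal \<beta>"
begin

lemma C_add: "(\<ointegral>X r\<in>C (p + q). \<beta> X r) = (\<ointegral>X r\<in>C p. \<beta> X r) + (\<ointegral>X r\<in>C q. \<beta> X r)"
proof -
  have "coact P (p + q) = dcls L (blact P) (C p + C q)"
    unfolding diamond_mult[symmetric] C_cls by (rule ca_add)
  then show ?thesis using sw_rep_dcls[OF b] by (simp add: sw_add)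
qed

lemma C_sw: "(\<ointegral>X r\<in>C (\<ointegral>x y\<in>c. F x y). \<beta> X r) = (\<ointegral>x y\<in>c. \<ointegral>X r\<in>C (F x y). \<beta> X r)"
  by (rule sw_hom[of "\<lambda>p. \<ointegral>X r\<in>C p. \<beta> X r"]) (rule C_add)

lemma C_tak: "(\<ointegral>X r\<in>C p. \<beta> (X \<cdot>\<^sub>L t a) r) = (\<ointegral>X r\<in>C p. \<beta> X (r \<cdot>\<^sub>P e a))"
proof -
  have "dcls L (blact P) (fmap2 (\<lambda>X. X \<cdot>\<^sub>L t a) id (C p)) = dcls L (blact P) (fmap2 id (bract P a) (C p))"
    using tak_C[of p] unfolding takeuchi_def by blast
  from dcls_eqD[OF this b] show ?thesis by simp
qed

lemma C_bimod: "(\<ointegral>X r\<in>C (e b \<cdot>\<^sub>P p \<cdot>\<^sub>P e b'). \<beta> X r) = (\<ointegral>X r\<in>C p. \<beta> (s b \<cdot>\<^sub>L X \<cdot>\<^sub>L s b') r)"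
proof -
  have "coact P (e b \<cdot>\<^sub>P p \<cdot>\<^sub>P e b') = dcls L (blact P) (fmap2 (\<lambda>X. s b \<cdot>\<^sub>L X \<cdot>\<^sub>L s b') id (C p))"
    by (rule ca_bimod)
  then show ?thesis by (simp only: sw_rep_dcls[OF b] sw_fmap2 id_apply)
qed

lemma C_left: "(\<ointegral>X r\<in>C (e b \<cdot>\<^sub>P p). \<beta> X r) = (\<ointegral>X r\<in>C p. \<beta> (s b \<cdot>\<^sub>L X) r)"
  using C_bimod[of b p "unt B"] by simp

lemma C_right: "(\<ointegral>X r\<in>C (p \<cdot>\<^sub>P e b). \<beta> X r) = (\<ointegral>X r\<in>C p. \<beta> (X \<cdot>\<^sub>L s b) r)"
  using C_bimod[of "unt B" p b] by simp

lemma C_emb: "(\<ointegral>X r\<in>C (e b). \<beta> X r) = \<beta> (s b) (unt P)"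
proof -
  have "coact P (e b) = dcls L (blact P) (frag_of (s b, unt P))" by (rule ca_emb)
  then show ?thesis by (simp only: sw_rep_dcls[OF b] sw_of)
qed

lemma C_one: "(\<ointegral>X r\<in>C (unt P). \<beta> X r) = \<beta> (unt L) (unt P)"
  using C_emb[of "unt B"] by simp

lemma C_mult: "(\<ointegral>X r\<in>C (p \<cdot>\<^sub>P q). \<beta> X r) = (\<ointegral>X p'\<in>C p. \<ointegral>Y q'\<in>C q. \<beta> (X \<cdot>\<^sub>L Y) (p' \<cdot>\<^sub>P q'))"
proof -
  have "coact P (p \<cdot>\<^sub>P q) = dcls L (blact P) (fprod (prd L) (prd P) (C p) (C q))" by (rule ca_mult)
  then show ?thesis by (simp only: sw_rep_dcls[OF b] sw_fprod)
qed

end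

lemma counit: "(\<ointegral>X q\<in>C p. e (\<epsilon> X) \<cdot>\<^sub>P q) = p"
proof -
  have "vsum P (\<lambda>(X, q). e (\<epsilon> X) \<cdot>\<^sub>P q) (C p) = p" by (rule ca_counit)
  then show ?thesis by (simp add: vsumP sw_def)
qed

lemma counit_hom:
  assumes "\<And>p q. h (p + q) = h p + h q"
  shows "(\<ointegral>X q\<in>C p. h (e (\<epsilon> X) \<cdot>\<^sub>P q)) = h p"
  using sw_hom[of h "C p" "\<lambda>X q. e (\<epsilon> X) \<cdot>\<^sub>P q", OF assms] by (simp add: counit)

abbreviation tri where
  "tri \<equiv> tri_bal (\<lambda>b X. t b \<cdot>\<^sub>L X) (\<lambda>b X. s b \<cdot>\<^sub>L X) (\<lambda>b p. e b \<cdot>\<^sub>P p)"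

lemma coassoc:
  assumes "tri \<gamma>"
  shows "(\<ointegral>X q\<in>C p. \<ointegral>X1 X2\<in>D X. \<gamma> X1 X2 q) = (\<ointegral>X q\<in>C p. \<ointegral>Y r\<in>C q. \<gamma> X Y r)"
  by (rule coassociativeD[OF coassociative_C assms])

text \<open>
  The Takeuchi condition of \<open>p\<^sub>-\<^sub>1 \<otimes> p\<^sub>0\<close> moves a right multiplication by \<open>\<bar>b\<close> from \<open>p\<^sub>-\<^sub>1\<close> to a right
  multiplication by \<open>b\<close> on \<open>p\<^sub>0\<close>; when \<open>p\<^sub>0\<close> is coacted on again, that becomes a right multiplication on its
  first component.
\<close>

lemma coaction_on_C:
  "coaction_on C D (\<lambda>b X. X \<cdot>\<^sub>L t b) (\<lambda>b X. X \<cdot>\<^sub>L s b) (\<lambda>b p. p \<cdot>\<^sub>P e b) tri"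
  unfolding coaction_on_def
proof (intro allI impI conjI)
  fix F :: "'l \<Rightarrow> 'l \<Rightarrow> 'p \<Rightarrow> 'g::ab_group_add" and p b
  assume F: "tri F"
  then have [simp]: "F (X + X') Y q = F X Y q + F X' Y q" "F X (Y + Y') q = F X Y q + F X Y' q"
    "F X Y (q + q') = F X Y q + F X Y q'" and tb: "F (t b \<cdot>\<^sub>L X) Y q = F X (s b \<cdot>\<^sub>L Y) q" "F X (t b \<cdot>\<^sub>L Y) q = F X Y (e b \<cdot>\<^sub>P q)"
    for X X' Y Y' q q' b unfolding tri_bal_def triadd_def by blast+
  show "(\<ointegral>X q\<in>C p. \<ointegral>X1 X2\<in>D X. F X1 X2 q) = (\<ointegral>X q\<in>C p. \<ointegral>Y r\<in>C q. F X Y r)"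
    using F by (rule coassoc)
  have b: "pbal (F X)" for X by standard (simp_all add: tb)
  show "(\<ointegral>X q\<in>C p. \<ointegral>Y r\<in>C q. F X (Y \<cdot>\<^sub>L t b) r) = (\<ointegral>X q\<in>C p. \<ointegral>Y r\<in>C q. F X Y (r \<cdot>\<^sub>P e b))"
    by (simp add: C_tak[OF b])
  have "pbal (\<lambda>X q. \<ointegral>Y r\<in>C q. F X Y r)"
    by standard (simp_all add: sw_plus C_add[OF b] C_left[OF b] tb)
  from C_tak[OF this]
  show "(\<ointegral>X q\<in>C p. \<ointegral>Y r\<in>C q. F (X \<cdot>\<^sub>L t b) Y r) = (\<ointegral>X q\<in>C p. \<ointegral>Y r\<in>C q. F X (Y \<cdot>\<^sub>L s b) r)"
    by (simp add: C_right[OF b])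
qed

end

sublocale bialgebroid \<subseteq> self: comodalg B L "self L"
  rewrites "prd (self L) = prd L" and "unt (self L) = unt L" and "scl (self L) = scl L"
    and "emb (self L) = src L" and "coact (self L) = cop L"
  by (intro comodalg.intro comodalg_axioms.intro bialgebroid_axioms self_comodule_algebra) simp_all

context bialgebroid
begin

lemmas D_add = self.C_add and D_left_s = self.C_left and D_right_s = self.C_right and D_mult = self.C_mult
  and D_tak = self.C_tak and D_s = self.C_emb and D_one = self.C_one and D_sw = self.C_sw

lemma D_left_t:
  assumes b: "lbal \<beta>"
  shows "(\<ointegral>X1 X2\<in>D (t c \<cdot>\<^sub>L X). \<beta> X1 X2) = (\<ointegral>X1 X2\<in>D X. \<beta> X1 (t c \<cdot>\<^sub>L X2))"
proof -
  have "cop L (s (unt B) \<cdot>\<^sub>L t c \<cdot>\<^sub>L X) = dcls L (\<lambda>b X. s b \<cdot>\<^sub>L X)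
     (fmap2 (\<lambda>X1. s (unt B) \<cdot>\<^sub>L X1) (\<lambda>X2. t c \<cdot>\<^sub>L X2) (D X))"
    by (rule lb_lin)
  then show ?thesis by (simp add: sw_rep_dcls[OF b])
qed

lemma counit_t: "(\<ointegral>X1 X2\<in>D X. t (\<epsilon> X2) \<cdot>\<^sub>L X1) = X"
proof -
  have "vsum L (\<lambda>(X1, X2). t (\<epsilon> X2) \<cdot>\<^sub>L X1) (D X) = X" by (rule lb_counit_t)
  then show ?thesis by (simp add: vsumL sw_def)
qed

lemma counit_t_hom:
  assumes "\<And>p q. h (p + q) = h p + h q"
  shows "(\<ointegral>X1 X2\<in>D X. h (t (\<epsilon> X2) \<cdot>\<^sub>L X1)) = h X"
  using sw_hom[of h "D X" "\<lambda>X1 X2. t (\<epsilon> X2) \<cdot>\<^sub>L X1", OF assms] by (simp add: counit_t)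

lemma D_t:
  assumes b: "lbal \<beta>"
  shows "(\<ointegral>X1 X2\<in>D (t c). \<beta> X1 X2) = \<beta> (unt L) (t c)"
proof -
  have "lbal (\<lambda>X1 X2. \<beta> X1 (t c \<cdot>\<^sub>L X2))"
    by standard (simp_all add: balD(1,2)[OF b] balD(3)[OF b UNIV_I])
  from D_one[OF this] D_left_t[OF b, of c "unt L"] show ?thesis by simp
qed

text \<open>
  Follows from multiplicativity and \<open>\<Delta>(\<bar>c) = 1 \<otimes> \<bar>c\<close>; the product may be tested against a
  balanced function because of the Takeuchi condition for \<open>X\<close>.
\<close>

lemma D_right_t:
  assumes b: "lbal \<beta>"
  shows "(\<ointegral>X1 X2\<in>D (X \<cdot>\<^sub>L t c). \<beta> X1 X2) = (\<ointegral>X1 X2\<in>D X. \<beta> X1 (X2 \<cdot>\<^sub>L t c))"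
proof -
  have "lbal (\<lambda>Y1 Y2. \<ointegral>X1 X2\<in>D X. \<beta> (X1 \<cdot>\<^sub>L Y1) (X2 \<cdot>\<^sub>L Y2))"
  proof
    fix r m n
    have "lbal (\<lambda>X1 X2. \<beta> (X1 \<cdot>\<^sub>L m) (X2 \<cdot>\<^sub>L n))"
      by standard (simp_all add: balD(1,2)[OF b] balD(3)[OF b UNIV_I])
    from D_tak[OF this, of X r]
    show "(\<ointegral>X1 X2\<in>D X. \<beta> (X1 \<cdot>\<^sub>L (t r \<cdot>\<^sub>L m)) (X2 \<cdot>\<^sub>L n)) = (\<ointegral>X1 X2\<in>D X. \<beta> (X1 \<cdot>\<^sub>L m) (X2 \<cdot>\<^sub>L (s r \<cdot>\<^sub>L n)))"
      by simp
  qed (simp_all add: sw_plus balD(1,2)[OF b])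
  from D_t[OF this, of c] show ?thesis
    by (simp add: D_mult[OF b] sw_swap[of "D X"])
qed

end


section \<open>Convolution and cocycles\<close>

context comodalg
begin

text \<open>
  The conditions are those of the tensor product in which \<open>X1 \<otimes> Y1\<close>, \<open>X2 \<otimes> Y2\<close> and \<open>p \<otimes> q\<close> are
  balanced over \<open>B\<close> or \<open>B\<^sup>e\<close>.  They are identities for the integrand alone, usually closed by rewriting.
\<close>

lemma coassoc2:
  fixes F :: "'l \<Rightarrow> 'l \<Rightarrow> 'p \<Rightarrow> 'l \<Rightarrow> 'l \<Rightarrow> 'p \<Rightarrow> 'g::ab_group_add"
  assumes add: "\<And>X1 X1' X2 p Y1 Y2 q. F (X1 + X1') X2 p Y1 Y2 q = F X1 X2 p Y1 Y2 q + F X1' X2 p Y1 Y2 q"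
    "\<And>X1 X2 X2' p Y1 Y2 q. F X1 (X2 + X2') p Y1 Y2 q = F X1 X2 p Y1 Y2 q + F X1 X2' p Y1 Y2 q"
    "\<And>X1 X2 p p' Y1 Y2 q. F X1 X2 (p + p') Y1 Y2 q = F X1 X2 p Y1 Y2 q + F X1 X2 p' Y1 Y2 q"
    "\<And>X1 X2 p Y1 Y1' Y2 q. F X1 X2 p (Y1 + Y1') Y2 q = F X1 X2 p Y1 Y2 q + F X1 X2 p Y1' Y2 q"
    "\<And>X1 X2 p Y1 Y2 Y2' q. F X1 X2 p Y1 (Y2 + Y2') q = F X1 X2 p Y1 Y2 q + F X1 X2 p Y1 Y2' q"
    "\<And>X1 X2 p Y1 Y2 q q'. F X1 X2 p Y1 Y2 (q + q') = F X1 X2 p Y1 Y2 q + F X1 X2 p Y1 Y2 q'"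
    and bal: "\<And>b X1 X2 p Y1 Y2 q. F (t b \<cdot>\<^sub>L X1) X2 p Y1 Y2 q = F X1 (s b \<cdot>\<^sub>L X2) p Y1 Y2 q"
    "\<And>b X1 X2 p Y1 Y2 q. F X1 (t b \<cdot>\<^sub>L X2) p Y1 Y2 q = F X1 X2 (e b \<cdot>\<^sub>P p) Y1 Y2 q"
    and mid: "\<And>b X1 X2 p Y1 Y2 q. F X1 X2 p (t b \<cdot>\<^sub>L Y1) Y2 q = F (X1 \<cdot>\<^sub>L t b) X2 p Y1 Y2 q"
    "\<And>b X1 X2 p Y1 Y2 q. F X1 X2 p Y1 (s b \<cdot>\<^sub>L Y2) q = F X1 (X2 \<cdot>\<^sub>L s b) p Y1 Y2 q"
    "\<And>b X1 X2 p Y1 Y2 q. F X1 X2 p Y1 (t b \<cdot>\<^sub>L Y2) q = F X1 (X2 \<cdot>\<^sub>L t b) p Y1 Y2 q"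
    "\<And>b X1 X2 p Y1 Y2 q. F X1 X2 p Y1 Y2 (e b \<cdot>\<^sub>P q) = F X1 X2 (p \<cdot>\<^sub>P e b) Y1 Y2 q"
  shows "(\<ointegral>X p0\<in>C p. \<ointegral>Y q0\<in>C q. \<ointegral>X1 X2\<in>D X. \<ointegral>Y1 Y2\<in>D Y. F X1 X2 p0 Y1 Y2 q0) =
    (\<ointegral>X p0\<in>C p. \<ointegral>Y q0\<in>C q. \<ointegral>X2 p2\<in>C p0. \<ointegral>Y2 q2\<in>C q0. F X X2 p2 Y Y2 q2)"
proof -
  let ?F = "\<lambda>c1 c2 v. F (fst c1) (fst c2) (fst v) (snd c1) (snd c2) (snd v)"
  note co = coaction_on_pair[OF coaction_on_C coaction_on_C]
  have "pair_class tri (\<lambda>b X. X \<cdot>\<^sub>L t b) (\<lambda>b X. X \<cdot>\<^sub>L s b) (\<lambda>b p. p \<cdot>\<^sub>P e b)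
     (\<lambda>b X. t b \<cdot>\<^sub>L X) (\<lambda>b X. s b \<cdot>\<^sub>L X) (\<lambda>b p. e b \<cdot>\<^sub>P p) ?F"
    unfolding pair_class_def tri_bal_def triadd_def fst_conv snd_conv
    by (intro conjI allI; rule assms)
  from coaction_onD(1)[OF co, OF this, of "(p, q)"] show ?thesis by simp
qed

end

lemma Be_mapsD:
  assumes "f \<in> Be_maps B L"
  shows "f (X + X') Y = f X Y + f X' Y" "f X (Y + Y') = f X Y + f X Y'"
    "f (X \<cdot>\<^bsub>L\<^esub> (src L b \<cdot>\<^bsub>L\<^esub> tgt L c)) Y = f X ((src L b \<cdot>\<^bsub>L\<^esub> tgt L c) \<cdot>\<^bsub>L\<^esub> Y)"
    "f (src L b \<cdot>\<^bsub>L\<^esub> tgt L c \<cdot>\<^bsub>L\<^esub> X) Y = b \<cdot>\<^bsub>B\<^esub> f X Y \<cdot>\<^bsub>B\<^esub> c"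
  using assms unfolding Be_maps_def mem_Collect_eq by (elim conjE; erule spec2 spec | blast)+

context bialgebroid
begin

lemma Be_simps:
  assumes "f \<in> Be_maps B L"
  shows "f (X + X') Y = f X Y + f X' Y" "f X (Y + Y') = f X Y + f X Y'"
    "f (s b \<cdot>\<^sub>L X) Y = b \<cdot>\<^sub>B f X Y" "f (t b \<cdot>\<^sub>L X) Y = f X Y \<cdot>\<^sub>B b"
    "f (X \<cdot>\<^sub>L s b) Y = f X (s b \<cdot>\<^sub>L Y)" "f (X \<cdot>\<^sub>L t b) Y = f X (t b \<cdot>\<^sub>L Y)"
proof -
  note f = Be_mapsD[OF assms]
  show "f (X + X') Y = f X Y + f X' Y" "f X (Y + Y') = f X Y + f X Y'" by (rule f)+
  show "f (s b \<cdot>\<^sub>L X) Y = b \<cdot>\<^sub>B f X Y" using f(4)[of b "unt B" X Y] by simp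
  show "f (t b \<cdot>\<^sub>L X) Y = f X Y \<cdot>\<^sub>B b" using f(4)[of "unt B" b X Y] by simp
  show "f (X \<cdot>\<^sub>L s b) Y = f X (s b \<cdot>\<^sub>L Y)" using f(3)[of X b "unt B" Y] by simp
  show "f (X \<cdot>\<^sub>L t b) Y = f X (t b \<cdot>\<^sub>L Y)" using f(3)[of X "unt B" b Y] by simp
qed

lemma sw_left_B: "b \<cdot>\<^sub>B (\<ointegral>x y\<in>c. F x y) = (\<ointegral>x y\<in>c. b \<cdot>\<^sub>B F x y)"
  and sw_right_B: "(\<ointegral>x y\<in>c. F x y) \<cdot>\<^sub>B b = (\<ointegral>x y\<in>c. F x y \<cdot>\<^sub>B b)"
  by (rule sw_hom; simp)+

lemma sw_left_L: "X \<cdot>\<^sub>L (\<ointegral>x y\<in>c. G x y) = (\<ointegral>x y\<in>c. X \<cdot>\<^sub>L G x y)"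
  and sw_right_L: "(\<ointegral>x y\<in>c. G x y) \<cdot>\<^sub>L X = (\<ointegral>x y\<in>c. G x y \<cdot>\<^sub>L X)"
  by (rule sw_hom; simp)+

lemma sw_t: "t (\<ointegral>x y\<in>c. F x y) = (\<ointegral>x y\<in>c. t (F x y))"
  and sw_\<epsilon>: "\<epsilon> (\<ointegral>x y\<in>c. G x y) = (\<ointegral>x y\<in>c. \<epsilon> (G x y))"
  by (rule sw_hom; simp)+

text \<open>
  A counit that also multiplies by \<open>W\<close>: since \<open>\<epsilon>(X\<^sub>2 W) = \<epsilon>(X\<^sub>2 \<epsilon>(W))\<close> with \<open>\<epsilon>(W)\<close> in \<open>B\<close> through the
  target, \<open>W\<close> can be replaced by a scalar, which multiplies \<open>X\<close> from the right.
\<close>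

lemma counit_t_mult:
  assumes "\<And>p q. h (p + q) = h p + h q"
  shows "(\<ointegral>X1 X2\<in>D X. h (t (\<epsilon> (X2 \<cdot>\<^sub>L W)) \<cdot>\<^sub>L X1)) = h (X \<cdot>\<^sub>L t (\<epsilon> W))"
proof -
  have "lbal (\<lambda>X1 X2. h (t (\<epsilon> X2) \<cdot>\<^sub>L X1))" by standard (simp_all add: assms)
  note r = D_right_t[OF this, where X = X and c = "\<epsilon> W"]
  have "h (X \<cdot>\<^sub>L t (\<epsilon> W)) = (\<ointegral>X1 X2\<in>D (X \<cdot>\<^sub>L t (\<epsilon> W)). h (t (\<epsilon> X2) \<cdot>\<^sub>L X1))"
    by (rule counit_t_hom[symmetric]) (rule assms)
  then show ?thesis unfolding r by (simp only: \<epsilon>_mult_t)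
qed

lemma counit_s_mult:
  assumes "\<And>p q. h (p + q) = h p + h q"
  shows "(\<ointegral>X1 X2\<in>D X. h (s (\<epsilon> (X1 \<cdot>\<^sub>L W)) \<cdot>\<^sub>L X2)) = h (X \<cdot>\<^sub>L s (\<epsilon> W))"
proof -
  have "lbal (\<lambda>X1 X2. h (s (\<epsilon> X1) \<cdot>\<^sub>L X2))" by standard (simp_all add: assms)
  note r = D_right_s[OF this, where p = X and b = "\<epsilon> W"]
  have "h (X \<cdot>\<^sub>L s (\<epsilon> W)) = (\<ointegral>X1 X2\<in>D (X \<cdot>\<^sub>L s (\<epsilon> W)). h (s (\<epsilon> X1) \<cdot>\<^sub>L X2))"
    by (rule self.counit_hom[symmetric]) (rule assms)
  then show ?thesis unfolding r by (simp only: \<epsilon>_mult_s)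
qed

lemma conv_unit_left:
  assumes f: "f \<in> Be_maps B L"
  shows "(\<ointegral>X1 X2\<in>D X. \<ointegral>Y1 Y2\<in>D Y. \<epsilon> (X1 \<cdot>\<^sub>L Y1) \<cdot>\<^sub>B f X2 Y2) = f X Y"
proof -
  note f = Be_simps[OF f]
  have "(\<ointegral>X1 X2\<in>D X. \<epsilon> (X1 \<cdot>\<^sub>L Y1) \<cdot>\<^sub>B f X2 Y2) = f X (s (\<epsilon> Y1) \<cdot>\<^sub>L Y2)" for Y1 Y2
    using counit_s_mult[of "\<lambda>X. f X Y2" X Y1, OF f(1)] by (simp only: f)
  moreover have "(\<ointegral>Y1 Y2\<in>D Y. f X (s (\<epsilon> Y1) \<cdot>\<^sub>L Y2)) = f X Y"
    by (rule self.counit_hom) (rule f)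
  ultimately show ?thesis unfolding sw_swap[of "D X"] by simp
qed

lemma conv_eq: "conv B L f g X Y = (\<ointegral>X1 X2\<in>D X. \<ointegral>Y1 Y2\<in>D Y. f X1 Y1 \<cdot>\<^sub>B g X2 Y2)"
  by (simp add: conv_def vsumB sw_def case_prod_unfold)

lemma conv_assoc:
  assumes "f \<in> Be_maps B L" "g \<in> Be_maps B L" "h \<in> Be_maps B L"
  shows "conv B L (conv B L f g) h X Y = conv B L f (conv B L g h) X Y"
proof -
  note [simp] = Be_simps[OF assms(1)] Be_simps[OF assms(2)] Be_simps[OF assms(3)]
  show ?thesis
    unfolding conv_eq sw_left_B sw_right_B B_simps(1)
    by (rule self.coassoc2) simp_all
qed

end


locale cocycle = bialgebroid B L for B :: "('k::field, 'b::ab_group_add) alg"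
    and L :: "('k, 'b, 'l::ab_group_add) bialgd" +
  fixes \<Gamma> :: "'l \<Rightarrow> 'l \<Rightarrow> 'b"
  assumes cocycle: "invertible_normalised_cocycle B L \<Gamma>"
begin

abbreviation \<Gamma>i where "\<Gamma>i \<equiv> conv_inv B L \<Gamma>"

lemma \<Gamma>_Be: "\<Gamma> \<in> Be_maps B L"
  and \<Gamma>_one [simp]: "\<Gamma> (unt L) X = \<epsilon> X" "\<Gamma> X (unt L) = \<epsilon> X"
  and \<Gamma>_bal: "\<Gamma> X (Y \<cdot>\<^sub>L s b) = \<Gamma> X (Y \<cdot>\<^sub>L t b)"
  using cocycle unfolding invertible_normalised_cocycle_def by simp_all

lemma \<Gamma>i_inverse: "is_conv_inverse B L \<Gamma> \<Gamma>i"
proof -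
  have "\<exists>g. is_conv_inverse B L \<Gamma> g"
    using cocycle unfolding invertible_normalised_cocycle_def by (elim conjE)
  then show ?thesis unfolding conv_inv_def by (rule someI_ex)
qed

lemma \<Gamma>i_Be: "\<Gamma>i \<in> Be_maps B L"
  and conv_\<Gamma>_\<Gamma>i: "conv B L \<Gamma> \<Gamma>i X Y = \<epsilon> (X \<cdot>\<^sub>L Y)" and conv_\<Gamma>i_\<Gamma>: "conv B L \<Gamma>i \<Gamma> X Y = \<epsilon> (X \<cdot>\<^sub>L Y)"
  using \<Gamma>i_inverse unfolding is_conv_inverse_def by blast+

lemmas \<Gamma>_simps [simp] = Be_simps[OF \<Gamma>_Be]
lemmas \<Gamma>i_simps [simp] = Be_simps[OF \<Gamma>i_Be]
lemmas \<Gamma>_\<Gamma>i = conv_\<Gamma>_\<Gamma>i[unfolded conv_eq]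
lemmas \<Gamma>i_\<Gamma> = conv_\<Gamma>i_\<Gamma>[unfolded conv_eq]

text \<open>
  Evaluate \<open>\<Gamma> * \<Gamma>\<^sup>-\<^sup>1 = \<epsilon>\<close> at \<open>(1, X)\<close> and \<open>(X, 1)\<close>; the values of \<open>\<Gamma>\<close> are then counits, which \<open>\<Gamma>\<^sup>-\<^sup>1\<close> absorbs.
\<close>

lemma \<Gamma>i_one [simp]: "\<Gamma>i (unt L) X = \<epsilon> X" "\<Gamma>i X (unt L) = \<epsilon> X"
proof -
  have "lbal (\<lambda>X1 X2. \<ointegral>Y1 Y2\<in>D X. \<Gamma> X1 Y1 \<cdot>\<^sub>B \<Gamma>i X2 Y2)"
    by standard (simp_all add: sw_plus)
  from D_one[OF this] have 1: "\<epsilon> X = (\<ointegral>Y1 Y2\<in>D X. \<epsilon> Y1 \<cdot>\<^sub>B \<Gamma>i (unt L) Y2)"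
    using \<Gamma>_\<Gamma>i[of "unt L" X] by simp
  have s: "b \<cdot>\<^sub>B \<Gamma>i (unt L) Y = \<Gamma>i (unt L) (s b \<cdot>\<^sub>L Y)" for b Y
  proof -
    have "\<Gamma>i (unt L) (s b \<cdot>\<^sub>L Y) = \<Gamma>i (unt L \<cdot>\<^sub>L s b) Y" by (simp only: \<Gamma>i_simps)
    also have "\<dots> = \<Gamma>i (s b \<cdot>\<^sub>L unt L) Y" by simp
    finally show ?thesis by (simp only: \<Gamma>i_simps)
  qed
  have "(\<ointegral>Y1 Y2\<in>D X. \<Gamma>i (unt L) (s (\<epsilon> Y1) \<cdot>\<^sub>L Y2)) = \<Gamma>i (unt L) X"
    by (rule self.counit_hom) simp
  with 1 show "\<Gamma>i (unt L) X = \<epsilon> X" by (simp add: s)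
next
  have one: "(\<ointegral>Y1 Y2\<in>D (unt L). \<ointegral>X1 X2\<in>D X. \<Gamma> X1 Y1 \<cdot>\<^sub>B \<Gamma>i X2 Y2) = (\<ointegral>X1 X2\<in>D X. \<Gamma> X1 (unt L) \<cdot>\<^sub>B \<Gamma>i X2 (unt L))"
  proof (rule D_one, standard)
    fix b m n
    have "lbal (\<lambda>X1 X2. \<Gamma> X1 m \<cdot>\<^sub>B \<Gamma>i X2 n)" by standard simp_all
    from D_tak[OF this, of X b]
    show "(\<ointegral>X1 X2\<in>D X. \<Gamma> X1 (t b \<cdot>\<^sub>L m) \<cdot>\<^sub>B \<Gamma>i X2 n) = (\<ointegral>X1 X2\<in>D X. \<Gamma> X1 m \<cdot>\<^sub>B \<Gamma>i X2 (s b \<cdot>\<^sub>L n))" by simp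
  qed (simp_all add: sw_plus)
  have "(\<ointegral>X1 X2\<in>D X. \<Gamma>i (s (\<epsilon> X1) \<cdot>\<^sub>L X2) (unt L)) = \<Gamma>i X (unt L)"
    by (rule self.counit_hom) simp
  then show "\<Gamma>i X (unt L) = \<epsilon> X"
    using \<Gamma>_\<Gamma>i[of X "unt L"] one by (simp add: sw_swap[of "D X"])
qed

text \<open>
  Convolving \<open>\<Gamma>\<close> with \<open>\<Gamma>\<^sup>-\<^sup>1(X, Yb)\<close> and with \<open>\<Gamma>\<^sup>-\<^sup>1(X, Y\<bar>b)\<close> gives \<open>\<epsilon>(XYb)\<close> and \<open>\<epsilon>(XY\<bar>b)\<close>, which
  agree; \<open>\<Gamma>\<close> can be cancelled.  In the first convolution the Takeuchi condition for \<open>Y\<close> turns \<open>b\<close> into \<open>\<bar>b\<close>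
  in the argument of \<open>\<Gamma>\<close>, where it may be exchanged for \<open>b\<close>.
\<close>

lemma \<Gamma>i_bal: "\<Gamma>i X (Y \<cdot>\<^sub>L s b) = \<Gamma>i X (Y \<cdot>\<^sub>L t b)"
proof -
  define h1 where "h1 = (\<lambda>X Y. \<Gamma>i X (Y \<cdot>\<^sub>L s b))"
  define h2 where "h2 = (\<lambda>X Y. \<Gamma>i X (Y \<cdot>\<^sub>L t b))"
  have Be: "h1 \<in> Be_maps B L" "h2 \<in> Be_maps B L"
    unfolding Be_maps_def h1_def h2_def using Be_mapsD[OF \<Gamma>i_Be] by simp_all
  have D2: "(\<ointegral>Y1 Y2\<in>D Y. \<ointegral>X1 X2\<in>D X. \<Gamma> X1 Y1 \<cdot>\<^sub>B \<Gamma>i X2 Y2) = \<epsilon> (X \<cdot>\<^sub>L Y)" for X Y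
    using \<Gamma>_\<Gamma>i[of X Y] by (simp add: sw_swap[of "D X"])
  have tak: "(\<ointegral>X1 X2\<in>D X. \<Gamma> X1 (t c \<cdot>\<^sub>L m) \<cdot>\<^sub>B \<Gamma>i X2 n) = (\<ointegral>X1 X2\<in>D X. \<Gamma> X1 m \<cdot>\<^sub>B \<Gamma>i X2 (s c \<cdot>\<^sub>L n))" for X c m n
  proof -
    have "lbal (\<lambda>X1 X2. \<Gamma> X1 m \<cdot>\<^sub>B \<Gamma>i X2 n)" by standard simp_all
    from D_tak[OF this, of X c] show ?thesis by simp
  qed
  have bal: "lbal (\<lambda>Y1 Y2. \<ointegral>X1 X2\<in>D X. \<Gamma> X1 Y1 \<cdot>\<^sub>B \<Gamma>i X2 Y2)" for X
    by standard (simp_all add: sw_plus tak)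
  have 2: "conv B L \<Gamma> h2 X Y = \<epsilon> (X \<cdot>\<^sub>L Y \<cdot>\<^sub>L t b)" for X Y
  proof -
    have "conv B L \<Gamma> h2 X Y = (\<ointegral>Y1 Y2\<in>D (Y \<cdot>\<^sub>L t b). \<ointegral>X1 X2\<in>D X. \<Gamma> X1 Y1 \<cdot>\<^sub>B \<Gamma>i X2 Y2)"
      unfolding conv_eq h2_def sw_swap[of "D X"] by (rule D_right_t[OF bal, symmetric])
    then show ?thesis by (simp add: D2)
  qed
  have 1: "conv B L \<Gamma> h1 X Y = \<epsilon> (X \<cdot>\<^sub>L Y \<cdot>\<^sub>L s b)" for X Y
  proof -
    have "conv B L \<Gamma> h1 X Y = (\<ointegral>Y1 Y2\<in>D Y. \<ointegral>X1 X2\<in>D X. \<Gamma> X1 (Y1 \<cdot>\<^sub>L t b) \<cdot>\<^sub>B \<Gamma>i X2 Y2)"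
      unfolding conv_eq h1_def sw_swap[of "D X"] by (rule D_tak[OF bal, symmetric])
    also have "\<dots> = (\<ointegral>Y1 Y2\<in>D (Y \<cdot>\<^sub>L s b). \<ointegral>X1 X2\<in>D X. \<Gamma> X1 Y1 \<cdot>\<^sub>B \<Gamma>i X2 Y2)"
      unfolding D_right_s[OF bal] \<Gamma>_bal ..
    finally show ?thesis by (simp add: D2)
  qed
  have "\<epsilon> (Z \<cdot>\<^sub>L s b) = \<epsilon> (Z \<cdot>\<^sub>L t b)" for Z
    using \<epsilon>_mult_s[of Z "s b"] \<epsilon>_mult_t[of Z "s b"] \<epsilon>_s[of b "unt L"] by simp
  then have 12: "conv B L \<Gamma> h1 = conv B L \<Gamma> h2" unfolding fun_eq_iff 1 2 by (simp only: simp_thms)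
  have inv: "conv B L \<Gamma>i (conv B L \<Gamma> h) X Y = h X Y" if "h \<in> Be_maps B L" for h
  proof -
    have "conv B L \<Gamma>i (conv B L \<Gamma> h) X Y = conv B L (conv B L \<Gamma>i \<Gamma>) h X Y"
      by (rule conv_assoc[OF \<Gamma>i_Be \<Gamma>_Be that, symmetric])
    also have "\<dots> = h X Y" unfolding conv_eq[of "conv B L \<Gamma>i \<Gamma>"] conv_\<Gamma>i_\<Gamma> by (rule conv_unit_left[OF that])
    finally show ?thesis .
  qed
  have "h1 X Y = h2 X Y" using inv[OF Be(1)] inv[OF Be(2)] 12 by metis
  then show ?thesis by (simp add: h1_def h2_def)
qed

end


section \<open>The left twist of a comodule algebra\<close>

locale cocycle_comodalg = cocycle B L \<Gamma> + comodalg B L P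
  for B :: "('k::field, 'b::ab_group_add) alg" and L :: "('k, 'b, 'l::ab_group_add) bialgd"
    and \<Gamma> :: "'l \<Rightarrow> 'l \<Rightarrow> 'b" and P :: "('k, 'b, 'l, 'p::ab_group_add) comodalg"
begin

text \<open>
  The product \<open>p \<cdot>\<^sub>\<Gamma> q\<close>.
\<close>

definition tw where
  "tw p q = (\<ointegral>X p0\<in>C p. \<ointegral>Y q0\<in>C q. e (\<Gamma> X Y) \<cdot>\<^sub>P (p0 \<cdot>\<^sub>P q0))"

lemma sw_left_P: "p \<cdot>\<^sub>P (\<ointegral>x y\<in>c. F x y) = (\<ointegral>x y\<in>c. p \<cdot>\<^sub>P F x y)"
  and sw_right_P: "(\<ointegral>x y\<in>c. F x y) \<cdot>\<^sub>P p = (\<ointegral>x y\<in>c. F x y \<cdot>\<^sub>P p)"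
  by (rule sw_hom; simp)+

lemma sw_e: "e (\<ointegral>x y\<in>c. F x y) = (\<ointegral>x y\<in>c. e (F x y))"
  by (rule sw_hom; simp)

lemma tw_test_left: "pbal (\<lambda>X p0. \<ointegral>Y q0\<in>C q. e (\<Gamma> X Y) \<cdot>\<^sub>P (p0 \<cdot>\<^sub>P q0))"
  by standard (simp_all add: sw_plus)

text \<open>
  In the second variable the summand is balanced only after summation over the first; the Takeuchi
  condition for \<open>p\<close> is what makes the twisted product well defined.
\<close>

lemma tw_test_right: "pbal (\<lambda>Y q0. \<ointegral>X p0\<in>C p. e (\<Gamma> X Y) \<cdot>\<^sub>P (p0 \<cdot>\<^sub>P q0))"
proof
  fix b Y q
  have "pbal (\<lambda>X p0. e (\<Gamma> X Y) \<cdot>\<^sub>P (p0 \<cdot>\<^sub>P q))" by standard simp_all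
  from C_tak[OF this, of p b]
  show "(\<ointegral>X p0\<in>C p. e (\<Gamma> X (t b \<cdot>\<^sub>L Y)) \<cdot>\<^sub>P (p0 \<cdot>\<^sub>P q)) = (\<ointegral>X p0\<in>C p. e (\<Gamma> X Y) \<cdot>\<^sub>P (p0 \<cdot>\<^sub>P (e b \<cdot>\<^sub>P q)))"
    by simp
qed (simp_all add: sw_plus)

lemma tw_swap: "tw p q = (\<ointegral>Y q0\<in>C q. \<ointegral>X p0\<in>C p. e (\<Gamma> X Y) \<cdot>\<^sub>P (p0 \<cdot>\<^sub>P q0))"
  unfolding tw_def by (rule sw_swap)

lemma tw_add [simp]: "tw (p + p') q = tw p q + tw p' q" "tw p (q + q') = tw p q + tw p q'"
  unfolding tw_def C_add[OF tw_test_left]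
  by simp (simp only: tw_swap[unfolded tw_def] C_add[OF tw_test_right])

lemma tw_emb [simp]: "tw (e b \<cdot>\<^sub>P p) q = e b \<cdot>\<^sub>P tw p q"
  unfolding tw_def C_left[OF tw_test_left] by (simp add: sw_left_P)

lemma tw_mid: "tw (p \<cdot>\<^sub>P e b) q = tw p (e b \<cdot>\<^sub>P q)"
proof -
  have "tw (p \<cdot>\<^sub>P e b) q = (\<ointegral>X p0\<in>C p. \<ointegral>Y q0\<in>C q. e (\<Gamma> (X \<cdot>\<^sub>L s b) Y) \<cdot>\<^sub>P (p0 \<cdot>\<^sub>P q0))"
    unfolding tw_def by (rule C_right[OF tw_test_left])
  also have "\<dots> = (\<ointegral>Y q0\<in>C q. \<ointegral>X p0\<in>C p. e (\<Gamma> X (s b \<cdot>\<^sub>L Y)) \<cdot>\<^sub>P (p0 \<cdot>\<^sub>P q0))"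
    by (simp add: sw_swap[of "C p"])
  also have "\<dots> = tw p (e b \<cdot>\<^sub>P q)"
    unfolding tw_swap by (rule C_left[OF tw_test_right, symmetric])
  finally show ?thesis .
qed

lemma tw_right [simp]: "tw p (q \<cdot>\<^sub>P e b) = tw p q \<cdot>\<^sub>P e b"
proof -
  have "tw p (q \<cdot>\<^sub>P e b) = (\<ointegral>Y q0\<in>C q. \<ointegral>X p0\<in>C p. e (\<Gamma> X (Y \<cdot>\<^sub>L t b)) \<cdot>\<^sub>P (p0 \<cdot>\<^sub>P q0))"
    unfolding tw_swap C_right[OF tw_test_right] \<Gamma>_bal ..
  also have "\<dots> = (\<ointegral>Y q0\<in>C q. \<ointegral>X p0\<in>C p. e (\<Gamma> X Y) \<cdot>\<^sub>P (p0 \<cdot>\<^sub>P (q0 \<cdot>\<^sub>P e b)))"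
    by (rule C_tak[OF tw_test_right])
  also have "\<dots> = tw p q \<cdot>\<^sub>P e b" unfolding tw_swap by (simp add: sw_right_P)
  finally show ?thesis .
qed

lemma tw_one [simp]: "tw (unt P) p = p" "tw p (unt P) = p"
proof -
  show "tw (unt P) p = p" unfolding tw_def C_one[OF tw_test_left] by (simp add: counit)
  show "tw p (unt P) = p" unfolding tw_swap C_one[OF tw_test_right] by (simp add: counit)
qed

lemma tw_e [simp]: "tw (e b) p = e b \<cdot>\<^sub>P p" "tw p (e b) = p \<cdot>\<^sub>P e b"
  using tw_emb[of b "unt P" p] tw_right[of p "unt P" b] by simp_all

lemma C_tw_CC:
  assumes b: "pbal \<beta>"
  shows "(\<ointegral>X r\<in>C (tw p q). \<beta> X r) =
    (\<ointegral>X p0\<in>C p. \<ointegral>Y q0\<in>C q. \<ointegral>X2 p2\<in>C p0. \<ointegral>Y2 q2\<in>C q0. \<beta> (s (\<Gamma> X Y) \<cdot>\<^sub>L (X2 \<cdot>\<^sub>L Y2)) (p2 \<cdot>\<^sub>P q2))"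
proof -
  have b': "pbal (\<lambda>X r. \<beta> (s c \<cdot>\<^sub>L X) r)" for c
    by standard (simp_all add: balD(1,2)[OF b] flip: balD(3)[OF b UNIV_I])
  show ?thesis unfolding tw_def C_sw[OF b] C_left[OF b] C_mult[OF b'] ..
qed

text \<open>
  The coaction sends \<open>p \<cdot>\<^sub>\<Gamma> q\<close> to \<open>\<Gamma>(p\<^sub>-\<^sub>2, q\<^sub>-\<^sub>2) p\<^sub>-\<^sub>1 q\<^sub>-\<^sub>1 \<otimes> p\<^sub>0 q\<^sub>0\<close>.
\<close>

lemma C_tw:
  assumes b: "pbal \<beta>"
  shows "(\<ointegral>X r\<in>C (tw p q). \<beta> X r) =
    (\<ointegral>X p0\<in>C p. \<ointegral>Y q0\<in>C q. \<ointegral>X1 X2\<in>D X. \<ointegral>Y1 Y2\<in>D Y. \<beta> (s (\<Gamma> X1 Y1) \<cdot>\<^sub>L (X2 \<cdot>\<^sub>L Y2)) (p0 \<cdot>\<^sub>P q0))"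
  unfolding C_tw_CC[OF b]
  by (rule coassoc2[symmetric]) (simp_all add: balD(1,2)[OF b] balD(3)[OF b UNIV_I])

end

sublocale cocycle \<subseteq> self: cocycle_comodalg B L \<Gamma> "self L"
  rewrites "prd (self L) = prd L" and "unt (self L) = unt L" and "scl (self L) = scl L"
    and "emb (self L) = src L" and "coact (self L) = cop L"
  by (intro cocycle_comodalg.intro cocycle_axioms self.comodalg_axioms) simp_all

context cocycle
begin

text \<open>
  The left twist of \<open>\<L>\<close> itself, \<open>X \<bullet> Y = \<Gamma>(X\<^sub>1, Y\<^sub>1) X\<^sub>2 Y\<^sub>2\<close>.
\<close>

abbreviation ltw (infixl \<open>\<bullet>\<close> 70) where "X \<bullet> Y \<equiv> self.tw X Y"

text \<open>
  The cocycle condition reads \<open>\<Gamma>(X, Y \<bullet> Z) = \<Gamma>(X \<bullet> Y, Z)\<close>.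
\<close>

lemma cocycle_eq: "\<Gamma> X (Y \<bullet> Z) = \<Gamma> (X \<bullet> Y) Z"
proof -
  have "\<forall>X Y Z. \<Gamma> X (vsum L (\<lambda>(Y1, Y2). vsum L (\<lambda>(Z1, Z2). s (\<Gamma> Y1 Z1) \<cdot>\<^sub>L Y2 \<cdot>\<^sub>L Z2) (D Z)) (D Y)) =
        \<Gamma> (vsum L (\<lambda>(X1, X2). vsum L (\<lambda>(Y1, Y2). s (\<Gamma> X1 Y1) \<cdot>\<^sub>L X2 \<cdot>\<^sub>L Y2) (D Y)) (D X)) Z"
    using cocycle unfolding invertible_normalised_cocycle_def by (elim conjE)
  then show ?thesis by (simp add: self.tw_def vsumL sw_def case_prod_unfold)
qed

lemma ltw_t_left [simp]: "(t b \<cdot>\<^sub>L X) \<bullet> Y = t b \<cdot>\<^sub>L (X \<bullet> Y)"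
  unfolding self.tw_def D_left_t[OF self.tw_test_left] by (simp add: sw_left_L)

lemma ltw_t_right [simp]: "X \<bullet> (Y \<cdot>\<^sub>L t b) = (X \<bullet> Y) \<cdot>\<^sub>L t b"
  unfolding self.tw_swap D_right_t[OF self.tw_test_right] by (simp add: sw_right_L)

lemma ltw_t_mid: "(X \<cdot>\<^sub>L t b) \<bullet> Y = X \<bullet> (t b \<cdot>\<^sub>L Y)"
proof -
  have "(X \<cdot>\<^sub>L t b) \<bullet> Y = (\<ointegral>X1 X2\<in>D X. \<ointegral>Y1 Y2\<in>D Y. s (\<Gamma> X1 Y1) \<cdot>\<^sub>L ((X2 \<cdot>\<^sub>L t b) \<cdot>\<^sub>L Y2))"
    unfolding self.tw_def by (rule D_right_t[OF self.tw_test_left])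
  also have "\<dots> = (\<ointegral>Y1 Y2\<in>D Y. \<ointegral>X1 X2\<in>D X. s (\<Gamma> X1 Y1) \<cdot>\<^sub>L (X2 \<cdot>\<^sub>L (t b \<cdot>\<^sub>L Y2)))"
    unfolding L_simps(1) by (rule sw_swap)
  also have "\<dots> = X \<bullet> (t b \<cdot>\<^sub>L Y)"
    unfolding self.tw_swap by (rule D_left_t[OF self.tw_test_right, symmetric])
  finally show ?thesis .
qed

lemma sw_\<Gamma>: "\<Gamma> (\<ointegral>x y\<in>c. F x y) Z = (\<ointegral>x y\<in>c. \<Gamma> (F x y) Z)" "\<Gamma> Z (\<ointegral>x y\<in>c. F x y) = (\<ointegral>x y\<in>c. \<Gamma> Z (F x y))"
  by (rule sw_hom[of "\<lambda>X. \<Gamma> X Z"]; simp) (rule sw_hom[of "\<Gamma> Z"]; simp)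

end

context cocycle_comodalg
begin

text \<open>
  Both triple products have the form \<open>\<gamma>(p\<^sub>-\<^sub>1, q\<^sub>-\<^sub>1, r\<^sub>-\<^sub>1) p\<^sub>0 q\<^sub>0 r\<^sub>0\<close>, and the cocycle condition says
  that the two coefficients \<open>\<gamma>\<close> agree.
\<close>

lemma tw_assoc: "tw (tw p q) r = tw p (tw q r)"
proof -
  have "tw (tw p q) r = (\<ointegral>X p0\<in>C p. \<ointegral>Y q0\<in>C q. \<ointegral>X1 X2\<in>D X. \<ointegral>Y1 Y2\<in>D Y. \<ointegral>Z r0\<in>C r.
      e (\<Gamma> (s (\<Gamma> X1 Y1) \<cdot>\<^sub>L (X2 \<cdot>\<^sub>L Y2)) Z) \<cdot>\<^sub>P ((p0 \<cdot>\<^sub>P q0) \<cdot>\<^sub>P r0))"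
    unfolding tw_def[of "tw p q"] by (rule C_tw[OF tw_test_left])
  also have "\<dots> = (\<ointegral>X p0\<in>C p. \<ointegral>Y q0\<in>C q. \<ointegral>Z r0\<in>C r. e (\<Gamma> (X \<bullet> Y) Z) \<cdot>\<^sub>P (p0 \<cdot>\<^sub>P (q0 \<cdot>\<^sub>P r0)))"
    unfolding self.tw_def sw_\<Gamma> sw_e sw_right_P sw_swap[of "D _" "C r"] by simp
  also have "\<dots> = (\<ointegral>X p0\<in>C p. \<ointegral>Y q0\<in>C q. \<ointegral>Z r0\<in>C r. e (\<Gamma> X (Y \<bullet> Z)) \<cdot>\<^sub>P (p0 \<cdot>\<^sub>P (q0 \<cdot>\<^sub>P r0)))"
    by (simp only: cocycle_eq)
  also have "\<dots> = (\<ointegral>Y q0\<in>C q. \<ointegral>Z r0\<in>C r. \<ointegral>X p0\<in>C p. e (\<Gamma> X (Y \<bullet> Z)) \<cdot>\<^sub>P (p0 \<cdot>\<^sub>P (q0 \<cdot>\<^sub>P r0)))"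
    unfolding sw_swap[of "C p" "C q"] sw_swap[of "C p" "C r"] ..
  also have "\<dots> = (\<ointegral>Y q0\<in>C q. \<ointegral>Z r0\<in>C r. \<ointegral>Y1 Y2\<in>D Y. \<ointegral>Z1 Z2\<in>D Z. \<ointegral>X p0\<in>C p.
      e (\<Gamma> X (s (\<Gamma> Y1 Z1) \<cdot>\<^sub>L (Y2 \<cdot>\<^sub>L Z2))) \<cdot>\<^sub>P (p0 \<cdot>\<^sub>P (q0 \<cdot>\<^sub>P r0)))"
    unfolding self.tw_def sw_\<Gamma> sw_e sw_right_P sw_swap[of "C p" "D _"] ..
  also have "\<dots> = tw p (tw q r)"
    unfolding tw_swap[of p "tw q r"] by (rule C_tw[OF tw_test_right, symmetric])
  finally show ?thesis .
qed

end


section \<open>The right twist and the cocycle condition for the inverse\<close>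

context bialgebroid
begin

text \<open>
  The left \<open>B\<^sup>e\<close>-linear maps \<open>\<L> \<otimes>\<^bsub>B\<^sup>e\<^esub> \<L> \<otimes>\<^bsub>B\<^sup>e\<^esub> \<L> \<rightarrow> B\<close>.
\<close>

definition Be3 :: "('l \<Rightarrow> 'l \<Rightarrow> 'l \<Rightarrow> 'b) \<Rightarrow> bool" where
  "Be3 f \<longleftrightarrow> (\<forall>X X' Y Z. f (X + X') Y Z = f X Y Z + f X' Y Z) \<and>
     (\<forall>X Y Y' Z. f X (Y + Y') Z = f X Y Z + f X Y' Z) \<and> (\<forall>X Y Z Z'. f X Y (Z + Z') = f X Y Z + f X Y Z') \<and>
     (\<forall>b X Y Z. f (s b \<cdot>\<^sub>L X) Y Z = b \<cdot>\<^sub>B f X Y Z) \<and> (\<forall>b X Y Z. f (t b \<cdot>\<^sub>L X) Y Z = f X Y Z \<cdot>\<^sub>B b) \<and>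
     (\<forall>b X Y Z. f (X \<cdot>\<^sub>L s b) Y Z = f X (s b \<cdot>\<^sub>L Y) Z) \<and> (\<forall>b X Y Z. f (X \<cdot>\<^sub>L t b) Y Z = f X (t b \<cdot>\<^sub>L Y) Z) \<and>
     (\<forall>b X Y Z. f X (Y \<cdot>\<^sub>L s b) Z = f X Y (s b \<cdot>\<^sub>L Z)) \<and> (\<forall>b X Y Z. f X (Y \<cdot>\<^sub>L t b) Z = f X Y (t b \<cdot>\<^sub>L Z))"

lemma Be3D:
  assumes "Be3 f"
  shows "f (X + X') Y Z = f X Y Z + f X' Y Z" "f X (Y + Y') Z = f X Y Z + f X Y' Z" "f X Y (Z + Z') = f X Y Z + f X Y Z'"
    "f (s b \<cdot>\<^sub>L X) Y Z = b \<cdot>\<^sub>B f X Y Z" "f (t b \<cdot>\<^sub>L X) Y Z = f X Y Z \<cdot>\<^sub>B b"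
    "f (X \<cdot>\<^sub>L s b) Y Z = f X (s b \<cdot>\<^sub>L Y) Z" "f (X \<cdot>\<^sub>L t b) Y Z = f X (t b \<cdot>\<^sub>L Y) Z"
    "f X (Y \<cdot>\<^sub>L s b) Z = f X Y (s b \<cdot>\<^sub>L Z)" "f X (Y \<cdot>\<^sub>L t b) Z = f X Y (t b \<cdot>\<^sub>L Z)"
  using assms unfolding Be3_def by simp_all

definition conv3 where
  "conv3 f g X Y Z = (\<ointegral>X1 X2\<in>D X. \<ointegral>Y1 Y2\<in>D Y. \<ointegral>Z1 Z2\<in>D Z. f X1 Y1 Z1 \<cdot>\<^sub>B g X2 Y2 Z2)"

lemma conv3_unit_right:
  assumes f: "Be3 f"
  shows "conv3 f (\<lambda>X Y Z. \<epsilon> (X \<cdot>\<^sub>L (Y \<cdot>\<^sub>L Z))) X Y Z = f X Y Z"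
proof -
  note f = Be3D[OF f]
  have "(\<ointegral>X1 X2\<in>D X. f X1 Y1 Z1 \<cdot>\<^sub>B \<epsilon> (X2 \<cdot>\<^sub>L (Y2 \<cdot>\<^sub>L Z2))) = f X (t (\<epsilon> (Y2 \<cdot>\<^sub>L Z2)) \<cdot>\<^sub>L Y1) Z1" for Y1 Y2 Z1 Z2
    using counit_t_mult[of "\<lambda>X. f X Y1 Z1" X "Y2 \<cdot>\<^sub>L Z2", OF f(1)] by (simp only: f)
  moreover have "(\<ointegral>Y1 Y2\<in>D Y. f X (t (\<epsilon> (Y2 \<cdot>\<^sub>L Z2)) \<cdot>\<^sub>L Y1) Z1) = f X Y (t (\<epsilon> Z2) \<cdot>\<^sub>L Z1)" for Z1 Z2
    using counit_t_mult[of "\<lambda>Y. f X Y Z1" Y Z2, OF f(2)] by (simp only: f)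
  moreover have "(\<ointegral>Z1 Z2\<in>D Z. f X Y (t (\<epsilon> Z2) \<cdot>\<^sub>L Z1)) = f X Y Z"
    by (rule counit_t_hom) (rule f)
  ultimately show ?thesis
    unfolding conv3_def sw_swap[of "D X"] sw_swap[of "D Y" "D Z"] by simp
qed

lemma conv3_unit_left:
  assumes f: "Be3 f"
  shows "conv3 (\<lambda>X Y Z. \<epsilon> (X \<cdot>\<^sub>L (Y \<cdot>\<^sub>L Z))) f X Y Z = f X Y Z"
proof -
  note f = Be3D[OF f]
  have "(\<ointegral>X1 X2\<in>D X. \<epsilon> (X1 \<cdot>\<^sub>L (Y1 \<cdot>\<^sub>L Z1)) \<cdot>\<^sub>B f X2 Y2 Z2) = f X (s (\<epsilon> (Y1 \<cdot>\<^sub>L Z1)) \<cdot>\<^sub>L Y2) Z2" for Y1 Y2 Z1 Z2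
    using counit_s_mult[of "\<lambda>X. f X Y2 Z2" X "Y1 \<cdot>\<^sub>L Z1", OF f(1)] by (simp only: f)
  moreover have "(\<ointegral>Y1 Y2\<in>D Y. f X (s (\<epsilon> (Y1 \<cdot>\<^sub>L Z1)) \<cdot>\<^sub>L Y2) Z2) = f X Y (s (\<epsilon> Z1) \<cdot>\<^sub>L Z2)" for Z1 Z2
    using counit_s_mult[of "\<lambda>Y. f X Y Z2" Y Z1, OF f(2)] by (simp only: f)
  moreover have "(\<ointegral>Z1 Z2\<in>D Z. f X Y (s (\<epsilon> Z1) \<cdot>\<^sub>L Z2)) = f X Y Z"
    by (rule self.counit_hom) (rule f)
  ultimately show ?thesis
    unfolding conv3_def sw_swap[of "D X"] sw_swap[of "D Y" "D Z"] by simp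
qed

text \<open>
  Coassociativity in three variables, from two applications of the product of coactions.
\<close>

lemma conv3_assoc:
  assumes "Be3 f" "Be3 g" "Be3 h"
  shows "conv3 (conv3 f g) h X Y Z = conv3 f (conv3 g h) X Y Z"
proof -
  note [simp] = Be3D[OF assms(1)] Be3D[OF assms(2)] Be3D[OF assms(3)]
  let ?F = "\<lambda>((X1, Y1), Z1) ((X2, Y2), Z2) ((X3, Y3), Z3). f X1 Y1 Z1 \<cdot>\<^sub>B (g X2 Y2 Z2 \<cdot>\<^sub>B h X3 Y3 Z3)"
  note co = coaction_on_pair[OF coaction_on_pair[OF self.coaction_on_C self.coaction_on_C] self.coaction_on_C]
  have "pair_class (pair_class (tri_bal (\<lambda>b X. t b \<cdot>\<^sub>L X) (\<lambda>b X. s b \<cdot>\<^sub>L X) (\<lambda>b X. s b \<cdot>\<^sub>L X)) (\<lambda>b X. X \<cdot>\<^sub>L t b) (\<lambda>b X. X \<cdot>\<^sub>L s b) (\<lambda>b p. p \<cdot>\<^sub>L s b)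
      (\<lambda>b X. t b \<cdot>\<^sub>L X) (\<lambda>b X. s b \<cdot>\<^sub>L X) (\<lambda>b p. s b \<cdot>\<^sub>L p))
      (\<lambda>b (c, Y). (c, Y \<cdot>\<^sub>L t b)) (\<lambda>b (c, Y). (c, Y \<cdot>\<^sub>L s b)) (\<lambda>b (v, q). (v, q \<cdot>\<^sub>L s b))
      (\<lambda>b X. t b \<cdot>\<^sub>L X) (\<lambda>b X. s b \<cdot>\<^sub>L X) (\<lambda>b p. s b \<cdot>\<^sub>L p) ?F"
    unfolding pair_class_def tri_bal_def triadd_def by simp
  from coaction_onD(1)[OF co, OF this, of "((X, Y), Z)"] show ?thesis
    unfolding conv3_def sw_left_B sw_right_B by simp
qed

end

context cocycle_comodalg
begin

text \<open>
  Twisting by \<open>\<Gamma>\<close> is undone by \<open>\<Gamma>\<^sup>-\<^sup>1\<close>: the coefficients combine to \<open>\<Gamma>\<^sup>-\<^sup>1 * \<Gamma> = \<epsilon>\<close>.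
\<close>

lemma untwist: "(\<ointegral>X p0\<in>C p. \<ointegral>Y q0\<in>C q. e (\<Gamma>i X Y) \<cdot>\<^sub>P tw p0 q0) = p \<cdot>\<^sub>P q"
proof -
  have b: "pbal (\<lambda>X r. e (\<epsilon> X) \<cdot>\<^sub>P r)" by standard simp_all
  have "(\<ointegral>X p0\<in>C p. \<ointegral>Y q0\<in>C q. e (\<Gamma>i X Y) \<cdot>\<^sub>P tw p0 q0) =
    (\<ointegral>X p0\<in>C p. \<ointegral>Y q0\<in>C q. \<ointegral>X1 X2\<in>D X. \<ointegral>Y1 Y2\<in>D Y. e (\<Gamma>i X1 Y1 \<cdot>\<^sub>B \<Gamma> X2 Y2) \<cdot>\<^sub>P (p0 \<cdot>\<^sub>P q0))"
    unfolding tw_def sw_left_P P_simps(1)[symmetric, of "e _" "e _"] e_simps(2)[symmetric]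
    by (rule coassoc2[symmetric]) simp_all
  also have "\<dots> = (\<ointegral>X p0\<in>C p. \<ointegral>Y q0\<in>C q. e (\<epsilon> (X \<cdot>\<^sub>L Y)) \<cdot>\<^sub>P (p0 \<cdot>\<^sub>P q0))"
    by (simp only: \<Gamma>i_\<Gamma> flip: sw_e sw_right_P)
  also have "\<dots> = p \<cdot>\<^sub>P q"
    unfolding C_mult[OF b, symmetric] by (rule counit)
  finally show ?thesis .
qed

end

context cocycle
begin

text \<open>
  The twist of \<open>\<L>\<close> from the right by \<open>\<Gamma>\<^sup>-\<^sup>1\<close>.  It is again a comodule algebra for the original coproduct,
  and twisting it from the left by \<open>\<Gamma>\<close> gives \<open>\<L>\<^sup>\<Gamma>\<close>.
\<close>

definition rtw (infixl \<open>\<rhd>\<close> 70) where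
  "X \<rhd> Y = (\<ointegral>X1 X2\<in>D X. \<ointegral>Y1 Y2\<in>D Y. t (\<Gamma>i X2 Y2) \<cdot>\<^sub>L (X1 \<cdot>\<^sub>L Y1))"

lemma rtw_test_left: "lbal (\<lambda>X1 X2. \<ointegral>Y1 Y2\<in>D Y. t (\<Gamma>i X2 Y2) \<cdot>\<^sub>L (X1 \<cdot>\<^sub>L Y1))"
  by standard (simp_all add: sw_plus)

lemma rtw_test_right: "lbal (\<lambda>Y1 Y2. \<ointegral>X1 X2\<in>D X. t (\<Gamma>i X2 Y2) \<cdot>\<^sub>L (X1 \<cdot>\<^sub>L Y1))"
proof
  fix b Y Y'
  have "lbal (\<lambda>X1 X2. t (\<Gamma>i X2 Y') \<cdot>\<^sub>L (X1 \<cdot>\<^sub>L Y))" by standard simp_all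
  from D_tak[OF this, of X b]
  show "(\<ointegral>X1 X2\<in>D X. t (\<Gamma>i X2 Y') \<cdot>\<^sub>L (X1 \<cdot>\<^sub>L (t b \<cdot>\<^sub>L Y))) = (\<ointegral>X1 X2\<in>D X. t (\<Gamma>i X2 (s b \<cdot>\<^sub>L Y')) \<cdot>\<^sub>L (X1 \<cdot>\<^sub>L Y))"
    by simp
qed (simp_all add: sw_plus)

lemma rtw_swap: "X \<rhd> Y = (\<ointegral>Y1 Y2\<in>D Y. \<ointegral>X1 X2\<in>D X. t (\<Gamma>i X2 Y2) \<cdot>\<^sub>L (X1 \<cdot>\<^sub>L Y1))"
  unfolding rtw_def by (rule sw_swap)

lemma rtw_add [simp]: "(X + X') \<rhd> Y = X \<rhd> Y + X' \<rhd> Y" "X \<rhd> (Y + Y') = X \<rhd> Y + X \<rhd> Y'"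
  unfolding rtw_def D_add[OF rtw_test_left]
  by simp (simp only: rtw_swap[unfolded rtw_def] D_add[OF rtw_test_right])

lemma rtw_one [simp]: "unt L \<rhd> X = X" "X \<rhd> unt L = X"
proof -
  show "unt L \<rhd> X = X" unfolding rtw_def D_one[OF rtw_test_left] by (simp add: counit_t)
  show "X \<rhd> unt L = X" unfolding rtw_swap D_one[OF rtw_test_right] by (simp add: counit_t)
qed

lemma rtw_left [simp]: "(s b \<cdot>\<^sub>L X) \<rhd> Y = s b \<cdot>\<^sub>L (X \<rhd> Y)" "(t b \<cdot>\<^sub>L X) \<rhd> Y = t b \<cdot>\<^sub>L (X \<rhd> Y)"
  unfolding rtw_def D_left_s[OF rtw_test_left] D_left_t[OF rtw_test_left] by (simp_all add: sw_left_L)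

lemma rtw_right [simp]: "X \<rhd> (Y \<cdot>\<^sub>L s b) = (X \<rhd> Y) \<cdot>\<^sub>L s b" "X \<rhd> (Y \<cdot>\<^sub>L t b) = (X \<rhd> Y) \<cdot>\<^sub>L t b"
proof -
  show "X \<rhd> (Y \<cdot>\<^sub>L s b) = (X \<rhd> Y) \<cdot>\<^sub>L s b"
    unfolding rtw_swap D_right_s[OF rtw_test_right] by (simp add: sw_right_L)
  have "X \<rhd> (Y \<cdot>\<^sub>L t b) = (\<ointegral>Y1 Y2\<in>D Y. \<ointegral>X1 X2\<in>D X. t (\<Gamma>i X2 (Y2 \<cdot>\<^sub>L s b)) \<cdot>\<^sub>L (X1 \<cdot>\<^sub>L Y1))"
    unfolding rtw_swap D_right_t[OF rtw_test_right] \<Gamma>i_bal ..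
  also have "\<dots> = (\<ointegral>Y1 Y2\<in>D Y. \<ointegral>X1 X2\<in>D X. t (\<Gamma>i X2 Y2) \<cdot>\<^sub>L (X1 \<cdot>\<^sub>L (Y1 \<cdot>\<^sub>L t b)))"
    by (rule D_tak[OF rtw_test_right, symmetric])
  also have "\<dots> = (X \<rhd> Y) \<cdot>\<^sub>L t b" unfolding rtw_swap by (simp add: sw_right_L)
  finally show "X \<rhd> (Y \<cdot>\<^sub>L t b) = (X \<rhd> Y) \<cdot>\<^sub>L t b" .
qed

lemma rtw_mid: "(X \<cdot>\<^sub>L s b) \<rhd> Y = X \<rhd> (s b \<cdot>\<^sub>L Y)" "(X \<cdot>\<^sub>L t b) \<rhd> Y = X \<rhd> (t b \<cdot>\<^sub>L Y)"
proof -
  show "(X \<cdot>\<^sub>L s b) \<rhd> Y = X \<rhd> (s b \<cdot>\<^sub>L Y)"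
    unfolding rtw_swap[of X] D_left_s[OF rtw_test_right]
    unfolding rtw_def D_right_s[OF rtw_test_left] by (simp add: sw_swap[of "D X"])
  show "(X \<cdot>\<^sub>L t b) \<rhd> Y = X \<rhd> (t b \<cdot>\<^sub>L Y)"
    unfolding rtw_swap[of X] D_left_t[OF rtw_test_right]
    unfolding rtw_def D_right_t[OF rtw_test_left] by (simp add: sw_swap[of "D X"])
qed

lemma rtw_st [simp]: "s b \<rhd> X = s b \<cdot>\<^sub>L X" "t b \<rhd> X = t b \<cdot>\<^sub>L X" "X \<rhd> s b = X \<cdot>\<^sub>L s b" "X \<rhd> t b = X \<cdot>\<^sub>L t b"
  using rtw_left[of b "unt L" X] rtw_right[of X "unt L" b] by simp_all

lemma \<epsilon>_rtw: "\<epsilon> (X \<rhd> Y) = \<Gamma>i X Y"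
  unfolding rtw_def sw_\<epsilon> \<epsilon>_t by (rule conv_unit_left[OF \<Gamma>i_Be])

lemma D_rtw:
  assumes b: "lbal \<beta>"
  shows "(\<ointegral>X1 X2\<in>D (X \<rhd> Y). \<beta> X1 X2) = (\<ointegral>X1 X2\<in>D X. \<ointegral>Y1 Y2\<in>D Y. \<beta> (X1 \<cdot>\<^sub>L Y1) (X2 \<rhd> Y2))"
proof -
  note bs = balD(1,2)[OF b] balD(3)[OF b UNIV_I]
  have b': "lbal (\<lambda>X1 X2. \<beta> X1 (t c \<cdot>\<^sub>L X2))" for c
    by standard (simp_all add: bs)
  have bsum: "\<beta> V (\<ointegral>x y\<in>c. F x y) = (\<ointegral>x y\<in>c. \<beta> V (F x y))" for V c and F :: "'l \<Rightarrow> 'l \<Rightarrow> 'l"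
    by (rule sw_hom) (rule bs)
  show ?thesis
    unfolding rtw_def D_sw[OF b] D_left_t[OF b] D_mult[OF b'] bsum
    by (rule self.coassoc2) (simp_all add: bs)
qed

lemma untwist_right: "(\<ointegral>X1 X2\<in>D X. \<ointegral>Y1 Y2\<in>D Y. t (\<Gamma> X2 Y2) \<cdot>\<^sub>L (X1 \<rhd> Y1)) = X \<cdot>\<^sub>L Y"
proof -
  have b: "lbal (\<lambda>X1 X2. t (\<epsilon> X2) \<cdot>\<^sub>L X1)" by standard simp_all
  have "(\<ointegral>X1 X2\<in>D X. \<ointegral>Y1 Y2\<in>D Y. t (\<Gamma> X2 Y2) \<cdot>\<^sub>L (X1 \<rhd> Y1)) =
    (\<ointegral>X p0\<in>D X. \<ointegral>Y q0\<in>D Y. \<ointegral>X1 X2\<in>D p0. \<ointegral>Y1 Y2\<in>D q0. t (\<Gamma>i X1 Y1 \<cdot>\<^sub>B \<Gamma> X2 Y2) \<cdot>\<^sub>L (X \<cdot>\<^sub>L Y))"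
    unfolding rtw_def sw_left_L L_simps(1)[symmetric, of "t _" "t _"] t_simps(2)[symmetric]
    by (rule self.coassoc2) simp_all
  also have "\<dots> = (\<ointegral>X1 X2\<in>D X. \<ointegral>Y1 Y2\<in>D Y. t (\<epsilon> (X2 \<cdot>\<^sub>L Y2)) \<cdot>\<^sub>L (X1 \<cdot>\<^sub>L Y1))"
    by (simp only: \<Gamma>i_\<Gamma> flip: sw_t sw_right_L)
  also have "\<dots> = X \<cdot>\<^sub>L Y"
    unfolding D_mult[OF b, symmetric] by (rule counit_t)
  finally show ?thesis .
qed

text \<open>
  The coefficients \<open>\<Gamma>\<^sup>-\<^sup>1(X\<^sub>2, Y\<^sub>2)\<close> of \<open>\<rhd>\<close> and \<open>\<Gamma>(X\<^sub>3, Y\<^sub>3)\<close> of \<open>\<bullet>\<close> meet in the middle and cancel.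
\<close>

lemma D_rtw_ltw:
  assumes b: "lbal \<beta>"
  shows "(\<ointegral>X1 X2\<in>D X. \<ointegral>Y1 Y2\<in>D Y. \<beta> (X1 \<rhd> Y1) (X2 \<bullet> Y2)) = (\<ointegral>X1 X2\<in>D (X \<cdot>\<^sub>L Y). \<beta> X1 X2)"
proof -
  note bs = balD(1,2)[OF b] balD(3)[OF b UNIV_I]
  have bsum: "\<beta> (\<ointegral>x y\<in>c. F x y) V = (\<ointegral>x y\<in>c. \<beta> (F x y) V)" "\<beta> V (\<ointegral>x y\<in>c. F x y) = (\<ointegral>x y\<in>c. \<beta> V (F x y))"
    for V c and F :: "'l \<Rightarrow> 'l \<Rightarrow> 'l"
    by (rule sw_hom[of "\<lambda>x. \<beta> x V"], rule bs, rule sw_hom, rule bs)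
  have "(\<ointegral>X1 X2\<in>D X. \<ointegral>Y1 Y2\<in>D Y. \<beta> (X1 \<rhd> Y1) (X2 \<bullet> Y2)) =
     (\<ointegral>X p0\<in>D X. \<ointegral>Y q0\<in>D Y. \<ointegral>X1 X2\<in>D X. \<ointegral>Y1 Y2\<in>D Y. \<beta> (X1 \<cdot>\<^sub>L Y1) (s (\<Gamma>i X2 Y2) \<cdot>\<^sub>L (p0 \<bullet> q0)))"
    unfolding rtw_def bsum bs(3) ..
  also have "\<dots> = (\<ointegral>X p0\<in>D X. \<ointegral>Y q0\<in>D Y. \<ointegral>X1 X2\<in>D p0. \<ointegral>Y1 Y2\<in>D q0. \<beta> (X \<cdot>\<^sub>L Y) (s (\<Gamma>i X1 Y1) \<cdot>\<^sub>L (X2 \<bullet> Y2)))"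
    by (rule self.coassoc2) (simp_all add: bs self.tw_mid ltw_t_mid)
  also have "\<dots> = (\<ointegral>X1 X2\<in>D (X \<cdot>\<^sub>L Y). \<beta> X1 X2)"
    unfolding bsum[symmetric] self.untwist D_mult[OF b] ..
  finally show ?thesis .
qed

text \<open>
  The product of \<open>\<L>\<^sup>\<Gamma>\<close>.
\<close>

definition stw (infixl \<open>\<star>\<close> 70) where
  "X \<star> Y = (\<ointegral>X1 X2\<in>D X. \<ointegral>Y1 Y2\<in>D Y. s (\<Gamma> X1 Y1) \<cdot>\<^sub>L (X2 \<rhd> Y2))"

lemma \<epsilon>_stw: "\<epsilon> (X \<star> Y) = \<epsilon> (X \<cdot>\<^sub>L Y)"
  unfolding stw_def sw_\<epsilon> \<epsilon>_s \<epsilon>_rtw by (rule \<Gamma>_\<Gamma>i)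

lemma D_stw_ltw_rtw:
  assumes b: "lbal \<beta>"
  shows "(\<ointegral>X1 X2\<in>D (X \<star> Y). \<beta> X1 X2) = (\<ointegral>X1 X2\<in>D X. \<ointegral>Y1 Y2\<in>D Y. \<beta> (X1 \<bullet> Y1) (X2 \<rhd> Y2))"
proof -
  note bs = balD(1,2)[OF b] balD(3)[OF b UNIV_I]
  have b': "lbal (\<lambda>X1 X2. \<beta> (s c \<cdot>\<^sub>L X1) X2)" for c
    by standard (simp_all add: bs)
  have bsum: "\<beta> (\<ointegral>x y\<in>c. F x y) V = (\<ointegral>x y\<in>c. \<beta> (F x y) V)" for V c and F :: "'l \<Rightarrow> 'l \<Rightarrow> 'l"
    by (rule sw_hom[of "\<lambda>x. \<beta> x V"], rule bs)
  show ?thesis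
    unfolding stw_def D_sw[OF b] D_left_s[OF b] D_rtw[OF b'] self.tw_def bsum
    by (rule self.coassoc2[symmetric]) (simp_all add: bs rtw_mid)
qed

text \<open>
  The inverse of a cocycle satisfies the mirrored cocycle condition.  In the three-variable convolution
  algebra \<open>?F\<close>, written in either of its two forms given by the cocycle condition for \<open>\<Gamma>\<close>, has \<open>?G1\<close> as
  right inverse and \<open>?G2\<close> as left inverse, and these coincide.  The two inverse
  properties come from \<open>\<Delta>(Y \<star> Z) = Y\<^sub>1 \<bullet> Z\<^sub>1 \<otimes> Y\<^sub>2 \<rhd> Z\<^sub>2\<close> and \<open>\<Delta>(XY) = X\<^sub>1 \<rhd> Y\<^sub>1 \<otimes> X\<^sub>2 \<bullet> Y\<^sub>2\<close>.
\<close>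

lemma \<Gamma>i_cocycle: "\<Gamma>i (X \<rhd> Y) Z = \<Gamma>i X (Y \<rhd> Z)"
proof -
  let ?F = "\<lambda>X Y Z. \<Gamma> X (Y \<bullet> Z)" and ?G1 = "\<lambda>X Y Z. \<Gamma>i X (Y \<rhd> Z)" and ?G2 = "\<lambda>X Y Z. \<Gamma>i (X \<rhd> Y) Z"
  let ?E = "\<lambda>X Y Z. \<epsilon> (X \<cdot>\<^sub>L (Y \<cdot>\<^sub>L Z))"
  have Be: "Be3 ?F" "Be3 ?G1" "Be3 ?G2"
    unfolding Be3_def by (simp_all add: self.tw_mid ltw_t_mid rtw_mid)
  have "conv3 ?F ?G1 X Y Z = ?E X Y Z" for X Y Z
  proof -
    have tak: "lbal (\<lambda>X1 X2. \<Gamma> X1 V \<cdot>\<^sub>B \<Gamma>i X2 W)" for V W by standard simp_all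
    have "lbal (\<lambda>V W. \<ointegral>X1 X2\<in>D X. \<Gamma> X1 V \<cdot>\<^sub>B \<Gamma>i X2 W)"
      using D_tak[OF tak, of X] by (intro balI) (simp_all add: sw_plus)
    note r = D_stw_ltw_rtw[OF this, of Y Z]
    have "conv3 ?F ?G1 X Y Z = (\<ointegral>V W\<in>D (Y \<star> Z). \<ointegral>X1 X2\<in>D X. \<Gamma> X1 V \<cdot>\<^sub>B \<Gamma>i X2 W)"
      unfolding conv3_def sw_swap[of "D X"] by (rule r[symmetric])
    also have "\<dots> = \<epsilon> (X \<cdot>\<^sub>L (Y \<star> Z))"
      using \<Gamma>_\<Gamma>i[of X "Y \<star> Z"] by (simp only: sw_swap[of "D X"])
    also have "\<dots> = ?E X Y Z"
      using \<epsilon>_mult_s[of X "Y \<star> Z"] \<epsilon>_mult_s[of X "Y \<cdot>\<^sub>L Z"] by (simp only: \<epsilon>_stw)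
    finally show ?thesis .
  qed
  then have FG: "conv3 ?F ?G1 = ?E" by (intro ext)
  have "conv3 ?G2 ?F X Y Z = ?E X Y Z" for X Y Z
  proof -
    have "lbal (\<lambda>V W. \<ointegral>Z1 Z2\<in>D Z. \<Gamma>i V Z1 \<cdot>\<^sub>B \<Gamma> W Z2)"
      by standard (simp_all add: sw_plus)
    note r = D_rtw_ltw[OF this, of X Y]
    have "conv3 ?G2 ?F X Y Z = (\<ointegral>V W\<in>D (X \<cdot>\<^sub>L Y). \<ointegral>Z1 Z2\<in>D Z. \<Gamma>i V Z1 \<cdot>\<^sub>B \<Gamma> W Z2)"
      unfolding conv3_def cocycle_eq by (rule r)
    also have "\<dots> = ?E X Y Z" using \<Gamma>i_\<Gamma>[of "X \<cdot>\<^sub>L Y" Z] by simp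
    finally show ?thesis .
  qed
  then have GF: "conv3 ?G2 ?F = ?E" by (intro ext)
  have "?G2 X Y Z = conv3 ?G2 (conv3 ?F ?G1) X Y Z"
    unfolding FG by (rule conv3_unit_right[OF Be(3), symmetric])
  also have "\<dots> = conv3 (conv3 ?G2 ?F) ?G1 X Y Z"
    by (rule conv3_assoc[OF Be(3,1,2), symmetric])
  also have "\<dots> = ?G1 X Y Z"
    unfolding GF by (rule conv3_unit_left[OF Be(2)])
  finally show ?thesis .
qed

lemma rtw_assoc: "(X \<rhd> Y) \<rhd> Z = X \<rhd> (Y \<rhd> Z)"
proof -
  have "(X \<rhd> Y) \<rhd> Z = (\<ointegral>X1 X2\<in>D X. \<ointegral>Y1 Y2\<in>D Y. \<ointegral>Z1 Z2\<in>D Z. t (\<Gamma>i (X2 \<rhd> Y2) Z2) \<cdot>\<^sub>L ((X1 \<cdot>\<^sub>L Y1) \<cdot>\<^sub>L Z1))"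
    unfolding rtw_def[of "X \<rhd> Y"] by (rule D_rtw[OF rtw_test_left])
  also have "\<dots> = (\<ointegral>Y1 Y2\<in>D Y. \<ointegral>Z1 Z2\<in>D Z. \<ointegral>X1 X2\<in>D X. t (\<Gamma>i X2 (Y2 \<rhd> Z2)) \<cdot>\<^sub>L (X1 \<cdot>\<^sub>L (Y1 \<cdot>\<^sub>L Z1)))"
    unfolding sw_swap[of "D X"] \<Gamma>i_cocycle L_simps(1) ..
  also have "\<dots> = X \<rhd> (Y \<rhd> Z)"
    unfolding rtw_swap[of X "Y \<rhd> Z"] by (rule D_rtw[OF rtw_test_right, symmetric])
  finally show ?thesis .
qed

end


section \<open>The twisted bialgebroid and its comodule algebra\<close>

lemma k_algebra_cong:
  assumes "scl A = scl A'" "prd A = prd A'" "unt A = unt A'" "k_algebra A"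
  shows "k_algebra A'"
  using assms by (simp add: k_algebra_def)

context comodalg
begin

lemma scl_P: "scl P c p = e (scl B c (unt B)) \<cdot>\<^sub>P p" "scl P c p = p \<cdot>\<^sub>P e (scl B c (unt B))"
  using k_algebraD(6,7)[OF kP] by (simp_all add: alg_homD(4)[OF e_hom])

text \<open>
  A field element acts as an element of \<open>B\<close>, from the left and from the right, so bilinearity over the
  field follows from \<open>B\<close>-linearity on both sides.
\<close>

lemma k_algebra_mult:
  assumes assoc: "\<And>p q r. m (m p q) r = m p (m q r)"
    and one: "\<And>p. m (unt P) p = p" "\<And>p. m p (unt P) = p"
    and add: "\<And>p p' q. m (p + p') q = m p q + m p' q" "\<And>p q q'. m p (q + q') = m p q + m p q'"
    and bimod: "\<And>b p q. m (e b \<cdot>\<^sub>P p) q = e b \<cdot>\<^sub>P m p q" "\<And>b p q. m p (q \<cdot>\<^sub>P e b) = m p q \<cdot>\<^sub>P e b"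
  shows "k_algebra (P\<lparr>prd := m\<rparr>)"
proof -
  have 1: "m (scl P c p) q = scl P c (m p q)" for c p q by (simp only: scl_P(1) bimod)
  have 2: "m p (scl P c q) = scl P c (m p q)" for c p q by (simp only: scl_P(2) bimod)
  show ?thesis
    unfolding k_algebra_def using k_algebraD(8)[OF kP] by (simp add: assoc one add 1 2)
qed

lemma alg_hom_mult:
  assumes "\<And>b c. m (e b) (e c) = e b \<cdot>\<^sub>P e c"
  shows "alg_hom B (P\<lparr>prd := m\<rparr>) e"
  using e_hom assms unfolding alg_hom_def by simp

end

context cocycle
begin

text \<open>
  \<open>\<L>\<close> with the right twisted product, as a comodule algebra over \<open>\<L>\<close>.
\<close>

definition rself where "rself = (self L)\<lparr>prd := (\<rhd>)\<rparr>"

lemma rself_simps [simp]: "prd rself = (\<rhd>)" "unt rself = unt L" "scl rself = scl L" "emb rself = src L" "coact rself = cop L"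
  by (simp_all add: rself_def)

lemma rself_comodule_algebra: "comodule_algebra B L rself"
proof (rule comodule_algebraI)
  show "k_algebra rself"
    unfolding rself_def by (rule self.k_algebra_mult) (simp_all add: rtw_assoc)
  show "alg_hom B rself (emb rself)"
    using self.alg_hom_mult[of "(\<rhd>)"] by (simp add: rself_def)
  show "coact rself X \<in> takeuchi L (blact rself) (bract rself)" for X
    using lb_tak[of X] by simp
  show "coassociative L (blact rself) (coact rself)"
    using lb_coassoc by simp
  show "(\<ointegral>X q\<in>rep (coact rself p). emb rself (\<epsilon> X) \<cdot>\<^bsub>rself\<^esub> q) = p" for p
    by (simp add: self.counit)
  fix \<beta> :: "'l \<Rightarrow> 'l \<Rightarrow> ('l \<times> 'l \<Rightarrow>\<^sub>0 int) quo"
  assume "dbal L (blact rself) \<beta>"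
  then have b: "lbal \<beta>" by simp
  show "(\<ointegral>X r\<in>rep (coact rself (X + Y)). \<beta> X r) =
      (\<ointegral>X r\<in>rep (coact rself X). \<beta> X r) + (\<ointegral>X r\<in>rep (coact rself Y). \<beta> X r)" for X Y
    by (simp add: D_add[OF b])
  show "(\<ointegral>X r\<in>rep (coact rself (emb rself c)). \<beta> X r) = \<beta> (s c) (unt rself)" for c
    by (simp add: D_s[OF b])
  show "(\<ointegral>X r\<in>rep (coact rself (X \<cdot>\<^bsub>rself\<^esub> Y)). \<beta> X r) =
    (\<ointegral>X p'\<in>rep (coact rself X). \<ointegral>Y q'\<in>rep (coact rself Y). \<beta> (X \<cdot>\<^sub>L Y) (p' \<cdot>\<^bsub>rself\<^esub> q'))" for X Y
    by (simp add: D_rtw[OF b])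
qed

lemma rself_cocycle_comodalg: "cocycle_comodalg B L \<Gamma> rself"
  by (intro cocycle_comodalg.intro comodalg.intro comodalg_axioms.intro cocycle_axioms bialgebroid_axioms rself_comodule_algebra)

lemma rself_tw: "cocycle_comodalg.tw \<Gamma> rself = (\<star>)"
proof (intro ext)
  interpret rt: cocycle_comodalg B L \<Gamma> rself by (rule rself_cocycle_comodalg)
  show "rt.tw X Y = X \<star> Y" for X Y by (simp add: rt.tw_def stw_def)
qed

lemma stw_add [simp]: "(X + X') \<star> Y = X \<star> Y + X' \<star> Y" "X \<star> (Y + Y') = X \<star> Y + X \<star> Y'"
  and stw_left_s [simp]: "(s b \<cdot>\<^sub>L X) \<star> Y = s b \<cdot>\<^sub>L (X \<star> Y)"
  and stw_right_s [simp]: "X \<star> (Y \<cdot>\<^sub>L s b) = (X \<star> Y) \<cdot>\<^sub>L s b"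
  and stw_one [simp]: "unt L \<star> X = X" "X \<star> unt L = X"
  and stw_assoc: "(X \<star> Y) \<star> Z = X \<star> (Y \<star> Z)"
proof -
  interpret rt: cocycle_comodalg B L \<Gamma> rself
    rewrites "cocycle_comodalg.tw \<Gamma> rself = (\<star>)"
    by (rule rself_cocycle_comodalg) (rule rself_tw)
  show "(X + X') \<star> Y = X \<star> Y + X' \<star> Y" "X \<star> (Y + Y') = X \<star> Y + X \<star> Y'" by (rule rt.tw_add)+
  show "(s b \<cdot>\<^sub>L X) \<star> Y = s b \<cdot>\<^sub>L (X \<star> Y)" using rt.tw_emb[of b X Y] by simp
  show "X \<star> (Y \<cdot>\<^sub>L s b) = (X \<star> Y) \<cdot>\<^sub>L s b" using rt.tw_right[of X Y b] by simp
  show "unt L \<star> X = X" "X \<star> unt L = X" using rt.tw_one[of X] by simp_all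
  show "(X \<star> Y) \<star> Z = X \<star> (Y \<star> Z)" by (rule rt.tw_assoc)
qed

lemma stw_test_left: "lbal (\<lambda>X1 X2. \<ointegral>Y1 Y2\<in>D Y. s (\<Gamma> X1 Y1) \<cdot>\<^sub>L (X2 \<rhd> Y2))"
  by standard (simp_all add: sw_plus)

lemma stw_test_right: "lbal (\<lambda>Y1 Y2. \<ointegral>X1 X2\<in>D X. s (\<Gamma> X1 Y1) \<cdot>\<^sub>L (X2 \<rhd> Y2))"
proof
  fix b Y Y'
  have "lbal (\<lambda>X1 X2. s (\<Gamma> X1 Y) \<cdot>\<^sub>L (X2 \<rhd> Y'))" by standard simp_all
  from D_tak[OF this, of X b]
  show "(\<ointegral>X1 X2\<in>D X. s (\<Gamma> X1 (t b \<cdot>\<^sub>L Y)) \<cdot>\<^sub>L (X2 \<rhd> Y')) = (\<ointegral>X1 X2\<in>D X. s (\<Gamma> X1 Y) \<cdot>\<^sub>L (X2 \<rhd> (s b \<cdot>\<^sub>L Y')))"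
    by (simp add: rtw_mid)
qed (simp_all add: sw_plus)

lemma stw_swap: "X \<star> Y = (\<ointegral>Y1 Y2\<in>D Y. \<ointegral>X1 X2\<in>D X. s (\<Gamma> X1 Y1) \<cdot>\<^sub>L (X2 \<rhd> Y2))"
  unfolding stw_def by (rule sw_swap)

lemma stw_left_t [simp]: "(t b \<cdot>\<^sub>L X) \<star> Y = t b \<cdot>\<^sub>L (X \<star> Y)"
  unfolding stw_def D_left_t[OF stw_test_left] by (simp add: sw_left_L)

lemma stw_right_t [simp]: "X \<star> (Y \<cdot>\<^sub>L t b) = (X \<star> Y) \<cdot>\<^sub>L t b"
  unfolding stw_swap D_right_t[OF stw_test_right] by (simp add: sw_right_L)

lemma stw_mid_t: "(X \<cdot>\<^sub>L t b) \<star> Y = X \<star> (t b \<cdot>\<^sub>L Y)"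
  unfolding stw_swap[of X] D_left_t[OF stw_test_right]
  unfolding stw_def D_right_t[OF stw_test_left] by (simp add: sw_swap[of "D X"] rtw_mid)

lemma stw_st [simp]: "s b \<star> X = s b \<cdot>\<^sub>L X" "t b \<star> X = t b \<cdot>\<^sub>L X" "X \<star> s b = X \<cdot>\<^sub>L s b" "X \<star> t b = X \<cdot>\<^sub>L t b"
  using stw_left_s[of b "unt L" X] stw_left_t[of b "unt L" X] stw_right_s[of X "unt L" b] stw_right_t[of X "unt L" b]
  by simp_all

text \<open>
  Expresses \<open>\<bullet>\<close> through \<open>\<star>\<close>: the factor \<open>\<Gamma>\<^sup>-\<^sup>1\<close> on the right of \<open>\<star>\<close> is cancelled by \<open>\<Gamma>\<close>.
\<close>

lemma ltw_from_stw: "(\<ointegral>X1 X2\<in>D X. \<ointegral>Y1 Y2\<in>D Y. t (\<Gamma> X2 Y2) \<cdot>\<^sub>L (X1 \<star> Y1)) = X \<bullet> Y"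
proof -
  have "(\<ointegral>X1 X2\<in>D X. \<ointegral>Y1 Y2\<in>D Y. t (\<Gamma> X2 Y2) \<cdot>\<^sub>L (X1 \<star> Y1)) =
    (\<ointegral>X p0\<in>D X. \<ointegral>Y q0\<in>D Y. \<ointegral>X1 X2\<in>D p0. \<ointegral>Y1 Y2\<in>D q0. s (\<Gamma> X Y) \<cdot>\<^sub>L (t (\<Gamma> X2 Y2) \<cdot>\<^sub>L (X1 \<rhd> Y1)))"
    unfolding stw_def sw_left_L s_t_simps(2)[symmetric]
    by (rule self.coassoc2) (simp_all add: rtw_mid)
  also have "\<dots> = X \<bullet> Y"
    by (simp only: untwist_right self.tw_def flip: sw_left_L)
  finally show ?thesis .
qed

text \<open>
  The product in the definition of \<open>\<L>\<^sup>\<Gamma>\<close> uses \<open>(\<Delta> \<otimes> id)\<Delta>\<close>, the iterated twist uses \<open>(id \<otimes> \<Delta>)\<Delta>\<close>.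
\<close>

lemma twist_bialgd_eq: "twist_bialgd B \<Gamma> L = L\<lparr>prd := (\<star>)\<rparr>"
proof -
  have "X \<star> Y = vsum L (\<lambda>(X1, X2, X3). vsum L (\<lambda>(Y1, Y2, Y3).
      s (\<Gamma> X1 Y1) \<cdot>\<^sub>L t (\<Gamma>i X3 Y3) \<cdot>\<^sub>L X2 \<cdot>\<^sub>L Y2) (cop2 L Y)) (cop2 L X)" for X Y
  proof -
    have c2: "vsum L f (cop2 L X) = (\<ointegral>X12 X3\<in>D X. \<ointegral>X1 X2\<in>D X12. f (X1, X2, X3))" for f X
      by (simp add: vsumL cop2_def isum_frag_extend sw_def case_prod_unfold)
    have "X \<star> Y = (\<ointegral>X1 X2\<in>D X. \<ointegral>Y1 Y2\<in>D Y. \<ointegral>X2 X3\<in>D X2. \<ointegral>Y2 Y3\<in>D Y2.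
        s (\<Gamma> X1 Y1) \<cdot>\<^sub>L (t (\<Gamma>i X3 Y3) \<cdot>\<^sub>L (X2 \<cdot>\<^sub>L Y2)))"
      unfolding stw_def rtw_def sw_left_L ..
    also have "\<dots> = (\<ointegral>X12 X3\<in>D X. \<ointegral>Y12 Y3\<in>D Y. \<ointegral>X1 X2\<in>D X12. \<ointegral>Y1 Y2\<in>D Y12.
        s (\<Gamma> X1 Y1) \<cdot>\<^sub>L (t (\<Gamma>i X3 Y3) \<cdot>\<^sub>L (X2 \<cdot>\<^sub>L Y2)))"
      by (rule self.coassoc2[symmetric]) simp_all
    also have "\<dots> = (\<ointegral>X12 X3\<in>D X. \<ointegral>X1 X2\<in>D X12. \<ointegral>Y12 Y3\<in>D Y. \<ointegral>Y1 Y2\<in>D Y12.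
        s (\<Gamma> X1 Y1) \<cdot>\<^sub>L (t (\<Gamma>i X3 Y3) \<cdot>\<^sub>L (X2 \<cdot>\<^sub>L Y2)))"
      unfolding sw_swap[of "D Y"] ..
    finally show ?thesis by (simp add: c2 del: s_t_simps)
  qed
  then show ?thesis unfolding twist_bialgd_def by presburger
qed

end

context cocycle_comodalg
begin

text \<open>
  The coaction is multiplicative for the two twisted products.  Its value on \<open>p \<cdot>\<^sub>\<Gamma> q\<close> is
  \<open>p\<^sub>-\<^sub>1 \<bullet> q\<^sub>-\<^sub>1 \<otimes> p\<^sub>0 q\<^sub>0\<close>; writing \<open>\<bullet>\<close> through \<open>\<star>\<close> leaves a scalar \<open>\<Gamma>(p\<^sub>-\<^sub>1, q\<^sub>-\<^sub>1)\<close> through the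
  target, which moves across \<open>\<diamond>\<close> and completes the twisted product on the right.  Applied to the right
  twist of \<open>\<L>\<close> this also says that \<open>\<Delta>\<close> is multiplicative for \<open>\<star>\<close>.
\<close>

lemma C_tw_stw:
  assumes b: "pbal \<beta>"
  shows "(\<ointegral>X r\<in>C (tw p q). \<beta> X r) = (\<ointegral>X p0\<in>C p. \<ointegral>Y q0\<in>C q. \<beta> (X \<star> Y) (tw p0 q0))"
proof -
  note bs = balD(1,2)[OF b] balD(3)[OF b UNIV_I]
  have bsum: "\<beta> (\<ointegral>x y\<in>c. F x y) r = (\<ointegral>x y\<in>c. \<beta> (F x y) r)" "\<beta> X (\<ointegral>x y\<in>c'. G x y) = (\<ointegral>x y\<in>c'. \<beta> X (G x y))"
    for c r X c' and F :: "'l \<Rightarrow> 'l \<Rightarrow> 'l" and G :: "'l \<Rightarrow> 'p \<Rightarrow> 'p"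
    by (rule sw_hom[of "\<lambda>x. \<beta> x r"], rule bs, rule sw_hom, rule bs)
  have "(\<ointegral>X r\<in>C (tw p q). \<beta> X r) = (\<ointegral>X p0\<in>C p. \<ointegral>Y q0\<in>C q. \<beta> (X \<bullet> Y) (p0 \<cdot>\<^sub>P q0))"
    unfolding C_tw[OF b] self.tw_def bsum ..
  also have "\<dots> = (\<ointegral>X p0\<in>C p. \<ointegral>Y q0\<in>C q. \<ointegral>X1 X2\<in>D X. \<ointegral>Y1 Y2\<in>D Y. \<beta> (X1 \<star> Y1) (e (\<Gamma> X2 Y2) \<cdot>\<^sub>P (p0 \<cdot>\<^sub>P q0)))"
    unfolding ltw_from_stw[symmetric] bsum bs(3) ..
  also have "\<dots> = (\<ointegral>X p0\<in>C p. \<ointegral>Y q0\<in>C q. \<ointegral>X2 p2\<in>C p0. \<ointegral>Y2 q2\<in>C q0. \<beta> (X \<star> Y) (e (\<Gamma> X2 Y2) \<cdot>\<^sub>P (p2 \<cdot>\<^sub>P q2)))"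
    by (rule coassoc2) (simp_all add: bs stw_mid_t)
  also have "\<dots> = (\<ointegral>X p0\<in>C p. \<ointegral>Y q0\<in>C q. \<beta> (X \<star> Y) (tw p0 q0))"
    unfolding tw_def bsum ..
  finally show ?thesis .
qed

lemma twist_comodalg_eq: "twist_comodalg \<Gamma> P = P\<lparr>prd := tw\<rparr>"
proof -
  have "tw p q = vsum P (\<lambda>(X, p0). vsum P (\<lambda>(Y, q0). e (\<Gamma> X Y) \<cdot>\<^sub>P p0 \<cdot>\<^sub>P q0) (C q)) (C p)" for p q
    by (simp add: vsumP tw_def sw_def)
  then show ?thesis unfolding twist_comodalg_def by presburger
qed

end

context cocycle
begin

abbreviation L\<Gamma> where "L\<Gamma> \<equiv> L\<lparr>prd := (\<star>)\<rparr>"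

text \<open>
  On elements of \<open>B\<close> and \<open>\<bar>B\<close> the products of \<open>\<L>\<close> and \<open>\<L>\<^sup>\<Gamma>\<close> agree, so both have the same tensor
  products and Takeuchi products.
\<close>

lemma twist_dcls: "dcls L\<Gamma> = dcls L"
  by (intro ext) (simp add: dcls_def)

lemma twist_diamond: "diamond L\<Gamma> = diamond L"
  by (intro ext) (simp add: diamond_def)

lemma twist_takeuchi: "takeuchi L\<Gamma> = takeuchi L"
  by (intro ext) (simp add: takeuchi_def twist_dcls twist_diamond)

lemma twist_coassociative: "coassociative L\<Gamma> = coassociative L"
  by (intro ext) (simp add: coassociative_def diamond3_null_def)

lemma twist_k_algebra: "k_algebra L\<Gamma>"
proof (rule k_algebra_cong)
  interpret rt: cocycle_comodalg B L \<Gamma> rself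
    rewrites "cocycle_comodalg.tw \<Gamma> rself = (\<star>)"
    by (rule rself_cocycle_comodalg) (rule rself_tw)
  show "k_algebra (rself\<lparr>prd := (\<star>)\<rparr>)"
    by (rule rt.k_algebra_mult) (simp_all add: stw_assoc)
qed simp_all

lemma twist_left_bialgebroid: "left_bialgebroid B L\<Gamma>"
proof -
  have mult: "cop L (X \<star> Y) = dcls L (\<lambda>b X. s b \<cdot>\<^sub>L X) (fprod (\<star>) (\<star>) (D X) (D Y))" for X Y
  proof -
    interpret rt: cocycle_comodalg B L \<Gamma> rself
      rewrites "cocycle_comodalg.tw \<Gamma> rself = (\<star>)"
      by (rule rself_cocycle_comodalg) (rule rself_tw)
    have "dcls L (\<lambda>b X. s b \<cdot>\<^sub>L X) (D (X \<star> Y)) = dcls L (\<lambda>b X. s b \<cdot>\<^sub>L X) (fprod (\<star>) (\<star>) (D X) (D Y))"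
      by (rule dcls_eqI) (use rt.C_tw_stw in simp)
    then show ?thesis using self.C_cls[of "X \<star> Y"] by simp
  qed
  have s: "alg_hom B L\<Gamma> s"
    using s_hom unfolding alg_hom_def by simp
  have t: "alg_hom (op_alg B) L\<Gamma> t"
    using t_hom unfolding alg_hom_def by (simp add: op_alg_def)
  have act: "(\<star>) (s b) = (\<cdot>\<^sub>L) (s b)" "(\<star>) (t b) = (\<cdot>\<^sub>L) (t b)" for b
    by (intro ext, simp)+
  have vs: "vsum L\<Gamma> = vsum L" by (intro ext) (simp add: vsum_def)
  show ?thesis
    unfolding left_bialgebroid_def Let_def twist_dcls twist_diamond twist_takeuchi twist_coassociative vs
    using kB twist_k_algebra s t lb_tak lb_add lb_lin[simplified] lb_coassoc lb_one mult
      lb_counit_s lb_counit_t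
    by (simp add: act \<epsilon>_stw \<epsilon>_mult_s \<epsilon>_mult_t)
qed

end

context cocycle_comodalg
begin

abbreviation P\<Gamma> where "P\<Gamma> \<equiv> P\<lparr>prd := tw\<rparr>"

lemma twist_comodule_algebra: "comodule_algebra B L\<Gamma> P\<Gamma>"
proof -
  interpret T: bialgebroid B "L\<Gamma>" by (rule bialgebroid.intro[OF twist_left_bialgebroid])
  show ?thesis
  proof (rule T.comodule_algebraI)
    show "k_algebra P\<Gamma>" by (rule k_algebra_mult) (simp_all add: tw_assoc)
    show "alg_hom B P\<Gamma> (emb P\<Gamma>)" using alg_hom_mult[of tw] by simp
    show "coact P\<Gamma> p \<in> takeuchi L\<Gamma> (blact P\<Gamma>) (bract P\<Gamma>)" for p
      using tak_C[of p] by (simp add: twist_takeuchi)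
    show "coassociative L\<Gamma> (blact P\<Gamma>) (coact P\<Gamma>)"
      using coassociative_C by (simp add: twist_coassociative)
    show "(\<ointegral>X q\<in>rep (coact P\<Gamma> p). emb P\<Gamma> (cou L\<Gamma> X) \<cdot>\<^bsub>P\<Gamma>\<^esub> q) = p" for p
      by (simp add: counit)
    fix \<beta> :: "'l \<Rightarrow> 'p \<Rightarrow> ('l \<times> 'p \<Rightarrow>\<^sub>0 int) quo"
    assume "dbal L\<Gamma> (blact P\<Gamma>) \<beta>"
    then have b: "pbal \<beta>" by simp
    show "(\<ointegral>X r\<in>rep (coact P\<Gamma> (p + q)). \<beta> X r) =
        (\<ointegral>X r\<in>rep (coact P\<Gamma> p). \<beta> X r) + (\<ointegral>X r\<in>rep (coact P\<Gamma> q). \<beta> X r)" for p q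
      by (simp add: C_add[OF b])
    show "(\<ointegral>X r\<in>rep (coact P\<Gamma> (emb P\<Gamma> c)). \<beta> X r) = \<beta> (src L\<Gamma> c) (unt P\<Gamma>)" for c
      by (simp add: C_emb[OF b])
    show "(\<ointegral>X r\<in>rep (coact P\<Gamma> (p \<cdot>\<^bsub>P\<Gamma>\<^esub> q)). \<beta> X r) =
      (\<ointegral>X p'\<in>rep (coact P\<Gamma> p). \<ointegral>Y q'\<in>rep (coact P\<Gamma> q). \<beta> (X \<cdot>\<^bsub>L\<Gamma>\<^esub> Y) (p' \<cdot>\<^bsub>P\<Gamma>\<^esub> q'))" for p q
      by (simp add: C_tw_stw[OF b])
  qed
qed

end


section \<open>The canonical map and the translation map\<close>

text \<open>
  Only the actions of elements of \<open>R\<close> enter; outside \<open>N\<close>, multiplication in \<open>P\<close> and in its twist differ.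
\<close>

lemma tensor_tmod_cong:
  assumes "\<And>r m. r \<in> R \<Longrightarrow> am r m = am' r m" "\<And>r n. r \<in> R \<Longrightarrow> an r n = an' r n"
  shows "tensor R (tmod am) (tmod an) = tensor R (tmod am') (tmod an')"
    "tcls R (tmod am) (tmod an) = tcls R (tmod am') (tmod an')"
proof -
  have "ten_rels R (tmod am) (tmod an) = ten_rels R (tmod am') (tmod an')"
    unfolding ten_rels_def tmod_simps using assms by (intro arg_cong2[where f = "(\<union>)"] refl) (metis (no_types, opaque_lifting))
  then have "ten_null R (tmod am) (tmod an) = ten_null R (tmod am') (tmod an')"
    unfolding ten_null_def tmod_simps by simp
  then show "tensor R (tmod am) (tmod an) = tensor R (tmod am') (tmod an')"
    "tcls R (tmod am) (tmod an) = tcls R (tmod am') (tmod an')"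
    unfolding tensor_def tcls_def tmod_simps by simp_all
qed

locale galois = comodalg B L P for B :: "('k::field, 'b::ab_group_add) alg"
    and L :: "('k, 'b, 'l::ab_group_add) bialgd" and P :: "('k, 'b, 'l, 'p::ab_group_add) comodalg" +
  fixes N :: "'p set"
  assumes N: "N = coinvariants L P"
    and can_bij: "bij_betw (left_can L P) (carrier (tens_N P N)) (carrier (diamond L (blact P)))"
begin

abbreviation nbal where "nbal \<equiv> bal N (\<lambda>n p. p \<cdot>\<^sub>P n) (\<lambda>n q. n \<cdot>\<^sub>P q)"

lemma C_N:
  assumes "pbal \<beta>" "n \<in> N"
  shows "(\<ointegral>X r\<in>C n. \<beta> X r) = \<beta> (unt L) n"
proof -
  have "coact P n = dcls L (blact P) (frag_of (unt L, n))"
    using assms(2) unfolding N coinvariants_def by blast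
  then show ?thesis by (simp add: sw_rep_dcls[OF assms(1)])
qed

text \<open>
  Coinvariants commute with \<open>B\<close>: apply the counit to the coaction of \<open>n b\<close>.
\<close>

lemma N_comm: "n \<in> N \<Longrightarrow> n \<cdot>\<^sub>P e b = e b \<cdot>\<^sub>P n"
proof -
  assume n: "n \<in> N"
  have b1: "pbal (\<lambda>X q. e (\<epsilon> X) \<cdot>\<^sub>P q)" by standard simp_all
  have b2: "pbal (\<lambda>X q. e (\<epsilon> (X \<cdot>\<^sub>L s b)) \<cdot>\<^sub>P q)" by standard simp_all
  have "\<epsilon> (s b) = b" using \<epsilon>_s[of b "unt L"] by simp
  then show ?thesis using C_right[OF b1, of n b] C_N[OF b2 n] by (simp add: counit)
qed

lemma N_comm' [simp]: "n \<in> N \<Longrightarrow> e b \<cdot>\<^sub>P (n \<cdot>\<^sub>P p) = n \<cdot>\<^sub>P (e b \<cdot>\<^sub>P p)"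
  using N_comm[of n b] by (metis P_simps(1))

lemma C_left_N:
  assumes b: "pbal \<beta>" and n: "n \<in> N"
  shows "(\<ointegral>X r\<in>C (n \<cdot>\<^sub>P p). \<beta> X r) = (\<ointegral>X r\<in>C p. \<beta> X (n \<cdot>\<^sub>P r))"
proof -
  note bs = balD(1,2)[OF b] balD(3)[OF b UNIV_I]
  have "pbal (\<lambda>X r. \<ointegral>Y q0\<in>C p. \<beta> (X \<cdot>\<^sub>L Y) (r \<cdot>\<^sub>P q0))"
    by standard (simp_all add: bs sw_plus)
  from C_N[OF this n] show ?thesis by (simp add: C_mult[OF b])
qed

lemma C_right_N:
  assumes b: "pbal \<beta>" and n: "n \<in> N"
  shows "(\<ointegral>X r\<in>C (p \<cdot>\<^sub>P n). \<beta> X r) = (\<ointegral>X r\<in>C p. \<beta> X (r \<cdot>\<^sub>P n))"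
proof -
  note bs = balD(1,2)[OF b] balD(3)[OF b UNIV_I]
  have t: "pbal (\<lambda>Y q0. \<ointegral>X r\<in>C p. \<beta> (X \<cdot>\<^sub>L Y) (r \<cdot>\<^sub>P q0))"
  proof
    fix b Y q
    have "pbal (\<lambda>X r. \<beta> (X \<cdot>\<^sub>L Y) (r \<cdot>\<^sub>P q))" by standard (simp_all add: bs)
    from C_tak[OF this, of p b]
    show "(\<ointegral>X r\<in>C p. \<beta> (X \<cdot>\<^sub>L (t b \<cdot>\<^sub>L Y)) (r \<cdot>\<^sub>P q)) = (\<ointegral>X r\<in>C p. \<beta> (X \<cdot>\<^sub>L Y) (r \<cdot>\<^sub>P (e b \<cdot>\<^sub>P q)))" by simp
  qed (simp_all add: bs sw_plus)
  have "(\<ointegral>X r\<in>C (p \<cdot>\<^sub>P n). \<beta> X r) = (\<ointegral>Y q0\<in>C n. \<ointegral>X r\<in>C p. \<beta> (X \<cdot>\<^sub>L Y) (r \<cdot>\<^sub>P q0))"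
    unfolding C_mult[OF b] by (rule sw_swap)
  then show ?thesis using C_N[OF t n] by simp
qed

text \<open>
  The canonical map on formal sums.  The product \<open>m\<close> is a parameter, so that one definition serves \<open>P\<close> and its
  twist.
\<close>

definition canf where
  "canf m x = frag_extend (\<lambda>(p, q). fmap2 id (\<lambda>p0. m p0 q) (C p)) x"

lemma sw_canf: "(\<ointegral>V r\<in>canf m x. \<beta> V r) = (\<ointegral>p q\<in>x. \<ointegral>V p0\<in>C p. \<beta> V (m p0 q))"
  unfolding canf_def sw_extend by simp

lemma can_test:
  assumes b: "pbal \<beta>"
  shows "nbal (\<lambda>p q. \<ointegral>V p0\<in>C p. \<beta> V (p0 \<cdot>\<^sub>P q))"
proof -
  note bs = balD(1,2)[OF b] balD(3)[OF b UNIV_I]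
  have b': "pbal (\<lambda>V p0. \<beta> V (p0 \<cdot>\<^sub>P q))" for q by standard (simp_all add: bs)
  show ?thesis by standard (simp_all add: bs C_add[OF b'] C_right_N[OF b'] sw_plus)
qed

lemma left_can_ncls: "left_can L P (ncls P N x) = dcls L (blact P) (canf (prd P) x)"
  unfolding left_can_def canf_def[symmetric]
proof (rule dcls_eqI)
  fix \<beta> :: "'l \<Rightarrow> 'p \<Rightarrow> ('l \<times> 'p \<Rightarrow>\<^sub>0 int) quo"
  assume "pbal \<beta>"
  from can_test[OF this]
  show "(\<ointegral>V r\<in>canf (prd P) (rep (ncls P N x)). \<beta> V r) = (\<ointegral>V r\<in>canf (prd P) x. \<beta> V r)"
    unfolding sw_canf ncls_def by (rule sw_rep_tcls)
qed

lemma carrier_tens_N: "carrier (tens_N P N) = range (ncls P N)"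
  unfolding tens_N_def ncls_def by (rule carrier_tensor_tmod)

text \<open>
  Injectivity of the canonical map as a proof method: formal sums with the same image take the same values
  under every \<open>N\<close>-balanced map.
\<close>

lemma can_inj:
  assumes "\<And>\<beta> :: 'l \<Rightarrow> 'p \<Rightarrow> ('l \<times> 'p \<Rightarrow>\<^sub>0 int) quo. pbal \<beta> \<Longrightarrow>
      (\<ointegral>p q\<in>x. \<ointegral>V p0\<in>C p. \<beta> V (p0 \<cdot>\<^sub>P q)) = (\<ointegral>p q\<in>y. \<ointegral>V p0\<in>C p. \<beta> V (p0 \<cdot>\<^sub>P q))"
    and g: "nbal \<gamma>"
  shows "(\<ointegral>p q\<in>x. \<gamma> p q) = (\<ointegral>p q\<in>y. \<gamma> p q)"
proof -
  have "dcls L (blact P) (canf (prd P) x) = dcls L (blact P) (canf (prd P) y)"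
    by (rule dcls_eqI) (unfold sw_canf, rule assms(1))
  then have "left_can L P (ncls P N x) = left_can L P (ncls P N y)" by (simp only: left_can_ncls)
  then have "ncls P N x = ncls P N y"
    using can_bij unfolding bij_betw_def carrier_tens_N by (meson inj_onD rangeI)
  from tcls_eqD[OF this[unfolded ncls_def] g] show ?thesis .
qed

subsection \<open>The translation map\<close>

abbreviation T where "T X \<equiv> rep (left_trans L P N X)"

lemma can_T:
  assumes b: "pbal \<beta>"
  shows "(\<ointegral>p q\<in>T X. \<ointegral>V p0\<in>C p. \<beta> V (p0 \<cdot>\<^sub>P q)) = \<beta> X (unt P)"
proof -
  have im: "dcls L (blact P) (frag_of (X, unt P)) \<in> left_can L P ` carrier (tens_N P N)"
    using can_bij unfolding bij_betw_def carrier_diamond by blast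
  have car: "left_trans L P N X \<in> carrier (tens_N P N)"
    unfolding left_trans_def using im by (rule inv_into_into)
  have "ncls P N (T X) = left_trans L P N X"
    using car unfolding tens_N_def ncls_def by (rule tcls_rep)
  then have "dcls L (blact P) (canf (prd P) (T X)) = left_can L P (left_trans L P N X)"
    by (simp flip: left_can_ncls)
  also have "\<dots> = dcls L (blact P) (frag_of (X, unt P))"
    unfolding left_trans_def by (rule f_inv_into_f[OF im])
  finally have "(\<ointegral>V r\<in>canf (prd P) (T X). \<beta> V r) = (\<ointegral>V r\<in>frag_of (X, unt P). \<beta> V r)"
    by (rule dcls_eqD[OF _ b])
  then show ?thesis unfolding sw_canf by simp
qed

lemma can_T_mult:
  assumes b: "pbal \<beta>"
  shows "(\<ointegral>p q\<in>T X. \<ointegral>V p0\<in>C p. \<beta> V (p0 \<cdot>\<^sub>P (q \<cdot>\<^sub>P r))) = \<beta> X r"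
proof -
  note bs = balD(1,2)[OF b] balD(3)[OF b UNIV_I]
  have "pbal (\<lambda>V p. \<beta> V (p \<cdot>\<^sub>P r))" by standard (simp_all add: bs)
  from can_T[OF this, of X] show ?thesis by simp
qed

text \<open>
  The identity \<open>p\<^sub>-\<^sub>1\<^sup><\<^sup>1\<^sup>> \<otimes> p\<^sub>-\<^sub>1\<^sup><\<^sup>2\<^sup>>p\<^sub>0 = p \<otimes> 1\<close>: both sides have the image \<open>p\<^sub>-\<^sub>1 \<otimes> p\<^sub>0\<close> under the
  canonical map.
\<close>

lemma T_coact:
  assumes g: "nbal \<gamma>"
  shows "(\<ointegral>V p0\<in>C p. \<ointegral>p' q'\<in>T V. \<gamma> p' (q' \<cdot>\<^sub>P p0)) = \<gamma> p (unt P)"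
proof -
  \<comment> \<open>the formal sum \<open>p\<^sub>-\<^sub>1\<^sup><\<^sup>1\<^sup>> \<otimes> p\<^sub>-\<^sub>1\<^sup><\<^sup>2\<^sup>>p\<^sub>0\<close>\<close>
  let ?x = "frag_extend (\<lambda>(V, p0). fmap2 id (\<lambda>q'. q' \<cdot>\<^sub>P p0) (T V)) (C p)"
  have "(\<ointegral>p q\<in>?x. \<gamma> p q) = (\<ointegral>p q\<in>frag_of (p, unt P). \<gamma> p q)"
    by (rule can_inj[OF _ g], unfold sw_extend) (simp add: can_T_mult)
  then show ?thesis unfolding sw_extend by simp
qed

lemma T_add:
  assumes g: "nbal \<gamma>"
  shows "(\<ointegral>p q\<in>T (X + Y). \<gamma> p q) = (\<ointegral>p q\<in>T X. \<gamma> p q) + (\<ointegral>p q\<in>T Y. \<gamma> p q)"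
  unfolding sw_add[symmetric] by (rule can_inj[OF _ g]) (simp add: sw_add can_T balD(1))

lemma T_left_t:
  assumes g: "nbal \<gamma>"
  shows "(\<ointegral>p q\<in>T (t b \<cdot>\<^sub>L X). \<gamma> p q) = (\<ointegral>p q\<in>T X. \<gamma> p (q \<cdot>\<^sub>P e b))"
proof -
  have "(\<ointegral>p q\<in>T (t b \<cdot>\<^sub>L X). \<gamma> p q) = (\<ointegral>p q\<in>fmap2 id (\<lambda>q. q \<cdot>\<^sub>P e b) (T X). \<gamma> p q)"
  proof (rule can_inj[OF _ g])
    fix \<beta> :: "'l \<Rightarrow> 'p \<Rightarrow> ('l \<times> 'p \<Rightarrow>\<^sub>0 int) quo"
    assume b: "pbal \<beta>"
    show "(\<ointegral>p q\<in>T (t b \<cdot>\<^sub>L X). \<ointegral>V p0\<in>C p. \<beta> V (p0 \<cdot>\<^sub>P q)) =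
      (\<ointegral>p q\<in>fmap2 id (\<lambda>q. q \<cdot>\<^sub>P e b) (T X). \<ointegral>V p0\<in>C p. \<beta> V (p0 \<cdot>\<^sub>P q))"
      using balD(3)[OF b UNIV_I, of b X "unt P"] by (simp add: can_T[OF b] can_T_mult[OF b])
  qed
  then show ?thesis by simp
qed

text \<open>
  Conditions on \<open>\<Psi>(p, Y, Z, q, r)\<close> under which the expression
  \<open>\<Psi>(X\<^sub>1\<^sup><\<^sup>1\<^sup>>, X\<^sub>1\<^sup><\<^sup>2\<^sup>>\<^sub>-\<^sub>1, X\<^sub>2, X\<^sub>1\<^sup><\<^sup>2\<^sup>>\<^sub>0, r)\<close> is defined on \<open>\<L> \<diamond> P\<close>.  Inverses
  of canonical maps have this shape.
\<close>

definition entwined :: "('p \<Rightarrow> 'l \<Rightarrow> 'l \<Rightarrow> 'p \<Rightarrow> 'p \<Rightarrow> 'g::ab_group_add) \<Rightarrow> bool" where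
  "entwined \<Psi> \<longleftrightarrow>
     (\<forall>p p' Y Z q r. \<Psi> (p + p') Y Z q r = \<Psi> p Y Z q r + \<Psi> p' Y Z q r) \<and>
     (\<forall>p Y Y' Z q r. \<Psi> p (Y + Y') Z q r = \<Psi> p Y Z q r + \<Psi> p Y' Z q r) \<and>
     (\<forall>p Y Z Z' q r. \<Psi> p Y (Z + Z') q r = \<Psi> p Y Z q r + \<Psi> p Y Z' q r) \<and>
     (\<forall>p Y Z q q' r. \<Psi> p Y Z (q + q') r = \<Psi> p Y Z q r + \<Psi> p Y Z q' r) \<and>
     (\<forall>p Y Z q r r'. \<Psi> p Y Z q (r + r') = \<Psi> p Y Z q r + \<Psi> p Y Z q r') \<and>
     (\<forall>n\<in>N. \<forall>p Y Z q r. \<Psi> (p \<cdot>\<^sub>P n) Y Z q r = \<Psi> p Y Z (n \<cdot>\<^sub>P q) r) \<and>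
     (\<forall>b p Y Z q r. \<Psi> p (t b \<cdot>\<^sub>L Y) Z q r = \<Psi> p Y Z (e b \<cdot>\<^sub>P q) r) \<and>
     (\<forall>b p Y Z q r. \<Psi> p (Y \<cdot>\<^sub>L s b) Z q r = \<Psi> p Y (s b \<cdot>\<^sub>L Z) q r) \<and>
     (\<forall>b p Y Z q r. \<Psi> p (Y \<cdot>\<^sub>L t b) Z q r = \<Psi> p Y (t b \<cdot>\<^sub>L Z) q r) \<and>
     (\<forall>b p Y Z q r. \<Psi> p Y Z (q \<cdot>\<^sub>P e b) r = \<Psi> p Y Z q (e b \<cdot>\<^sub>P r))"

context
  fixes \<Psi> :: "'p \<Rightarrow> 'l \<Rightarrow> 'l \<Rightarrow> 'p \<Rightarrow> 'p \<Rightarrow> 'g::ab_group_add"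
  assumes ent: "entwined \<Psi>"
begin

lemma ent_simps:
  "\<Psi> (p + p') Y Z q r = \<Psi> p Y Z q r + \<Psi> p' Y Z q r" "\<Psi> p (Y + Y') Z q r = \<Psi> p Y Z q r + \<Psi> p Y' Z q r"
  "\<Psi> p Y (Z + Z') q r = \<Psi> p Y Z q r + \<Psi> p Y Z' q r" "\<Psi> p Y Z (q + q') r = \<Psi> p Y Z q r + \<Psi> p Y Z q' r"
  "\<Psi> p Y Z q (r + r') = \<Psi> p Y Z q r + \<Psi> p Y Z q r'"
  "n \<in> N \<Longrightarrow> \<Psi> (p \<cdot>\<^sub>P n) Y Z q r = \<Psi> p Y Z (n \<cdot>\<^sub>P q) r" "\<Psi> p (t b \<cdot>\<^sub>L Y) Z q r = \<Psi> p Y Z (e b \<cdot>\<^sub>P q) r"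
  "\<Psi> p (Y \<cdot>\<^sub>L s b) Z q r = \<Psi> p Y (s b \<cdot>\<^sub>L Z) q r" "\<Psi> p (Y \<cdot>\<^sub>L t b) Z q r = \<Psi> p Y (t b \<cdot>\<^sub>L Z) q r"
  "\<Psi> p Y Z (q \<cdot>\<^sub>P e b) r = \<Psi> p Y Z q (e b \<cdot>\<^sub>P r)"
  using ent unfolding entwined_def by simp_all

lemma ent_dbal: "pbal (\<lambda>Y q0. \<Psi> p Y Z q0 r)"
  by standard (simp_all add: ent_simps)

lemma ent_nbal: "nbal (\<lambda>p q. \<ointegral>Y q0\<in>C q. \<Psi> p Y Z q0 r)"
  by standard (simp_all add: ent_simps sw_plus C_add[OF ent_dbal] C_left_N[OF ent_dbal])

lemma ent_Z: "(\<ointegral>Y q0\<in>C q. \<Psi> p Y (t b \<cdot>\<^sub>L Z) q0 r) = (\<ointegral>Y q0\<in>C q. \<Psi> p Y Z q0 (e b \<cdot>\<^sub>P r))"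
  using C_tak[OF ent_dbal, where p = q and a = b] by (simp add: ent_simps)

lemma ent_test1: "lbal (\<lambda>X1 X2. \<ointegral>p q\<in>T X1. \<ointegral>Y q0\<in>C q. \<Psi> p Y X2 q0 r)"
  by standard (simp_all add: T_add[OF ent_nbal] T_left_t[OF ent_nbal] ent_simps sw_plus C_right[OF ent_dbal])

definition ent_ext where
  "ent_ext X r = (\<ointegral>X1 X2\<in>D X. \<ointegral>p q\<in>T X1. \<ointegral>Y q0\<in>C q. \<Psi> p Y X2 q0 r)"

lemma ent_ext_dbal: "pbal ent_ext"
  unfolding ent_ext_def
  by standard (simp_all add: D_add[OF ent_test1] D_left_t[OF ent_test1] ent_Z ent_simps sw_plus)

text \<open>
  Coassociativity replaces \<open>p\<^sub>-\<^sub>2 \<otimes> p\<^sub>-\<^sub>1\<close> by the coaction of \<open>p\<^sub>0\<close>, which brings \<open>\<Psi>\<close> into a form where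
  \<open>T_coact\<close> applies to \<open>p\<^sub>-\<^sub>1\<^sup><\<^sup>2\<^sup>>p\<^sub>0\<close>.
\<close>

lemma ent_ext_coact:
  "(\<ointegral>X p0\<in>C p. ent_ext X p0) =
    (\<ointegral>X p0\<in>C p. \<ointegral>p' q'\<in>T X. \<ointegral>Z r\<in>C p0. \<ointegral>Y q0\<in>C q'. \<Psi> p' Y Z q0 r)"
proof -
  have "tri (\<lambda>X1 X2 p0. \<ointegral>p' q'\<in>T X1. \<ointegral>Y q0\<in>C q'. \<Psi> p' Y X2 q0 p0)"
    unfolding tri_bal_def triadd_def
    by (simp add: T_add[OF ent_nbal] T_left_t[OF ent_nbal] ent_simps sw_plus C_right[OF ent_dbal] ent_Z)
  from coassoc[OF this, of p] show ?thesis
    unfolding ent_ext_def sw_swap[of "T _" "C _"] by simp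
qed

end

text \<open>
  The test functions on \<open>P \<otimes>\<^sub>N (\<L> \<diamond> P)\<close>.
\<close>

definition ptest :: "('p \<Rightarrow> 'l \<Rightarrow> 'p \<Rightarrow> 'g::ab_group_add) \<Rightarrow> bool" where
  "ptest F \<longleftrightarrow> triadd F \<and> (\<forall>n\<in>N. \<forall>p Z q. F (p \<cdot>\<^sub>P n) Z q = F p Z (n \<cdot>\<^sub>P q)) \<and>
     (\<forall>b p Z q. F p (t b \<cdot>\<^sub>L Z) q = F p Z (e b \<cdot>\<^sub>P q))"

lemma ptestD:
  assumes "ptest F"
  shows "F (p + p') Z q = F p Z q + F p' Z q" "F p (Z + Z') q = F p Z q + F p Z' q"
    "F p Z (q + q') = F p Z q + F p Z q'" "n \<in> N \<Longrightarrow> F (p \<cdot>\<^sub>P n) Z q = F p Z (n \<cdot>\<^sub>P q)"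
    "F p (t b \<cdot>\<^sub>L Z) q = F p Z (e b \<cdot>\<^sub>P q)"
  using assms unfolding ptest_def triadd_def by simp_all

text \<open>
  In Sweedler notation, \<open>X\<^sub>1\<^sup><\<^sup>1\<^sup>> \<otimes> X\<^sub>1\<^sup><\<^sup>2\<^sup>>\<^sub>-\<^sub>1X\<^sub>2 \<otimes> X\<^sub>1\<^sup><\<^sup>2\<^sup>>\<^sub>0 = X\<^sup><\<^sup>1\<^sup>> \<otimes> 1 \<otimes> X\<^sup><\<^sup>2\<^sup>>\<close>.
  The left-hand side extends to a function of \<open>X \<otimes> r\<close>, so \<open>X \<otimes> 1\<close> may be replaced by
  \<open>p\<^sub>-\<^sub>1 \<otimes> p\<^sub>0 q\<close> with \<open>p \<otimes> q\<close> the translation of \<open>X\<close>.  Then \<open>p\<^sub>-\<^sub>2\<^sup><\<^sup>2\<^sup>>\<^sub>-\<^sub>1p\<^sub>-\<^sub>1 \<otimes> p\<^sub>-\<^sub>2\<^sup><\<^sup>2\<^sup>>\<^sub>0p\<^sub>0\<close>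
  is the coaction of \<open>p\<^sub>-\<^sub>1\<^sup><\<^sup>2\<^sup>>p\<^sub>0\<close>, and \<open>T_coact\<close> applies.
\<close>

lemma T_cancel:
  assumes F: "ptest F"
  shows "(\<ointegral>X1 X2\<in>D X. \<ointegral>p q\<in>T X1. \<ointegral>Y q0\<in>C q. F p (Y \<cdot>\<^sub>L X2) q0) = (\<ointegral>p q\<in>T X. F p (unt L) q)"
proof -
  note F' = ptestD[OF F]
  let ?\<Psi> = "\<lambda>p Y Z q r. F p (Y \<cdot>\<^sub>L Z) (q \<cdot>\<^sub>P r)"
  have ent: "entwined ?\<Psi>" unfolding entwined_def by (simp add: F')
  have ent': "entwined (\<lambda>p Y Z q0 r. F p (Y \<cdot>\<^sub>L Z) (q0 \<cdot>\<^sub>P (r \<cdot>\<^sub>P q)))" for q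
    unfolding entwined_def by (simp add: F')
  have "(\<ointegral>X1 X2\<in>D X. \<ointegral>p q\<in>T X1. \<ointegral>Y q0\<in>C q. F p (Y \<cdot>\<^sub>L X2) q0) = ent_ext ?\<Psi> X (unt P)"
    unfolding ent_ext_def[OF ent] by simp
  also have "\<dots> = (\<ointegral>p q\<in>T X. \<ointegral>V p0\<in>C p. ent_ext ?\<Psi> V (p0 \<cdot>\<^sub>P q))"
    by (rule can_T[OF ent_ext_dbal[OF ent], symmetric])
  also have "\<dots> = (\<ointegral>p q\<in>T X. F p (unt L) q)"
  proof -
    have "(\<ointegral>V p0\<in>C p. ent_ext ?\<Psi> V (p0 \<cdot>\<^sub>P q)) = F p (unt L) q" for p q
    proof -
      have d: "pbal (\<lambda>W w. F p' W (w \<cdot>\<^sub>P q))" for p' by standard (simp_all add: F')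
      have nb: "nbal (\<lambda>p' r. \<ointegral>W w\<in>C r. F p' W (w \<cdot>\<^sub>P q))"
        by standard (simp_all add: F' sw_plus C_add[OF d] C_left_N[OF d])
      have "(\<ointegral>V p0\<in>C p. ent_ext ?\<Psi> V (p0 \<cdot>\<^sub>P q)) =
          (\<ointegral>V p0\<in>C p. \<ointegral>p' q'\<in>T V. \<ointegral>Z r\<in>C p0. \<ointegral>Y q0\<in>C q'. F p' (Y \<cdot>\<^sub>L Z) (q0 \<cdot>\<^sub>P (r \<cdot>\<^sub>P q)))"
        using ent_ext_coact[OF ent', of p q] by (simp add: ent_ext_def[OF ent] ent_ext_def[OF ent'])
      also have "\<dots> = (\<ointegral>V p0\<in>C p. \<ointegral>p' q'\<in>T V. \<ointegral>W w\<in>C (q' \<cdot>\<^sub>P p0). F p' W (w \<cdot>\<^sub>P q))"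
      proof -
        have "(\<ointegral>Z r\<in>C p0. \<ointegral>Y q0\<in>C q'. F p' (Y \<cdot>\<^sub>L Z) (q0 \<cdot>\<^sub>P (r \<cdot>\<^sub>P q))) = (\<ointegral>W w\<in>C (q' \<cdot>\<^sub>P p0). F p' W (w \<cdot>\<^sub>P q))"
          for p' q' p0
          unfolding C_mult[OF d] by (subst sw_swap) simp
        then show ?thesis by (simp only:)
      qed
      also have "\<dots> = (\<ointegral>W w\<in>C (unt P). F p W (w \<cdot>\<^sub>P q))"
        by (rule T_coact[OF nb])
      also have "\<dots> = F p (unt L) q" unfolding C_one[OF d] by simp
      finally show ?thesis .
    qed
    then show ?thesis by simp
  qed
  finally show ?thesis .
qed

text \<open>
  In Sweedler notation, with \<open>p \<otimes> q\<close> the translation of \<open>X\<^sub>1\<close>: \<open>p\<^sub>-\<^sub>1 \<otimes> q\<^sub>-\<^sub>1X\<^sub>2 \<otimes> p\<^sub>0q\<^sub>0 = X \<otimes> 1 \<otimes> 1\<close>.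
  It follows from the preceding identity, after which only the canonical map of the translation of \<open>X\<close> remains.
\<close>

lemma T_coact_cancel:
  assumes add: "triadd \<Theta>" and bal: "\<And>b V Z w. \<Theta> (t b \<cdot>\<^sub>L V) Z w = \<Theta> V Z (e b \<cdot>\<^sub>P w)"
    "\<And>b V Z w. \<Theta> (V \<cdot>\<^sub>L t b) Z w = \<Theta> V (t b \<cdot>\<^sub>L Z) w"
  shows "(\<ointegral>X1 X2\<in>D X. \<ointegral>p q\<in>T X1. \<ointegral>Y q0\<in>C q. \<ointegral>V p0\<in>C p. \<Theta> V (Y \<cdot>\<^sub>L X2) (p0 \<cdot>\<^sub>P q0)) = \<Theta> X (unt L) (unt P)"
proof -
  have a: "\<Theta> (V + V') Z w = \<Theta> V Z w + \<Theta> V' Z w" "\<Theta> V (Z + Z') w = \<Theta> V Z w + \<Theta> V Z' w"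
    "\<Theta> V Z (w + w') = \<Theta> V Z w + \<Theta> V Z w'" for V V' Z Z' w w'
    using add unfolding triadd_def by simp_all
  have d: "pbal (\<lambda>V p0. \<Theta> V Z (p0 \<cdot>\<^sub>P q))" for Z q by standard (simp_all add: a bal)
  have "(\<ointegral>V p0\<in>C p. \<Theta> V (t b \<cdot>\<^sub>L Z) (p0 \<cdot>\<^sub>P q)) = (\<ointegral>V p0\<in>C p. \<Theta> V Z (p0 \<cdot>\<^sub>P (e b \<cdot>\<^sub>P q)))" for p b Z q
    using C_tak[OF d, of p b Z q] by (simp add: bal)
  then have "ptest (\<lambda>p Z q. \<ointegral>V p0\<in>C p. \<Theta> V Z (p0 \<cdot>\<^sub>P q))"
    unfolding ptest_def triadd_def by (simp add: a sw_plus C_add[OF d] C_right_N[OF d])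
  from T_cancel[OF this, of X] show ?thesis
    using can_T[of "\<lambda>V w. \<Theta> V (unt L) w" X] by (simp add: balI a bal)
qed

end


section \<open>The twisted canonical map\<close>

context cocycle
begin

text \<open>
  Rewriting has to reach products whose second factor is hidden by eta-contraction.
\<close>

lemma L_partial: "prd L (X + Y) = (\<lambda>Z. X \<cdot>\<^sub>L Z + Y \<cdot>\<^sub>L Z)" "prd L (X \<cdot>\<^sub>L Y) = (\<lambda>Z. X \<cdot>\<^sub>L (Y \<cdot>\<^sub>L Z))"
  by (intro ext, simp)+

text \<open>
  \<open>Y \<otimes> Z \<mapsto> \<Gamma>\<^sup>-\<^sup>1(Y\<^sub>1, Z) Y\<^sub>2\<close>, the twist of a single factor.
\<close>

definition utw where "utw Y Z = (\<ointegral>Y1 Y2\<in>D Y. s (\<Gamma>i Y1 Z) \<cdot>\<^sub>L Y2)"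

lemma utw_test: "lbal (\<lambda>Y1 Y2. s (\<Gamma>i Y1 Z) \<cdot>\<^sub>L Y2)"
  by standard simp_all

lemma utw_Be3: "Be3 (\<lambda>X Y Z. \<Gamma> X (utw Y Z))"
proof -
  have add: "utw (Y + Y') Z = utw Y Z + utw Y' Z" "utw Y (Z + Z') = utw Y Z + utw Y Z'" for Y Y' Z Z'
    unfolding utw_def D_add[OF utw_test] by (simp_all add: sw_plus L_partial)
  have left: "utw (s b \<cdot>\<^sub>L Y) Z = s b \<cdot>\<^sub>L utw Y Z" "utw (t b \<cdot>\<^sub>L Y) Z = t b \<cdot>\<^sub>L utw Y Z" for b Y Z
    unfolding utw_def D_left_s[OF utw_test] D_left_t[OF utw_test] by (simp_all add: sw_left_L L_partial)
  have right: "utw (Y \<cdot>\<^sub>L s b) Z = utw Y (s b \<cdot>\<^sub>L Z)" "utw (Y \<cdot>\<^sub>L t b) Z = utw Y Z \<cdot>\<^sub>L t b"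
    "utw Y (t b \<cdot>\<^sub>L Z) = utw Y Z \<cdot>\<^sub>L s b" for b Y Z
    using D_tak[OF utw_test, of Y b Z]
    unfolding utw_def D_right_s[OF utw_test] D_right_t[OF utw_test] by (simp_all add: sw_right_L L_partial)
  show ?thesis unfolding Be3_def by (simp add: add left right \<Gamma>_bal)
qed

text \<open>
  The form of the cocycle condition in which \<open>\<Gamma>\<close> and \<open>\<Gamma>\<^sup>-\<^sup>1\<close> occur together:
  \<open>\<Gamma>(X, \<Gamma>\<^sup>-\<^sup>1(Y\<^sub>1, Z)Y\<^sub>2) = \<Gamma>(X\<^sub>1, Y\<^sub>1Z\<^sub>1) \<Gamma>\<^sup>-\<^sup>1(X\<^sub>2Y\<^sub>2, Z\<^sub>2)\<close>.  Write \<open>YZ\<close> as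
  \<open>(\<Gamma>\<^sup>-\<^sup>1(Y\<^sub>1, Z\<^sub>1)Y\<^sub>2) \<bullet> Z\<^sub>2\<close> in \<open>\<Gamma>(X, YZ)\<close> and apply the cocycle condition; the result is the convolution
  of the left-hand side with \<open>\<Gamma>(XY, Z)\<close>, whose inverse is \<open>\<Gamma>\<^sup>-\<^sup>1(XY, Z)\<close>.
\<close>

lemma \<Gamma>_utw: "\<Gamma> X (utw Y Z) = conv3 (\<lambda>X Y Z. \<Gamma> X (Y \<cdot>\<^sub>L Z)) (\<lambda>X Y Z. \<Gamma>i (X \<cdot>\<^sub>L Y) Z) X Y Z"
proof -
  let ?A = "\<lambda>X Y Z. \<Gamma> X (utw Y Z)" and ?G = "\<lambda>X Y Z. \<Gamma> (X \<cdot>\<^sub>L Y) Z" and ?Gi = "\<lambda>X Y Z. \<Gamma>i (X \<cdot>\<^sub>L Y) Z"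
  have mid: "\<Gamma> (X \<cdot>\<^sub>L (Y \<cdot>\<^sub>L s b)) Z = \<Gamma> (X \<cdot>\<^sub>L Y) (s b \<cdot>\<^sub>L Z)" "\<Gamma> (X \<cdot>\<^sub>L (Y \<cdot>\<^sub>L t b)) Z = \<Gamma> (X \<cdot>\<^sub>L Y) (t b \<cdot>\<^sub>L Z)"
    "\<Gamma>i (X \<cdot>\<^sub>L (Y \<cdot>\<^sub>L s b)) Z = \<Gamma>i (X \<cdot>\<^sub>L Y) (s b \<cdot>\<^sub>L Z)" "\<Gamma>i (X \<cdot>\<^sub>L (Y \<cdot>\<^sub>L t b)) Z = \<Gamma>i (X \<cdot>\<^sub>L Y) (t b \<cdot>\<^sub>L Z)" for X Y Z b
    by (simp_all flip: L_simps(1) \<Gamma>_simps(5,6) \<Gamma>i_simps(5,6))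
  have Be: "Be3 ?G" "Be3 ?Gi" unfolding Be3_def by (simp_all add: mid)
  have "conv3 ?A ?G X Y Z = \<Gamma> X (Y \<cdot>\<^sub>L Z)" for X Y Z
  proof -
    have tak: "(\<ointegral>X1 X2\<in>D X. \<Gamma> X1 (t b \<cdot>\<^sub>L W) \<cdot>\<^sub>B \<Gamma> (X2 \<cdot>\<^sub>L Y) Z) = (\<ointegral>X1 X2\<in>D X. \<Gamma> X1 W \<cdot>\<^sub>B \<Gamma> (X2 \<cdot>\<^sub>L (s b \<cdot>\<^sub>L Y)) Z)"
      for b W Y Z
    proof -
      have "lbal (\<lambda>X1 X2. \<Gamma> X1 W \<cdot>\<^sub>B \<Gamma> (X2 \<cdot>\<^sub>L Y) Z)" by standard simp_all
      from D_tak[OF this, of X b] show ?thesis by simp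
    qed
    have tri: "tri_bal (\<lambda>b X. t b \<cdot>\<^sub>L X) (\<lambda>b X. s b \<cdot>\<^sub>L X) (\<lambda>b X. s b \<cdot>\<^sub>L X)
      (\<lambda>Y1 Y2 Y3. \<ointegral>Z1 Z2\<in>D Z. \<ointegral>X1 X2\<in>D X. \<Gamma> X1 (s (\<Gamma>i Y1 Z1) \<cdot>\<^sub>L Y2) \<cdot>\<^sub>B \<Gamma> (X2 \<cdot>\<^sub>L Y3) Z2)"
      unfolding tri_bal_def triadd_def by (simp add: sw_plus tak)
    have V: "\<Gamma> (X \<bullet> (s c \<cdot>\<^sub>L Y)) Z = (\<ointegral>Y1 Y2\<in>D Y. \<ointegral>X1 X2\<in>D X. \<Gamma> X1 (s c \<cdot>\<^sub>L Y1) \<cdot>\<^sub>B \<Gamma> (X2 \<cdot>\<^sub>L Y2) Z)" for c Y Z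
      unfolding self.tw_swap D_left_s[OF self.tw_test_right] sw_\<Gamma> \<Gamma>_simps ..
    have "\<Gamma> X (Y \<cdot>\<^sub>L Z) = (\<ointegral>Y1 Y2\<in>D Y. \<ointegral>Z1 Z2\<in>D Z. \<Gamma> (X \<bullet> (s (\<Gamma>i Y1 Z1) \<cdot>\<^sub>L Y2)) Z2)"
      unfolding self.untwist[of Y Z, symmetric] sw_\<Gamma> self.tw_emb[symmetric] cocycle_eq ..
    also have "\<dots> = (\<ointegral>Y1 Y'\<in>D Y. \<ointegral>Y2 Y3\<in>D Y'. \<ointegral>Z1 Z2\<in>D Z. \<ointegral>X1 X2\<in>D X. \<Gamma> X1 (s (\<Gamma>i Y1 Z1) \<cdot>\<^sub>L Y2) \<cdot>\<^sub>B \<Gamma> (X2 \<cdot>\<^sub>L Y3) Z2)"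
      unfolding V sw_swap[of "D Z"] ..
    also have "\<dots> = (\<ointegral>Y' Y3\<in>D Y. \<ointegral>Y1 Y2\<in>D Y'. \<ointegral>Z1 Z2\<in>D Z. \<ointegral>X1 X2\<in>D X. \<Gamma> X1 (s (\<Gamma>i Y1 Z1) \<cdot>\<^sub>L Y2) \<cdot>\<^sub>B \<Gamma> (X2 \<cdot>\<^sub>L Y3) Z2)"
      by (rule self.coassoc[OF tri, symmetric])
    also have "\<dots> = (\<ointegral>Y' Y3\<in>D Y. \<ointegral>Z1 Z2\<in>D Z. \<ointegral>X1 X2\<in>D X. \<ointegral>Y1 Y2\<in>D Y'. \<Gamma> X1 (s (\<Gamma>i Y1 Z1) \<cdot>\<^sub>L Y2) \<cdot>\<^sub>B \<Gamma> (X2 \<cdot>\<^sub>L Y3) Z2)"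
    proof -
      have "(\<ointegral>Y1 Y2\<in>D Y'. \<ointegral>Z1 Z2\<in>D Z. \<ointegral>X1 X2\<in>D X. \<Gamma> X1 (s (\<Gamma>i Y1 Z1) \<cdot>\<^sub>L Y2) \<cdot>\<^sub>B \<Gamma> (X2 \<cdot>\<^sub>L Y3) Z2) =
        (\<ointegral>Z1 Z2\<in>D Z. \<ointegral>X1 X2\<in>D X. \<ointegral>Y1 Y2\<in>D Y'. \<Gamma> X1 (s (\<Gamma>i Y1 Z1) \<cdot>\<^sub>L Y2) \<cdot>\<^sub>B \<Gamma> (X2 \<cdot>\<^sub>L Y3) Z2)" for Y' Y3
        by (subst sw_swap, subst (2) sw_swap) (rule refl)
      then show ?thesis by (simp only:)
    qed
    also have "\<dots> = conv3 ?A ?G X Y Z"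
      unfolding conv3_def utw_def sw_\<Gamma> sw_right_B sw_swap[of "D X"] ..
    finally show ?thesis by simp
  qed
  then have A: "conv3 ?A ?G = (\<lambda>X Y Z. \<Gamma> X (Y \<cdot>\<^sub>L Z))" by (intro ext)
  have "conv3 ?G ?Gi X Y Z = \<epsilon> (X \<cdot>\<^sub>L (Y \<cdot>\<^sub>L Z))" for X Y Z
  proof -
    have "lbal (\<lambda>V W. \<ointegral>Z1 Z2\<in>D Z. \<Gamma> V Z1 \<cdot>\<^sub>B \<Gamma>i W Z2)"
      by standard (simp_all add: sw_plus)
    from D_mult[OF this, of X Y] show ?thesis
      unfolding conv3_def using \<Gamma>_\<Gamma>i[of "X \<cdot>\<^sub>L Y" Z] by simp
  qed
  then have E: "conv3 ?G ?Gi = (\<lambda>X Y Z. \<epsilon> (X \<cdot>\<^sub>L (Y \<cdot>\<^sub>L Z)))" by (intro ext)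
  have "\<Gamma> X (utw Y Z) = conv3 ?A (conv3 ?G ?Gi) X Y Z"
    unfolding E by (rule conv3_unit_right[OF utw_Be3, symmetric])
  also have "\<dots> = conv3 (conv3 ?A ?G) ?Gi X Y Z"
    by (rule conv3_assoc[OF utw_Be3 Be, symmetric])
  finally show ?thesis unfolding A .
qed

end

context cocycle_comodalg
begin

lemma P_partial: "prd P (p + q) = (\<lambda>r. p \<cdot>\<^sub>P r + q \<cdot>\<^sub>P r)" "prd P (p \<cdot>\<^sub>P q) = (\<lambda>r. p \<cdot>\<^sub>P (q \<cdot>\<^sub>P r))"
  by (intro ext, simp)+

text \<open>
  What \<open>\<Gamma>\<^sup>-\<^sup>1(-, Z)\<close> does to an element of \<open>P\<close> through its coaction.
\<close>

definition \<rho> where "\<rho> Z w = (\<ointegral>W w0\<in>C w. e (\<Gamma>i W Z) \<cdot>\<^sub>P w0)"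

lemma \<rho>_test: "pbal (\<lambda>W w. e (\<Gamma>i W Z) \<cdot>\<^sub>P w)"
  by standard simp_all

lemma \<rho>_simps: "\<rho> (Z + Z') w = \<rho> Z w + \<rho> Z' w" "\<rho> Z (w + w') = \<rho> Z w + \<rho> Z w'"
  "\<rho> Z (e b \<cdot>\<^sub>P w) = e b \<cdot>\<^sub>P \<rho> Z w" "\<rho> (s b \<cdot>\<^sub>L Z) w = \<rho> Z (w \<cdot>\<^sub>P e b)" "\<rho> Z (unt P) = e (\<epsilon> Z)"
  unfolding \<rho>_def C_add[OF \<rho>_test] C_left[OF \<rho>_test] C_right[OF \<rho>_test] C_one[OF \<rho>_test]
  by (simp_all add: sw_plus sw_left_P P_partial)

text \<open>
  The second argument of the twisted product is the second leg of the inverse canonical map.  After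
  \<open>\<Gamma>_utw\<close> the factor \<open>\<Gamma>\<^sup>-\<^sup>1\<close> has \<open>p\<^sub>-\<^sub>1q\<^sub>-\<^sub>1\<close> as its first argument, which is the coaction of \<open>p\<^sub>0q\<^sub>0\<close>; so
  it becomes a function of the product of \<open>p\<^sub>0\<close> and \<open>q\<^sub>0\<close>.
\<close>

lemma tw_cocycle_inverse:
  "(\<ointegral>Y q0\<in>C q. tw p (e (\<Gamma>i Y Z) \<cdot>\<^sub>P q0)) =
    (\<ointegral>Z1 Z2\<in>D Z. \<ointegral>V p0\<in>C p. \<ointegral>Y q0\<in>C q. e (\<Gamma> V (Y \<cdot>\<^sub>L Z1)) \<cdot>\<^sub>P \<rho> Z2 (p0 \<cdot>\<^sub>P q0))"
proof -
  have tak: "(\<ointegral>V p0\<in>C p. e (\<Gamma> V (t b \<cdot>\<^sub>L W)) \<cdot>\<^sub>P (p0 \<cdot>\<^sub>P q)) = (\<ointegral>V p0\<in>C p. e (\<Gamma> V W) \<cdot>\<^sub>P (p0 \<cdot>\<^sub>P (e b \<cdot>\<^sub>P q)))" for b W q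
  proof -
    have "pbal (\<lambda>V p0. e (\<Gamma> V W) \<cdot>\<^sub>P (p0 \<cdot>\<^sub>P q))" by standard simp_all
    from C_tak[OF this, of p b] show ?thesis by simp
  qed
  have "tri (\<lambda>Y1 Y2 q0. \<ointegral>V p0\<in>C p. e (\<Gamma> V (s (\<Gamma>i Y1 Z) \<cdot>\<^sub>L Y2)) \<cdot>\<^sub>P (p0 \<cdot>\<^sub>P q0))"
    unfolding tri_bal_def triadd_def by (simp add: sw_plus tak)
  note co = coassoc[OF this, of q]
  have "(\<ointegral>Y q0\<in>C q. tw p (e (\<Gamma>i Y Z) \<cdot>\<^sub>P q0)) =
      (\<ointegral>Y q0\<in>C q. \<ointegral>Y1 Y2\<in>D Y. \<ointegral>V p0\<in>C p. e (\<Gamma> V (s (\<Gamma>i Y1 Z) \<cdot>\<^sub>L Y2)) \<cdot>\<^sub>P (p0 \<cdot>\<^sub>P q0))"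
    unfolding tw_swap C_left[OF tw_test_right] by (rule co[symmetric])
  also have "\<dots> = (\<ointegral>Y q0\<in>C q. \<ointegral>V p0\<in>C p. e (\<Gamma> V (utw Y Z)) \<cdot>\<^sub>P (p0 \<cdot>\<^sub>P q0))"
    unfolding utw_def sw_\<Gamma> sw_e sw_right_P sw_swap[of "C p" "D _"] ..
  also have "\<dots> = (\<ointegral>V p0\<in>C p. \<ointegral>Y q0\<in>C q. e (\<Gamma> V (utw Y Z)) \<cdot>\<^sub>P (p0 \<cdot>\<^sub>P q0))"
    by (rule sw_swap)
  also have "\<dots> = (\<ointegral>V p0\<in>C p. \<ointegral>Y q0\<in>C q. \<ointegral>V1 V2\<in>D V. \<ointegral>Y1 Y2\<in>D Y.
      \<ointegral>Z1 Z2\<in>D Z. e (\<Gamma> V1 (Y1 \<cdot>\<^sub>L Z1) \<cdot>\<^sub>B \<Gamma>i (V2 \<cdot>\<^sub>L Y2) Z2) \<cdot>\<^sub>P (p0 \<cdot>\<^sub>P q0))"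
    unfolding \<Gamma>_utw conv3_def sw_e sw_right_P ..
  also have "\<dots> = (\<ointegral>V p0\<in>C p. \<ointegral>Y q0\<in>C q. \<ointegral>V2 p2\<in>C p0. \<ointegral>Y2 q2\<in>C q0.
      \<ointegral>Z1 Z2\<in>D Z. e (\<Gamma> V (Y \<cdot>\<^sub>L Z1) \<cdot>\<^sub>B \<Gamma>i (V2 \<cdot>\<^sub>L Y2) Z2) \<cdot>\<^sub>P (p2 \<cdot>\<^sub>P q2))"
    by (rule coassoc2) (simp_all add: sw_plus)
  also have "\<dots> = (\<ointegral>Z1 Z2\<in>D Z. \<ointegral>V p0\<in>C p. \<ointegral>Y q0\<in>C q. \<ointegral>V2 p2\<in>C p0. \<ointegral>Y2 q2\<in>C q0.
      e (\<Gamma> V (Y \<cdot>\<^sub>L Z1) \<cdot>\<^sub>B \<Gamma>i (V2 \<cdot>\<^sub>L Y2) Z2) \<cdot>\<^sub>P (p2 \<cdot>\<^sub>P q2))"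
    unfolding sw_swap[of "D Z"] ..
  also have "\<dots> = (\<ointegral>Z1 Z2\<in>D Z. \<ointegral>V p0\<in>C p. \<ointegral>Y q0\<in>C q. e (\<Gamma> V (Y \<cdot>\<^sub>L Z1)) \<cdot>\<^sub>P \<rho> Z2 (p0 \<cdot>\<^sub>P q0))"
    unfolding \<rho>_def C_mult[OF \<rho>_test] sw_left_P by simp
  finally show ?thesis .
qed

end

locale cocycle_galois = cocycle_comodalg B L \<Gamma> P + galois B L P N
  for B :: "('k::field, 'b::ab_group_add) alg" and L :: "('k, 'b, 'l::ab_group_add) bialgd"
    and \<Gamma> :: "'l \<Rightarrow> 'l \<Rightarrow> 'b" and P :: "('k, 'b, 'l, 'p::ab_group_add) comodalg" and N :: "'p set"
begin

lemma tw_N_left [simp]: "n \<in> N \<Longrightarrow> tw (n \<cdot>\<^sub>P p) q = n \<cdot>\<^sub>P tw p q"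
  unfolding tw_def C_left_N[OF tw_test_left] by (simp add: sw_left_P)

lemma tw_N_mid: "n \<in> N \<Longrightarrow> tw (p \<cdot>\<^sub>P n) q = tw p (n \<cdot>\<^sub>P q)"
  unfolding tw_swap[of p] C_left_N[OF tw_test_right]
  unfolding tw_def C_right_N[OF tw_test_left] by (simp add: sw_swap[of "C p"])

lemma tw_N [simp]: "n \<in> N \<Longrightarrow> tw n p = n \<cdot>\<^sub>P p" "n \<in> N \<Longrightarrow> tw p n = p \<cdot>\<^sub>P n"
  using tw_N_left[of n "unt P" p] tw_N_mid[of n p "unt P"] by simp_all

text \<open>
  The inverse of the twisted canonical map, tested against \<open>\<gamma>\<close>, is \<open>ent_ext\<close> of this function.
\<close>

definition \<Psi> where "\<Psi> \<gamma> p Y Z q r = \<gamma> p (tw (e (\<Gamma>i Y Z) \<cdot>\<^sub>P q) r)"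

text \<open>
  Applied to \<open>p\<^sub>-\<^sub>1 \<otimes> p\<^sub>0 \<cdot>\<^sub>\<Gamma> q\<close>, the inverse contains \<open>\<Gamma>\<^sup>-\<^sup>1\<close> next to a twisted product of the second leg of the
  translation with \<open>p\<^sub>0\<close>; \<open>untwist\<close> turns this into an untwisted product, and \<open>T_coact\<close> gives \<open>p \<otimes> q\<close>.
\<close>

lemma twisted_can_left_inverse:
  assumes g: "nbal \<gamma>"
  shows "pbal (ent_ext (\<Psi> \<gamma>))" "(\<ointegral>V p0\<in>C p. ent_ext (\<Psi> \<gamma>) V (tw p0 q)) = \<gamma> p q"
proof -
  note gs = balD[OF g]
  have ent: "entwined (\<Psi> \<gamma>)" unfolding entwined_def \<Psi>_def by (simp add: gs tw_mid)
  have ent': "entwined (\<lambda>p Y Z q0 r. \<Psi> \<gamma> p Y Z q0 (tw r q))"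
    unfolding entwined_def \<Psi>_def by (simp add: gs tw_mid)
  show "pbal (ent_ext (\<Psi> \<gamma>))" by (rule ent_ext_dbal[OF ent])
  have nb: "nbal (\<lambda>p' r. \<gamma> p' (tw r q))" by standard (simp_all add: gs)
  \<comment> \<open>\<open>untwist\<close>, multiplied from the right by \<open>q\<close> in the twisted algebra\<close>
  have U: "(\<ointegral>Z r\<in>C p0. \<ointegral>Y q0\<in>C q'. \<Psi> \<gamma> p' Y Z q0 (tw r q)) = \<gamma> p' (tw (q' \<cdot>\<^sub>P p0) q)" for p' q' p0
  proof -
    have "\<gamma> p' (tw (\<ointegral>Y q0\<in>C q'. \<ointegral>Z r\<in>C p0. e (\<Gamma>i Y Z) \<cdot>\<^sub>P tw q0 r) q)
        = (\<ointegral>Y q0\<in>C q'. \<gamma> p' (tw (\<ointegral>Z r\<in>C p0. e (\<Gamma>i Y Z) \<cdot>\<^sub>P tw q0 r) q))"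
      by (rule sw_hom[of "\<lambda>z. \<gamma> p' (tw z q)"]) (simp add: gs)
    also have "\<dots> = (\<ointegral>Y q0\<in>C q'. \<ointegral>Z r\<in>C p0. \<gamma> p' (tw (e (\<Gamma>i Y Z) \<cdot>\<^sub>P tw q0 r) q))"
      by (subst sw_hom[of "\<lambda>z. \<gamma> p' (tw z q)"]) (simp_all add: gs)
    finally show ?thesis unfolding untwist \<Psi>_def by (subst sw_swap) (simp add: tw_assoc)
  qed
  have "(\<ointegral>V p0\<in>C p. ent_ext (\<Psi> \<gamma>) V (tw p0 q)) = (\<ointegral>V p0\<in>C p. \<ointegral>p' q'\<in>T V. \<gamma> p' (tw (q' \<cdot>\<^sub>P p0) q))"
    using ent_ext_coact[OF ent', of p] by (simp add: ent_ext_def[OF ent] ent_ext_def[OF ent'] U)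
  also have "\<dots> = \<gamma> p q" using T_coact[OF nb, of p] by simp
  finally show "(\<ointegral>V p0\<in>C p. ent_ext (\<Psi> \<gamma>) V (tw p0 q)) = \<gamma> p q" .
qed

lemma twisted_can_test:
  assumes b: "pbal \<beta>"
  shows "nbal (\<lambda>p q. \<ointegral>V p0\<in>C p. \<beta> V (tw p0 q))"
proof -
  note bs = balD(1,2)[OF b] balD(3)[OF b UNIV_I]
  have b': "pbal (\<lambda>V p0. \<beta> V (tw p0 q))" for q by standard (simp_all add: bs)
  show ?thesis by standard (simp_all add: bs C_add[OF b'] C_right_N[OF b'] tw_N_mid sw_plus)
qed

text \<open>
  With \<open>p \<otimes> q\<close> the translation of \<open>X\<^sub>1\<close>, \<open>tw_cocycle_inverse\<close> brings the left-hand side into a form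
  \<open>\<Phi>(p\<^sub>-\<^sub>1, q\<^sub>-\<^sub>1X\<^sub>2, p\<^sub>0q\<^sub>0)\<close> with a further component \<open>X\<^sub>3\<close>.  By \<open>T_coact_cancel\<close> the arguments
  collapse to \<open>(X, 1, 1)\<close>, where \<open>\<Gamma>\<close> and \<open>\<Gamma>\<^sup>-\<^sup>1\<close> take values \<open>\<epsilon>\<close> by normalisation.
\<close>

lemma twisted_can_right_inverse:
  assumes b: "pbal \<beta>"
  shows "(\<ointegral>X1 X2\<in>D X. \<ointegral>p q\<in>T X1. \<ointegral>Y q0\<in>C q. \<ointegral>V p0\<in>C p. \<beta> V (tw p0 (e (\<Gamma>i Y X2) \<cdot>\<^sub>P q0))) = \<beta> X (unt P)"
proof -
  note bs = balD(1,2)[OF b] balD(3)[OF b UNIV_I]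
  have bsum: "\<beta> V (\<ointegral>x y\<in>c. F x y) = (\<ointegral>x y\<in>c. \<beta> V (F x y))" for V and c :: "'x \<times> 'y \<Rightarrow>\<^sub>0 int" and F
    by (rule sw_hom) (rule bs)
  define \<Phi> where "\<Phi> X3 V Z w = (\<ointegral>V1 V2\<in>D V. \<beta> V1 (e (\<Gamma> V2 Z) \<cdot>\<^sub>P \<rho> X3 w))" for X3 V Z w
  have Vt: "lbal (\<lambda>V1 V2. \<beta> V1 (e (\<Gamma> V2 Z) \<cdot>\<^sub>P w))" for Z w
    by standard (simp_all add: bs)
  have \<Phi>: "triadd (\<Phi> X3)" "\<Phi> X3 (t b \<cdot>\<^sub>L V) Z w = \<Phi> X3 V Z (e b \<cdot>\<^sub>P w)" "\<Phi> X3 (V \<cdot>\<^sub>L t b) Z w = \<Phi> X3 V (t b \<cdot>\<^sub>L Z) w"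
    "\<Phi> (X3 + X3') V Z w = \<Phi> X3 V Z w + \<Phi> X3' V Z w" "\<Phi> (s b \<cdot>\<^sub>L X3) V Z w = \<Phi> X3 V Z (w \<cdot>\<^sub>P e b)"
    for X3 X3' b V Z w
    unfolding \<Phi>_def triadd_def
    by (simp_all add: D_add[OF Vt] D_left_t[OF Vt] D_right_t[OF Vt] bs sw_plus \<rho>_simps)
  have \<Phi>a: "\<Phi> X3 (V + V') Z w = \<Phi> X3 V Z w + \<Phi> X3 V' Z w" "\<Phi> X3 V (Z + Z') w = \<Phi> X3 V Z w + \<Phi> X3 V Z' w"
    "\<Phi> X3 V Z (w + w') = \<Phi> X3 V Z w + \<Phi> X3 V Z w'" for X3 V V' Z Z' w w'
    using \<Phi>(1) unfolding triadd_def by simp_all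
  have \<Phi>V: "pbal (\<lambda>V p0. \<Phi> X3 V Z (p0 \<cdot>\<^sub>P q0))" for X3 Z q0
    by standard (simp_all add: \<Phi>a \<Phi>)
  have \<Phi>Vt: "(\<ointegral>V p0\<in>C p. \<Phi> X3 V (t b \<cdot>\<^sub>L Z) (p0 \<cdot>\<^sub>P q0)) = (\<ointegral>V p0\<in>C p. \<Phi> X3 V Z (p0 \<cdot>\<^sub>P (e b \<cdot>\<^sub>P q0)))" for X3 b Z p q0
  proof -
    have "pbal (\<lambda>V p0. \<Phi> X3 V Z (p0 \<cdot>\<^sub>P q0))" by (rule \<Phi>V)
    from C_tak[OF this, of p b] show ?thesis by (simp add: \<Phi>)
  qed
  \<comment> \<open>the two coactions of \<open>p\<close> in the twisted canonical map are merged into one coproduct, which is part of \<open>\<Phi>\<close>\<close>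
  have step: "(\<ointegral>Y q0\<in>C q. \<ointegral>V p0\<in>C p. \<beta> V (tw p0 (e (\<Gamma>i Y Z) \<cdot>\<^sub>P q0))) =
      (\<ointegral>X2 X3\<in>D Z. \<ointegral>Y q0\<in>C q. \<ointegral>V p0\<in>C p. \<Phi> X3 V (Y \<cdot>\<^sub>L X2) (p0 \<cdot>\<^sub>P q0))" for p q Z
  proof -
    have "(\<ointegral>Y q0\<in>C q. \<ointegral>V p0\<in>C p. \<beta> V (tw p0 (e (\<Gamma>i Y Z) \<cdot>\<^sub>P q0))) =
      (\<ointegral>V p0\<in>C p. \<beta> V (\<ointegral>Y q0\<in>C q. tw p0 (e (\<Gamma>i Y Z) \<cdot>\<^sub>P q0)))"
      unfolding bsum by (rule sw_swap)
    also have "\<dots> = (\<ointegral>V p0\<in>C p. \<ointegral>X2 X3\<in>D Z. \<ointegral>V' p'\<in>C p0. \<ointegral>Y q0\<in>C q. \<beta> V (e (\<Gamma> V' (Y \<cdot>\<^sub>L X2)) \<cdot>\<^sub>P \<rho> X3 (p' \<cdot>\<^sub>P q0)))"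
      unfolding tw_cocycle_inverse bsum ..
    also have "\<dots> = (\<ointegral>X2 X3\<in>D Z. \<ointegral>Y q0\<in>C q. \<ointegral>V p0\<in>C p. \<ointegral>V' p'\<in>C p0. \<beta> V (e (\<Gamma> V' (Y \<cdot>\<^sub>L X2)) \<cdot>\<^sub>P \<rho> X3 (p' \<cdot>\<^sub>P q0)))"
    proof -
      have "(\<ointegral>V p0\<in>C p. \<ointegral>V' p'\<in>C p0. \<ointegral>Y q0\<in>C q. G V V' p' Y q0) = (\<ointegral>Y q0\<in>C q. \<ointegral>V p0\<in>C p. \<ointegral>V' p'\<in>C p0. G V V' p' Y q0)"
        for G :: "'l \<Rightarrow> 'l \<Rightarrow> 'p \<Rightarrow> 'l \<Rightarrow> 'p \<Rightarrow> 'a"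
        by (subst sw_swap[of "C q" "C p"], subst sw_swap[of "C q"]) (rule refl)
      then show ?thesis unfolding sw_swap[of "C p" "D Z"] by (simp only:)
    qed
    also have "\<dots> = (\<ointegral>X2 X3\<in>D Z. \<ointegral>Y q0\<in>C q. \<ointegral>V p0\<in>C p. \<Phi> X3 V (Y \<cdot>\<^sub>L X2) (p0 \<cdot>\<^sub>P q0))"
    proof -
      have "(\<ointegral>V p0\<in>C p. \<ointegral>V' p'\<in>C p0. \<beta> V (e (\<Gamma> V' W) \<cdot>\<^sub>P \<rho> X3 (p' \<cdot>\<^sub>P q0))) = (\<ointegral>V p0\<in>C p. \<Phi> X3 V W (p0 \<cdot>\<^sub>P q0))" for W X3 q0
      proof -
        have "tri (\<lambda>V1 V2 p'. \<beta> V1 (e (\<Gamma> V2 W) \<cdot>\<^sub>P \<rho> X3 (p' \<cdot>\<^sub>P q0)))"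
          unfolding tri_bal_def triadd_def by (simp add: bs \<rho>_simps)
        from coassoc[OF this, of p] show ?thesis unfolding \<Phi>_def by simp
      qed
      then show ?thesis by (simp only:)
    qed
    finally show ?thesis .
  qed
  have Yd: "pbal (\<lambda>Y q0. \<ointegral>V p0\<in>C p. \<Phi> X3 V (Y \<cdot>\<^sub>L X2) (p0 \<cdot>\<^sub>P q0))" for p X2 X3
    by standard (simp_all add: \<Phi>a sw_plus \<Phi>Vt)
  have nb: "nbal (\<lambda>p q. \<ointegral>Y q0\<in>C q. \<ointegral>V p0\<in>C p. \<Phi> X3 V (Y \<cdot>\<^sub>L X2) (p0 \<cdot>\<^sub>P q0))" for X2 X3
    by standard (simp_all add: \<Phi>a sw_plus C_add[OF Yd] C_add[OF \<Phi>V] C_left_N[OF Yd] C_right_N[OF \<Phi>V])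
  have Yt: "(\<ointegral>Y q0\<in>C q. \<ointegral>V p0\<in>C p. \<Phi> X3 V (Y \<cdot>\<^sub>L (t b \<cdot>\<^sub>L X2)) (p0 \<cdot>\<^sub>P q0)) =
      (\<ointegral>Y q0\<in>C q. \<ointegral>V p0\<in>C p. \<Phi> (s b \<cdot>\<^sub>L X3) V (Y \<cdot>\<^sub>L X2) (p0 \<cdot>\<^sub>P q0))" for p q b X2 X3
  proof -
    have "pbal (\<lambda>Y q0. \<ointegral>V p0\<in>C p. \<Phi> X3 V (Y \<cdot>\<^sub>L X2) (p0 \<cdot>\<^sub>P q0))" by (rule Yd)
    from C_tak[OF this, of q b] show ?thesis by (simp add: \<Phi>)
  qed
  \<comment> \<open>split off \<open>X\<^sub>3\<close>, so that the pair \<open>X\<^sub>1, X\<^sub>2\<close> comes from a single coproduct\<close>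
  have tri: "tri_bal (\<lambda>b X. t b \<cdot>\<^sub>L X) (\<lambda>b X. s b \<cdot>\<^sub>L X) (\<lambda>b X. s b \<cdot>\<^sub>L X)
     (\<lambda>X1 X2 X3. \<ointegral>p q\<in>T X1. \<ointegral>Y q0\<in>C q. \<ointegral>V p0\<in>C p. \<Phi> X3 V (Y \<cdot>\<^sub>L X2) (p0 \<cdot>\<^sub>P q0))"
    unfolding tri_bal_def triadd_def
    by (simp add: T_add[OF nb] T_left_t[OF nb] C_right[OF Yd] \<Phi>a \<Phi>(4) sw_plus Yt)
  have "(\<ointegral>X1 X2\<in>D X. \<ointegral>p q\<in>T X1. \<ointegral>Y q0\<in>C q. \<ointegral>V p0\<in>C p. \<beta> V (tw p0 (e (\<Gamma>i Y X2) \<cdot>\<^sub>P q0))) =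
    (\<ointegral>X1 Z\<in>D X. \<ointegral>X2 X3\<in>D Z. \<ointegral>p q\<in>T X1. \<ointegral>Y q0\<in>C q. \<ointegral>V p0\<in>C p. \<Phi> X3 V (Y \<cdot>\<^sub>L X2) (p0 \<cdot>\<^sub>P q0))"
    unfolding step sw_swap[of "T _" "D _"] ..
  also have "\<dots> = (\<ointegral>X' X3\<in>D X. \<ointegral>X1 X2\<in>D X'. \<ointegral>p q\<in>T X1. \<ointegral>Y q0\<in>C q. \<ointegral>V p0\<in>C p. \<Phi> X3 V (Y \<cdot>\<^sub>L X2) (p0 \<cdot>\<^sub>P q0))"
    by (rule self.coassoc[OF tri, symmetric])
  also have "\<dots> = (\<ointegral>X' X3\<in>D X. \<Phi> X3 X' (unt L) (unt P))"
    unfolding T_coact_cancel[OF \<Phi>(1,2,3)] ..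
  also have "\<dots> = (\<ointegral>X' X3\<in>D X. \<beta> X' (e (\<epsilon> X3)))"
  proof -
    have "\<Phi> X3 X' (unt L) (unt P) = \<beta> X' (e (\<epsilon> X3))" for X3 X'
    proof -
      have "\<Phi> X3 X' (unt L) (unt P) = (\<ointegral>V1 V2\<in>D X'. \<beta> (t (\<epsilon> V2) \<cdot>\<^sub>L V1) (e (\<epsilon> X3)))"
        unfolding \<Phi>_def by (simp add: \<rho>_simps bs)
      also have "\<dots> = \<beta> X' (e (\<epsilon> X3))" by (rule counit_t_hom) (rule bs)
      finally show ?thesis .
    qed
    then show ?thesis by (simp only:)
  qed
  also have "\<dots> = (\<ointegral>X' X3\<in>D X. \<beta> (t (\<epsilon> X3) \<cdot>\<^sub>L X') (unt P))" by (simp add: bs)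
  also have "\<dots> = \<beta> X (unt P)" by (rule counit_t_hom) (rule bs)
  finally show ?thesis .
qed

end


section \<open>Faithful flatness and the map \<open>\<lambda>\<close>\<close>

lemma one_tensor: "\<one>\<^bsub>tensor R M N\<^esub> = tcls R M N 0"
  by (auto simp: tensor_def tcls_def r_coset_def)

lemma keys_in_frag_extend:
  assumes "c \<in> carrier (free_Abelian_group S)" "\<And>x. x \<in> S \<Longrightarrow> f x \<in> carrier (free_Abelian_group S')"
  shows "frag_extend f c \<in> carrier (free_Abelian_group S')"
  using keys_frag_extend[of f c] assms by (fastforce simp: subset_iff)

text \<open>
  A monoid with an action, in the format of a module record.
\<close>

definition quot_mod :: "'x monoid \<Rightarrow> ('r \<Rightarrow> 'x \<Rightarrow> 'x) \<Rightarrow> ('r, 'x) module" where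
  "quot_mod G act = \<lparr>carrier = carrier G, monoid.mult = undefined, one = undefined, zero = one G, add = monoid.mult G,
     smult = act\<rparr>"

lemma quot_mod_simps [simp]:
  "carrier (quot_mod G act) = carrier G" "zero (quot_mod G act) = \<one>\<^bsub>G\<^esub>" "add (quot_mod G act) = monoid.mult G"
  "smult (quot_mod G act) = act"
  by (simp_all add: quot_mod_def)

text \<open>
  A tensor product over \<open>S\<close> as a right \<open>R\<close>-module, with scalars acting by \<open>f r \<otimes> g r\<close>.  The module laws
  are required only under balanced maps.
\<close>

locale tensor_module =
  fixes S :: "'s set" and am :: "'s \<Rightarrow> 'm::ab_group_add \<Rightarrow> 'm" and an :: "'s \<Rightarrow> 'n::ab_group_add \<Rightarrow> 'n"
    and R :: "'r ring" and f :: "'r \<Rightarrow> 'm \<Rightarrow> 'm" and g :: "'r \<Rightarrow> 'n \<Rightarrow> 'n"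
  assumes R: "ring R"
    and bal: "\<And>(\<beta> :: 'm \<Rightarrow> 'n \<Rightarrow> ('m \<times> 'n \<Rightarrow>\<^sub>0 int) quo) r. r \<in> carrier R \<Longrightarrow> bal S am an \<beta> \<Longrightarrow> bal S am an (\<lambda>m n. \<beta> (f r m) (g r n))"
    and mod: "\<And>(\<beta> :: 'm \<Rightarrow> 'n \<Rightarrow> ('m \<times> 'n \<Rightarrow>\<^sub>0 int) quo) r r' m n. bal S am an \<beta> \<Longrightarrow> r \<in> carrier R \<Longrightarrow> r' \<in> carrier R \<Longrightarrow>
      \<beta> (f (r \<oplus>\<^bsub>R\<^esub> r') m) (g (r \<oplus>\<^bsub>R\<^esub> r') n) = \<beta> (f r m) (g r n) + \<beta> (f r' m) (g r' n)"
      "\<And>(\<beta> :: 'm \<Rightarrow> 'n \<Rightarrow> ('m \<times> 'n \<Rightarrow>\<^sub>0 int) quo) r r' m n. bal S am an \<beta> \<Longrightarrow> r \<in> carrier R \<Longrightarrow> r' \<in> carrier R \<Longrightarrow>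
      \<beta> (f (r \<otimes>\<^bsub>R\<^esub> r') m) (g (r \<otimes>\<^bsub>R\<^esub> r') n) = \<beta> (f r' (f r m)) (g r' (g r n))"
      "\<And>(\<beta> :: 'm \<Rightarrow> 'n \<Rightarrow> ('m \<times> 'n \<Rightarrow>\<^sub>0 int) quo) m n. bal S am an \<beta> \<Longrightarrow> \<beta> (f \<one>\<^bsub>R\<^esub> m) (g \<one>\<^bsub>R\<^esub> n) = \<beta> m n"
begin

abbreviation cls where "cls \<equiv> tcls S (tmod am) (tmod an)"

definition V where
  "V = quot_mod (tensor S (tmod am) (tmod an)) (\<lambda>r c. cls (fmap2 (f r) (g r) (rep c)))"

lemma V_carrier: "carrier V = range cls"
  by (simp add: V_def carrier_tensor_tmod)

lemma V_add: "cls x \<oplus>\<^bsub>V\<^esub> cls y = cls (x + y)"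
  by (simp add: V_def tensor_tmod_mult)

lemma V_zero: "\<zero>\<^bsub>V\<^esub> = cls 0"
  by (simp add: V_def one_tensor)

lemma V_smult: "r \<in> carrier R \<Longrightarrow> r \<odot>\<^bsub>V\<^esub> cls x = cls (fmap2 (f r) (g r) x)"
proof -
  assume r: "r \<in> carrier R"
  show ?thesis
    unfolding V_def quot_mod_simps by (rule tcls_eqI) (simp add: sw_rep_tcls[OF bal[OF r]])
qed

lemma right_mod_V: "right_mod R V"
  unfolding right_mod_def
proof (intro conjI ballI)
  interpret R: ring R by (rule R)
  show "ring R" by (rule R)
  show "abelian_group V"
  proof (rule abelian_groupI)
    fix x assume "x \<in> carrier V"
    then obtain x' where x: "x = cls x'" by (auto simp: V_carrier)
    have "cls (- x') \<oplus>\<^bsub>V\<^esub> x = \<zero>\<^bsub>V\<^esub>" by (simp add: x V_add V_zero)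
    then show "\<exists>y\<in>carrier V. y \<oplus>\<^bsub>V\<^esub> x = \<zero>\<^bsub>V\<^esub>" by (auto simp: V_carrier)
  qed (auto simp: V_carrier V_add V_zero ac_simps)
  have V_obtain: "\<exists>x. v = cls x" if "v \<in> carrier V" for v
    using that by (auto simp: V_carrier)
  fix r v assume r: "r \<in> carrier R" and "v \<in> carrier V"
  then obtain x where v: "v = cls x" using V_obtain by blast
  show "r \<odot>\<^bsub>V\<^esub> v \<in> carrier V" using r by (simp add: v V_smult V_carrier)
  show "r \<odot>\<^bsub>V\<^esub> (v \<oplus>\<^bsub>V\<^esub> w) = (r \<odot>\<^bsub>V\<^esub> v) \<oplus>\<^bsub>V\<^esub> (r \<odot>\<^bsub>V\<^esub> w)" if "w \<in> carrier V" for w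
  proof -
    obtain y where w: "w = cls y" using V_obtain \<open>w \<in> carrier V\<close> by blast
    show ?thesis unfolding v w V_add V_smult[OF r] by (rule tcls_eqI) (simp add: sw_add)
  qed
  show "(r \<oplus>\<^bsub>R\<^esub> r') \<odot>\<^bsub>V\<^esub> v = (r \<odot>\<^bsub>V\<^esub> v) \<oplus>\<^bsub>V\<^esub> (r' \<odot>\<^bsub>V\<^esub> v)" if r': "r' \<in> carrier R" for r'
    unfolding v V_smult[OF r] V_smult[OF r'] V_smult[OF R.add.m_closed[OF r r']] V_add
    by (rule tcls_eqI) (simp add: sw_add sw_plus mod r r')
  show "(r \<otimes>\<^bsub>R\<^esub> r') \<odot>\<^bsub>V\<^esub> v = r' \<odot>\<^bsub>V\<^esub> (r \<odot>\<^bsub>V\<^esub> v)" if r': "r' \<in> carrier R" for r'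
    unfolding v V_smult[OF r] V_smult[OF r'] V_smult[OF R.m_closed[OF r r']]
    by (rule tcls_eqI) (simp add: mod r r')
next
  interpret R: ring R by (rule R)
  fix v assume "v \<in> carrier V"
  then obtain x where v: "v = cls x" by (auto simp: V_carrier)
  show "\<one>\<^bsub>R\<^esub> \<odot>\<^bsub>V\<^esub> v = v"
    unfolding v V_smult[OF R.one_closed] by (rule tcls_eqI) (simp add: mod)
qed


end

lemma keys_diff_subset:
  "Poly_Mapping.keys a \<subseteq> S \<Longrightarrow> Poly_Mapping.keys b \<subseteq> S \<Longrightarrow> Poly_Mapping.keys (a - b) \<subseteq> S"
  using keys_diff[of a b] by blast

lemma right_mod_ten_rels:
  assumes "right_mod R V"
  shows "ten_rels (carrier R) V (tmod act) \<subseteq> carrier (free_Abelian_group (carrier V \<times> carrier (tmod act)))"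
proof -
  interpret V: abelian_group V using assms unfolding right_mod_def by blast
  have sm: "r \<odot>\<^bsub>V\<^esub> v \<in> carrier V" if "r \<in> carrier R" "v \<in> carrier V" for r v
    using assms that unfolding right_mod_def by blast
  show ?thesis
    unfolding ten_rels_def tmod_simps
    by (intro Un_least subsetI; unfold mem_Collect_eq carrier_free_Abelian_group_iff; elim exE conjE; hypsubst)
       (intro keys_diff_subset; simp add: sm)+
qed

text \<open>
  Apply the definition to \<open>V \<rightarrow> W \<rightarrow> W\<close> with second map zero: exactness says that the first map is
  onto, and faithful flatness reflects it.
\<close>

lemma faithfully_flat_surj:
  fixes VM WM :: "('r, 'u) module" and act :: "'r \<Rightarrow> 'p::ab_group_add \<Rightarrow> 'p"
  assumes ff: "faithfully_flat TYPE('u) R (tmod act)"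
    and V: "right_mod R VM" and W: "right_mod R WM" and h: "h \<in> right_mod_hom R VM WM"
    and surj: "\<And>w. w \<in> carrier (free_Abelian_group (carrier WM \<times> UNIV)) \<Longrightarrow>
      \<exists>x \<in> carrier (free_Abelian_group (carrier VM \<times> UNIV)).
        tcls (carrier R) WM (tmod act) (fmap2 h id x) = tcls (carrier R) WM (tmod act) w"
  shows "h ` carrier VM = carrier WM"
proof -
  interpret WA: abelian_group WM using W unfolding right_mod_def by blast
  let ?TV = "tensor (carrier R) VM (tmod act)" and ?TW = "tensor (carrier R) WM (tmod act)"
  let ?g = "\<lambda>_. \<zero>\<^bsub>WM\<^esub>"
  have smW: "r \<odot>\<^bsub>WM\<^esub> \<zero>\<^bsub>WM\<^esub> = \<zero>\<^bsub>WM\<^esub>" if "r \<in> carrier R" for r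
  proof -
    have "r \<odot>\<^bsub>WM\<^esub> (\<zero>\<^bsub>WM\<^esub> \<oplus>\<^bsub>WM\<^esub> \<zero>\<^bsub>WM\<^esub>) = (r \<odot>\<^bsub>WM\<^esub> \<zero>\<^bsub>WM\<^esub>) \<oplus>\<^bsub>WM\<^esub> (r \<odot>\<^bsub>WM\<^esub> \<zero>\<^bsub>WM\<^esub>)" and "r \<odot>\<^bsub>WM\<^esub> \<zero>\<^bsub>WM\<^esub> \<in> carrier WM"
      using W that unfolding right_mod_def by blast+
    then show ?thesis by (simp add: WA.add.l_cancel_one')
  qed
  have g: "?g \<in> right_mod_hom R WM WM"
    unfolding right_mod_hom_def hom_def using smW by simp
  have hc: "v \<in> carrier VM \<Longrightarrow> h v \<in> carrier WM"
    for v
    using h unfolding right_mod_hom_def hom_def by auto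
  note relV = right_mod_ten_rels[OF V, of act] and relW = right_mod_ten_rels[OF W, of act]
  have ind: "tcls (carrier R) WM (tmod act) (fmap2 k id (rep (tcls (carrier R) UM (tmod act) x)))
      = tcls (carrier R) WM (tmod act) (fmap2 k id x)"
    if U: "right_mod R UM" and k: "k \<in> right_mod_hom R UM WM" for UM :: "('r, 'u) module" and k x
    unfolding tcls_eq_iff_kills[OF relW]
  proof (intro allI impI)
    fix \<phi> :: "'u \<times> 'p \<Rightarrow> ('u \<times> 'p \<Rightarrow>\<^sub>0 int) quo"
    assume \<phi>: "kills (ten_rels (carrier R) WM (tmod act)) \<phi>"
    have "kills (ten_rels (carrier R) UM (tmod act)) (\<lambda>(v, p). \<phi> (k v, p))"
    proof (rule kills_ten_relsI)
      have kc: "v \<in> carrier UM \<Longrightarrow> k v \<in> carrier WM"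
        and ka: "v \<in> carrier UM \<Longrightarrow> v' \<in> carrier UM \<Longrightarrow> k (v \<oplus>\<^bsub>UM\<^esub> v') = k v \<oplus>\<^bsub>WM\<^esub> k v'"
        and ks: "r \<in> carrier R \<Longrightarrow> v \<in> carrier UM \<Longrightarrow> k (r \<odot>\<^bsub>UM\<^esub> v) = r \<odot>\<^bsub>WM\<^esub> k v" for v v' r
        using k unfolding right_mod_hom_def hom_def by auto
      fix m m' n n' r
      assume m: "m \<in> carrier UM"
      show "m' \<in> carrier UM \<Longrightarrow> n \<in> carrier (tmod act) \<Longrightarrow> (case (m \<oplus>\<^bsub>UM\<^esub> m', n) of (v, p) \<Rightarrow> \<phi> (k v, p)) =
          (case (m, n) of (v, p) \<Rightarrow> \<phi> (k v, p)) + (case (m', n) of (v, p) \<Rightarrow> \<phi> (k v, p))"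
        using kills_ten_relsD(1)[OF \<phi>] m by (simp add: ka kc)
      show "n \<in> carrier (tmod act) \<Longrightarrow> n' \<in> carrier (tmod act) \<Longrightarrow> (case (m, n \<oplus>\<^bsub>tmod act\<^esub> n') of (v, p) \<Rightarrow> \<phi> (k v, p)) =
          (case (m, n) of (v, p) \<Rightarrow> \<phi> (k v, p)) + (case (m, n') of (v, p) \<Rightarrow> \<phi> (k v, p))"
        using kills_ten_relsD(2)[OF \<phi>] m by (simp add: kc)
      show "r \<in> carrier R \<Longrightarrow> n \<in> carrier (tmod act) \<Longrightarrow> (case (r \<odot>\<^bsub>UM\<^esub> m, n) of (v, p) \<Rightarrow> \<phi> (k v, p)) =
          (case (m, r \<odot>\<^bsub>tmod act\<^esub> n) of (v, p) \<Rightarrow> \<phi> (k v, p))"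
        using kills_ten_relsD(3)[OF \<phi>] m by (simp add: kc ks)
    qed
    from tcls_eqD_kills[OF right_mod_ten_rels[OF U] this rep_tcls[OF right_mod_ten_rels[OF U]]]
    have "isum (\<lambda>(v, p). \<phi> (k v, p)) (rep (tcls (carrier R) UM (tmod act) x)) = isum (\<lambda>(v, p). \<phi> (k v, p)) x" .
    then show "isum \<phi> (fmap2 k id (rep (tcls (carrier R) UM (tmod act) x))) = isum \<phi> (fmap2 k id x)"
      by (simp add: fmap2_def isum_frag_extend case_prod_unfold)
  qed
  have zero: "tcls (carrier R) WM (tmod act) (fmap2 ?g id x) = \<one>\<^bsub>?TW\<^esub>" for x
    unfolding one_tensor tcls_eq_iff_kills[OF relW]
  proof (intro allI impI)
    fix \<phi> :: "'u \<times> 'p \<Rightarrow> ('u \<times> 'p \<Rightarrow>\<^sub>0 int) quo"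
    assume \<phi>: "kills (ten_rels (carrier R) WM (tmod act)) \<phi>"
    have "\<phi> (\<zero>\<^bsub>WM\<^esub>, p) = 0" for p
      using kills_ten_relsD(1)[OF \<phi>, of "\<zero>\<^bsub>WM\<^esub>" "\<zero>\<^bsub>WM\<^esub>" p] by simp
    then show "isum \<phi> (fmap2 ?g id x) = isum \<phi> 0"
      by (simp add: fmap2_def isum_frag_extend case_prod_unfold)
  qed
  have carV: "carrier ?TV = tcls (carrier R) VM (tmod act) ` carrier (free_Abelian_group (carrier VM \<times> UNIV))"
    and carW: "carrier ?TW = tcls (carrier R) WM (tmod act) ` carrier (free_Abelian_group (carrier WM \<times> UNIV))"
    by (simp_all only: carrier_tensor tmod_simps)
  have "(\<lambda>c. tcls (carrier R) WM (tmod act) (fmap2 h id (rep c))) ` carrier ?TV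
     = kernel ?TW ?TW (\<lambda>c. tcls (carrier R) WM (tmod act) (fmap2 ?g id (rep c)))"
  proof
    show "(\<lambda>c. tcls (carrier R) WM (tmod act) (fmap2 h id (rep c))) ` carrier ?TV
      \<subseteq> kernel ?TW ?TW (\<lambda>c. tcls (carrier R) WM (tmod act) (fmap2 ?g id (rep c)))"
    proof
      fix d assume "d \<in> (\<lambda>c. tcls (carrier R) WM (tmod act) (fmap2 h id (rep c))) ` carrier ?TV"
      then obtain x where x: "x \<in> carrier (free_Abelian_group (carrier VM \<times> UNIV))"
        and d: "d = tcls (carrier R) WM (tmod act) (fmap2 h id x)"
        unfolding carV using ind[OF V h] by auto
      have "fmap2 h id x \<in> carrier (free_Abelian_group (carrier WM \<times> UNIV))"
        unfolding fmap2_def using x by (rule keys_in_frag_extend) (auto simp: hc)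
      then show "d \<in> kernel ?TW ?TW (\<lambda>c. tcls (carrier R) WM (tmod act) (fmap2 ?g id (rep c)))"
        unfolding kernel_def zero by (simp add: d carW del: carrier_free_Abelian_group_iff)
    qed
    show "kernel ?TW ?TW (\<lambda>c. tcls (carrier R) WM (tmod act) (fmap2 ?g id (rep c)))
      \<subseteq> (\<lambda>c. tcls (carrier R) WM (tmod act) (fmap2 h id (rep c))) ` carrier ?TV"
    proof
      fix d assume "d \<in> kernel ?TW ?TW (\<lambda>c. tcls (carrier R) WM (tmod act) (fmap2 ?g id (rep c)))"
      then have "d \<in> carrier ?TW" unfolding kernel_def by blast
      then obtain w where w: "w \<in> carrier (free_Abelian_group (carrier WM \<times> UNIV))"
        and d: "d = tcls (carrier R) WM (tmod act) w" unfolding carW by blast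
      from surj[OF w] obtain x where x: "x \<in> carrier (free_Abelian_group (carrier VM \<times> UNIV))"
        and "tcls (carrier R) WM (tmod act) (fmap2 h id x) = d" unfolding d by blast
      then have "d = tcls (carrier R) WM (tmod act) (fmap2 h id (rep (tcls (carrier R) VM (tmod act) x)))"
        using ind[OF V h] by simp
      then show "d \<in> (\<lambda>c. tcls (carrier R) WM (tmod act) (fmap2 h id (rep c))) ` carrier ?TV"
        using x unfolding carV by blast
    qed
  qed
  then have "h ` carrier VM = kernel (add_monoid WM) (add_monoid WM) ?g"
    using ff V W h g unfolding faithfully_flat_def Let_def by blast
  then show ?thesis by (simp add: kernel_def)
qed


context galois
begin

text \<open>
  The identity \<open>X\<^sub>+\<^sup><\<^sup>1\<^sup>> \<otimes> X\<^sub>- \<otimes> X\<^sub>+\<^sup><\<^sup>2\<^sup>> = X\<^sup><\<^sup>1\<^sup>> \<otimes> X\<^sup><\<^sup>2\<^sup>>\<^sub>-\<^sub>1 \<otimes> X\<^sup><\<^sup>2\<^sup>>\<^sub>0\<close>.  The right-hand side is the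
  value at \<open>X \<otimes> 1\<close> of a function on \<open>\<L> \<diamond> \<L>\<close>; inserting \<open>X \<otimes> 1 = X\<^sub>+\<^sub>1 \<otimes> X\<^sub>+\<^sub>2X\<^sub>-\<close> and applying \<open>T_cancel\<close> to
  \<open>X\<^sub>+\<close> gives the left-hand side.
\<close>

lemma T_plus_minus:
  fixes F :: "'p \<Rightarrow> 'l \<Rightarrow> 'p \<Rightarrow> 'g::ab_group_add"
  assumes hopf: "\<And>\<beta> :: 'l \<Rightarrow> 'l \<Rightarrow> 'g. lbal \<beta> \<Longrightarrow>
      (\<ointegral>V W\<in>c. \<ointegral>V1 V2\<in>D V. \<beta> V1 (V2 \<cdot>\<^sub>L W)) = \<beta> X (unt L)"
    and F: "ptest F"
  shows "(\<ointegral>V W\<in>c. \<ointegral>p q\<in>T V. F p W q) = (\<ointegral>p q\<in>T X. \<ointegral>Y q0\<in>C q. F p Y q0)"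
proof -
  note F' = ptestD[OF F]
  have d: "pbal (\<lambda>Z q0. F p (Z \<cdot>\<^sub>L Y) q0)" for p Y by standard (simp_all add: F')
  have nb: "nbal (\<lambda>p q. \<ointegral>Z q0\<in>C q. F p (Z \<cdot>\<^sub>L Y) q0)" for Y
    by standard (simp_all add: F' sw_plus C_add[OF d] C_left_N[OF d])
  have "lbal (\<lambda>X Y. \<ointegral>p q\<in>T X. \<ointegral>Z q0\<in>C q. F p (Z \<cdot>\<^sub>L Y) q0)"
    by standard (simp_all add: F' sw_plus T_add[OF nb] T_left_t[OF nb] C_right[OF d])
  note h = hopf[OF this]
  have "(\<ointegral>V1 V2\<in>D V. \<ointegral>p q\<in>T V1. \<ointegral>Z q0\<in>C q. F p (Z \<cdot>\<^sub>L (V2 \<cdot>\<^sub>L W)) q0) = (\<ointegral>p q\<in>T V. F p W q)" for V W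
  proof -
    have "ptest (\<lambda>p Z q. F p (Z \<cdot>\<^sub>L W) q)" unfolding ptest_def triadd_def by (simp add: F')
    from T_cancel[OF this, of V] show ?thesis by simp
  qed
  with h show ?thesis by simp
qed

text \<open>
  The map \<open>\<lambda>\<close> on formal sums.
\<close>

definition hopff where "hopff x = frag_extend (\<lambda>(X, Y). fmap2 id (\<lambda>X2. X2 \<cdot>\<^sub>L Y) (D X)) x"

lemma sw_hopff: "(\<ointegral>V W\<in>hopff x. \<beta> V W) = (\<ointegral>X Y\<in>x. \<ointegral>X1 X2\<in>D X. \<beta> X1 (X2 \<cdot>\<^sub>L Y))"
  unfolding hopff_def sw_extend by simp

abbreviation bcls where "bcls \<equiv> tcls UNIV (tmod (\<lambda>b X. X \<cdot>\<^sub>L t b)) (tmod (\<lambda>b Y. t b \<cdot>\<^sub>L Y))"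

lemma hopf_map_bcls: "hopf_map L (bcls x) = dcls L (\<lambda>b X. s b \<cdot>\<^sub>L X) (hopff x)"
  unfolding hopf_map_def hopff_def[symmetric]
proof (rule dcls_eqI)
  fix \<beta> :: "'l \<Rightarrow> 'l \<Rightarrow> ('l \<times> 'l \<Rightarrow>\<^sub>0 int) quo"
  assume b: "lbal \<beta>"
  note bs = balD(1,2)[OF b] balD(3)[OF b UNIV_I]
  have b': "lbal (\<lambda>X1 X2. \<beta> X1 (X2 \<cdot>\<^sub>L Y))" for Y by standard (simp_all add: bs)
  have "bal UNIV (\<lambda>b X. X \<cdot>\<^sub>L t b) (\<lambda>b Y. t b \<cdot>\<^sub>L Y) (\<lambda>X Y. \<ointegral>X1 X2\<in>D X. \<beta> X1 (X2 \<cdot>\<^sub>L Y))"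
    by standard (simp_all add: bs sw_plus D_add[OF b'] D_right_t[OF b'])
  from sw_rep_tcls[OF this, of x]
  show "(\<ointegral>V W\<in>hopff (rep (bcls x)). \<beta> V W) = (\<ointegral>V W\<in>hopff x. \<beta> V W)"
    unfolding sw_hopff .
qed

text \<open>
  A preimage of \<open>X \<otimes> Y \<otimes> r\<close> under \<open>\<lambda> \<otimes> P\<close>: with \<open>x \<otimes> x'\<close> and \<open>y \<otimes> y'\<close> the translations of \<open>X\<close> and \<open>Y\<close>, it is
  \<open>x\<^sub>-\<^sub>1 \<otimes> (x'y)\<^sub>-\<^sub>1 \<otimes> x\<^sub>0(x'y)\<^sub>0y'r\<close>.
\<close>

definition cover :: "'l \<Rightarrow> 'l \<Rightarrow> 'p \<Rightarrow> (('l \<times> 'l \<Rightarrow>\<^sub>0 int) set \<times> 'p \<Rightarrow>\<^sub>0 int)" where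
  "cover X Y r = frag_extend (\<lambda>(x, x'). frag_extend (\<lambda>(y, y'). frag_extend (\<lambda>(V, x0). frag_extend (\<lambda>(Z, z).
     frag_of (bcls (frag_of (V, Z)), x0 \<cdot>\<^sub>P (z \<cdot>\<^sub>P (y' \<cdot>\<^sub>P r)))) (C (x' \<cdot>\<^sub>P y))) (C x)) (T Y)) (T X)"

lemma isum_cover:
  "isum \<phi> (cover X Y r) = (\<ointegral>x x'\<in>T X. \<ointegral>y y'\<in>T Y. \<ointegral>V x0\<in>C x. \<ointegral>Z z\<in>C (x' \<cdot>\<^sub>P y).
     \<phi> (bcls (frag_of (V, Z)), x0 \<cdot>\<^sub>P (z \<cdot>\<^sub>P (y' \<cdot>\<^sub>P r))))"
  by (simp add: cover_def isum_frag_extend sw_def case_prod_unfold)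

text \<open>
  The value of \<open>\<lambda> \<otimes> P\<close> on the preimage is \<open>x\<^sub>-\<^sub>1 \<otimes> (x\<^sub>0x'y)\<^sub>-\<^sub>1 \<otimes> (x\<^sub>0x'y)\<^sub>0y'r\<close>.  As \<open>x\<^sub>-\<^sub>1 \<otimes> x\<^sub>0x' = X \<otimes> 1\<close>, this is
  \<open>X \<otimes> y\<^sub>-\<^sub>1 \<otimes> y\<^sub>0y'r = X \<otimes> Y \<otimes> r\<close>.
\<close>

lemma cover_eq:
  assumes "tri \<gamma>"
  shows "(\<ointegral>x x'\<in>T X. \<ointegral>y y'\<in>T Y. \<ointegral>V x0\<in>C x. \<ointegral>Z z\<in>C (x' \<cdot>\<^sub>P y).
     \<ointegral>V1 V2\<in>D V. \<gamma> V1 (V2 \<cdot>\<^sub>L Z) (x0 \<cdot>\<^sub>P (z \<cdot>\<^sub>P (y' \<cdot>\<^sub>P r)))) = \<gamma> X Y r"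
proof -
  have g: "\<gamma> (X + X') Y p = \<gamma> X Y p + \<gamma> X' Y p" "\<gamma> X (Y + Y') p = \<gamma> X Y p + \<gamma> X Y' p"
    "\<gamma> X Y (p + p') = \<gamma> X Y p + \<gamma> X Y p'" "\<gamma> (t b \<cdot>\<^sub>L X) Y p = \<gamma> X (s b \<cdot>\<^sub>L Y) p" "\<gamma> X (t b \<cdot>\<^sub>L Y) p = \<gamma> X Y (e b \<cdot>\<^sub>P p)"
    for X X' Y Y' p p' b
    using assms unfolding tri_bal_def triadd_def by simp_all
  have dY: "pbal (\<lambda>Y y0. \<gamma> X Y (y0 \<cdot>\<^sub>P q))" for X q by standard (simp_all add: g)
  have dX: "pbal (\<lambda>V w. \<ointegral>Y w0\<in>C w. \<gamma> V Y (w0 \<cdot>\<^sub>P q))" for q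
    by standard (simp_all add: g sw_plus C_add[OF dY] C_left[OF dY])
  have step: "(\<ointegral>V x0\<in>C x. \<ointegral>Y w0\<in>C (x0 \<cdot>\<^sub>P v). \<gamma> V Y (w0 \<cdot>\<^sub>P q)) =
      (\<ointegral>V x0\<in>C x. \<ointegral>Z z\<in>C v. \<ointegral>V1 V2\<in>D V. \<gamma> V1 (V2 \<cdot>\<^sub>L Z) (x0 \<cdot>\<^sub>P (z \<cdot>\<^sub>P q)))" for x v q
  proof -
    have "tri (\<lambda>V1 V2 x0. \<ointegral>Z z\<in>C v. \<gamma> V1 (V2 \<cdot>\<^sub>L Z) (x0 \<cdot>\<^sub>P (z \<cdot>\<^sub>P q)))"
      unfolding tri_bal_def triadd_def by (simp add: g sw_plus)
    from coassoc[OF this, of x] show ?thesis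
      unfolding C_mult[OF dY] by (simp add: sw_swap[of "D _" "C v"])
  qed
  have "(\<ointegral>x x'\<in>T X. \<ointegral>y y'\<in>T Y. \<ointegral>V x0\<in>C x. \<ointegral>Z z\<in>C (x' \<cdot>\<^sub>P y).
     \<ointegral>V1 V2\<in>D V. \<gamma> V1 (V2 \<cdot>\<^sub>L Z) (x0 \<cdot>\<^sub>P (z \<cdot>\<^sub>P (y' \<cdot>\<^sub>P r)))) =
     (\<ointegral>x x'\<in>T X. \<ointegral>y y'\<in>T Y. \<ointegral>V x0\<in>C x. \<ointegral>Y w0\<in>C (x0 \<cdot>\<^sub>P (x' \<cdot>\<^sub>P y)). \<gamma> V Y (w0 \<cdot>\<^sub>P (y' \<cdot>\<^sub>P r)))"
    unfolding step ..
  also have "\<dots> = (\<ointegral>y y'\<in>T Y. \<ointegral>x x'\<in>T X. \<ointegral>V x0\<in>C x. \<ointegral>Y w0\<in>C (x0 \<cdot>\<^sub>P (x' \<cdot>\<^sub>P y)). \<gamma> V Y (w0 \<cdot>\<^sub>P (y' \<cdot>\<^sub>P r)))"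
    by (rule sw_swap)
  also have "\<dots> = (\<ointegral>y y'\<in>T Y. \<ointegral>W w0\<in>C y. \<gamma> X W (w0 \<cdot>\<^sub>P (y' \<cdot>\<^sub>P r)))"
    unfolding can_T_mult[OF dX] ..
  also have "\<dots> = \<gamma> X Y r"
  proof -
    have "pbal (\<lambda>W w. \<gamma> X W w)" by standard (simp_all add: g)
    from can_T_mult[OF this, of Y r] show ?thesis by simp
  qed
  finally show ?thesis .
qed

text \<open>
  The scalar \<open>b\<close> acts on the source and the target of \<open>\<lambda>\<close> by left multiplication with \<open>\<bar>b\<close>, on the first factor of
  the source and on the second factor of the target.  Tensoring with \<open>P\<close> makes \<open>\<lambda>\<close> onto by the explicit preimages
  \<open>cover\<close>, and \<open>P\<close> is faithfully flat over \<open>B\<close>.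
\<close>

lemma hopf_map_onto:
  assumes ff: "faithfully_flat TYPE('l universe) (ring_of B UNIV) (tmod (blact P))"
  shows "hopf_map L ` carrier (tens_Bop L) = carrier (diamond L (\<lambda>b X. s b \<cdot>\<^sub>L X))"
proof -
  let ?R = "ring_of B UNIV"
  have R: "ring ?R" using ff unfolding faithfully_flat_def left_mod_def by blast
  have R_simps [simp]: "carrier ?R = UNIV" "monoid.mult ?R = prd B" "add ?R = (+)" "one ?R = unt B"
    by (simp_all add: ring_of_def)
  interpret Vm: tensor_module UNIV "\<lambda>b X. X \<cdot>\<^sub>L t b" "\<lambda>b Y. t b \<cdot>\<^sub>L Y" ?R "\<lambda>b X. t b \<cdot>\<^sub>L X" "\<lambda>_ Y. Y"
  proof (rule tensor_module.intro[OF R])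
    fix \<beta> :: "'l \<Rightarrow> 'l \<Rightarrow> ('l \<times> 'l \<Rightarrow>\<^sub>0 int) quo"
    assume b: "bal UNIV (\<lambda>b X. X \<cdot>\<^sub>L t b) (\<lambda>b Y. t b \<cdot>\<^sub>L Y) \<beta>"
    note bs = balD(1,2)[OF b] balD(3)[OF b UNIV_I]
    show "bal UNIV (\<lambda>b X. X \<cdot>\<^sub>L t b) (\<lambda>b Y. t b \<cdot>\<^sub>L Y) (\<lambda>m. \<beta> (t r \<cdot>\<^sub>L m))" for r
    proof
      show "\<beta> (t r \<cdot>\<^sub>L (m \<cdot>\<^sub>L t c)) n = \<beta> (t r \<cdot>\<^sub>L m) (t c \<cdot>\<^sub>L n)" for c m n
        by (simp flip: bs(3))
    qed (simp_all add: bs)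
  qed (simp_all add: balD)
  interpret Wm: tensor_module UNIV "\<lambda>b X. t b \<cdot>\<^sub>L X" "\<lambda>b X. s b \<cdot>\<^sub>L X" ?R "\<lambda>_ X. X" "\<lambda>b Y. t b \<cdot>\<^sub>L Y"
  proof (rule tensor_module.intro[OF R])
    fix \<beta> :: "'l \<Rightarrow> 'l \<Rightarrow> ('l \<times> 'l \<Rightarrow>\<^sub>0 int) quo"
    assume b: "bal UNIV (\<lambda>b X. t b \<cdot>\<^sub>L X) (\<lambda>b X. s b \<cdot>\<^sub>L X) \<beta>"
    note bs = balD(1,2)[OF b] balD(3)[OF b UNIV_I]
    show "bal UNIV (\<lambda>b X. t b \<cdot>\<^sub>L X) (\<lambda>b X. s b \<cdot>\<^sub>L X) (\<lambda>m n. \<beta> m (t r \<cdot>\<^sub>L n))" for r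
      by standard (simp_all add: bs)
  qed (simp_all add: balD)
  have Wcls: "Wm.cls = dcls L (\<lambda>b X. s b \<cdot>\<^sub>L X)" by (simp add: dcls_def)
  have hopf: "hopf_map L (bcls x) = Wm.cls (hopff x)" for x unfolding Wcls by (rule hopf_map_bcls)
  have "hopf_map L \<in> right_mod_hom ?R Vm.V Wm.V"
    unfolding right_mod_hom_def
  proof (intro CollectI conjI ballI homI)
    fix v w assume "v \<in> carrier (add_monoid Vm.V)" "w \<in> carrier (add_monoid Vm.V)"
    then obtain x y where v: "v = bcls x" "w = bcls y" by (auto simp: Vm.V_carrier)
    show "hopf_map L v \<in> carrier (add_monoid Wm.V)" by (simp add: v hopf Wm.V_carrier)
    have "hopff (x + y) = hopff x + hopff y" by (simp add: hopff_def frag_extend_add)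
    then show "hopf_map L (v \<otimes>\<^bsub>add_monoid Vm.V\<^esub> w) = hopf_map L v \<otimes>\<^bsub>add_monoid Wm.V\<^esub> hopf_map L w"
      by (simp add: v hopf Vm.V_add Wm.V_add)
  next
    fix r v assume "r \<in> carrier ?R" "v \<in> carrier Vm.V"
    then obtain x where v: "v = bcls x" by (auto simp: Vm.V_carrier)
    show "hopf_map L (r \<odot>\<^bsub>Vm.V\<^esub> v) = r \<odot>\<^bsub>Wm.V\<^esub> hopf_map L v"
      unfolding v hopf Vm.V_smult[OF \<open>r \<in> carrier ?R\<close>] Wm.V_smult[OF \<open>r \<in> carrier ?R\<close>]
    proof (rule tcls_eqI)
      fix \<beta> :: "'l \<Rightarrow> 'l \<Rightarrow> ('l \<times> 'l \<Rightarrow>\<^sub>0 int) quo"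
      assume b: "lbal \<beta>"
      note bs = balD(1,2)[OF b] balD(3)[OF b UNIV_I]
      have b': "lbal (\<lambda>X1 X2. \<beta> X1 (X2 \<cdot>\<^sub>L Y))" for Y by standard (simp_all add: bs)
      show "(\<ointegral>V W\<in>hopff (fmap2 (\<lambda>X. t r \<cdot>\<^sub>L X) (\<lambda>Y. Y) x). \<beta> V W) = (\<ointegral>V W\<in>fmap2 (\<lambda>X. X) (\<lambda>Y. t r \<cdot>\<^sub>L Y) (hopff x). \<beta> V W)"
        by (simp add: sw_hopff D_left_t[OF b'])
    qed
  qed
  then have "hopf_map L ` carrier Vm.V = carrier Wm.V"
  proof (rule faithfully_flat_surj[OF ff Vm.right_mod_V Wm.right_mod_V])
    fix w assume w: "w \<in> carrier (free_Abelian_group (carrier Wm.V \<times> (UNIV :: 'p set)))"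
    let ?x = "frag_extend (\<lambda>(d, p). frag_extend (\<lambda>(X, Y). cover X Y p) (rep d)) w"
    have "?x \<in> carrier (free_Abelian_group (carrier Vm.V \<times> UNIV))"
    proof -
      have "cover X Y p \<in> carrier (free_Abelian_group (carrier Vm.V \<times> UNIV))" for X Y p
        unfolding cover_def by (rule keys_in_frag_extend[where S = UNIV], simp, clarify)+ (simp add: Vm.V_carrier)
      then have "frag_extend (\<lambda>(X, Y). cover X Y p) z \<in> carrier (free_Abelian_group (carrier Vm.V \<times> UNIV))" for p z
        by (intro keys_in_frag_extend[where S = UNIV]) auto
      then show ?thesis by (intro keys_in_frag_extend[OF w]) auto
    qed
    moreover have "tcls (carrier ?R) Wm.V (tmod (blact P)) (fmap2 (hopf_map L) id ?x) = tcls (carrier ?R) Wm.V (tmod (blact P)) w"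
      unfolding tcls_eq_iff_kills[OF right_mod_ten_rels[OF Wm.right_mod_V]]
    proof (intro allI impI)
      fix \<phi> :: "('l \<times> 'l \<Rightarrow>\<^sub>0 int) set \<times> 'p \<Rightarrow> (('l \<times> 'l \<Rightarrow>\<^sub>0 int) set \<times> 'p \<Rightarrow>\<^sub>0 int) quo"
      assume \<phi>: "kills (ten_rels (carrier ?R) Wm.V (tmod (blact P))) \<phi>"
      have \<phi>_add: "\<phi> (Wm.cls (x + y), p) = \<phi> (Wm.cls x, p) + \<phi> (Wm.cls y, p)"
        and \<phi>_add2: "\<phi> (Wm.cls x, p + q) = \<phi> (Wm.cls x, p) + \<phi> (Wm.cls x, q)"
        and \<phi>_smult: "\<phi> (Wm.cls (fmap2 (\<lambda>X. X) (\<lambda>Y. t b \<cdot>\<^sub>L Y) x), p) = \<phi> (Wm.cls x, e b \<cdot>\<^sub>P p)" for x y p q b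
        using kills_ten_relsD(1)[OF \<phi>, of "Wm.cls x" "Wm.cls y" p] kills_ten_relsD(2)[OF \<phi>, of "Wm.cls x" p q]
          kills_ten_relsD(3)[OF \<phi>, of b "Wm.cls x" p]
        by (simp_all add: Wm.V_carrier Wm.V_add Wm.V_smult)
      define \<gamma> where "\<gamma> X Y p = \<phi> (Wm.cls (frag_of (X, Y)), p)" for X Y p
      have \<phi>_cls: "\<phi> (Wm.cls y, p) = (\<ointegral>X Y\<in>y. \<gamma> X Y p)" for y p
      proof (induction y rule: frag_ind)
        case zero
        show ?case using \<phi>_add[of 0 0 p] by simp
      next
        case (one x)
        show ?case by (cases x) (simp add: \<gamma>_def)
      next
        case (diff a b)
        show ?case using \<phi>_add[of "a - b" b p] diff by (simp add: sw_diff)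
      qed
      have "tri \<gamma>"
      proof -
        have cls: "Wm.cls (frag_of (X + X', Y)) = Wm.cls (frag_of (X, Y) + frag_of (X', Y))"
          "Wm.cls (frag_of (X, Y + Y')) = Wm.cls (frag_of (X, Y) + frag_of (X, Y'))" for X X' Y Y'
          by (rule tcls_eqI, simp add: sw_add balD)+
        have cls_t: "Wm.cls (frag_of (t b \<cdot>\<^sub>L X, Y)) = Wm.cls (frag_of (X, s b \<cdot>\<^sub>L Y))" for X Y b
        proof (rule tcls_eqI)
          fix \<beta> :: "'l \<Rightarrow> 'l \<Rightarrow> ('l \<times> 'l \<Rightarrow>\<^sub>0 int) quo"
          assume "lbal \<beta>"
          from balD(3)[OF this UNIV_I]
          show "(\<ointegral>m n\<in>frag_of (t b \<cdot>\<^sub>L X, Y). \<beta> m n) = (\<ointegral>m n\<in>frag_of (X, s b \<cdot>\<^sub>L Y). \<beta> m n)" by simp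
        qed
        have "\<gamma> X (t b \<cdot>\<^sub>L Y) p = \<gamma> X Y (e b \<cdot>\<^sub>P p)" for X b Y p
          using \<phi>_smult[of b "frag_of (X, Y)" p] by (simp add: \<gamma>_def fmap2_def)
        then show ?thesis
          unfolding tri_bal_def triadd_def by (simp add: \<gamma>_def cls cls_t \<phi>_add \<phi>_add2)
      qed
      note cov = cover_eq[OF this]
      have "isum \<phi> (fmap2 (hopf_map L) id (cover X Y p)) = \<gamma> X Y p" for X Y p
      proof -
        have "\<phi> (hopf_map L (bcls (frag_of (V, Z))), q) = (\<ointegral>V1 V2\<in>D V. \<gamma> V1 (V2 \<cdot>\<^sub>L Z) q)" for V Z q
          unfolding hopf \<phi>_cls sw_hopff by simp
        moreover have "isum \<phi> (fmap2 (hopf_map L) id (cover X Y p)) = isum (\<lambda>(v, q). \<phi> (hopf_map L v, q)) (cover X Y p)"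
          by (simp add: fmap2_def isum_frag_extend case_prod_unfold)
        ultimately show ?thesis unfolding isum_cover by (simp add: cov)
      qed
      then have *: "isum (\<lambda>(v, q). \<phi> (hopf_map L v, q)) (cover X Y p) = \<gamma> X Y p" for X Y p
        by (simp add: fmap2_def isum_frag_extend case_prod_unfold)
      have "isum \<phi> (fmap2 (hopf_map L) id ?x) = isum (\<lambda>(d, p). \<ointegral>X Y\<in>rep d. \<gamma> X Y p) w"
        using * by (simp add: fmap2_def isum_frag_extend case_prod_unfold sw_def)
      also have "\<dots> = isum \<phi> w"
      proof (rule isum_cong)
        fix z assume "z \<in> Poly_Mapping.keys w"
        then obtain d p where z: "z = (d, p)" "d \<in> carrier Wm.V"
          using w by (cases z) auto
        then have "Wm.cls (rep d) = d" unfolding Wm.V_def quot_mod_simps by (intro tcls_rep)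
        then show "(case z of (d, p) \<Rightarrow> \<ointegral>X Y\<in>rep d. \<gamma> X Y p) = \<phi> z"
          by (simp add: z(1) flip: \<phi>_cls)
      qed
      finally show "isum \<phi> (fmap2 (hopf_map L) id ?x) = isum \<phi> w" .
    qed
    ultimately show "\<exists>x\<in>carrier (free_Abelian_group (carrier Vm.V \<times> UNIV)).
        tcls (carrier ?R) Wm.V (tmod (blact P)) (fmap2 (hopf_map L) id x) = tcls (carrier ?R) Wm.V (tmod (blact P)) w" by blast
  qed
  then show ?thesis by (simp add: Vm.V_def Wm.V_def tens_Bop_def diamond_def)
qed

lemma plus_minus_hopf:
  assumes ff: "faithfully_flat TYPE('l universe) (ring_of B UNIV) (tmod (blact P))"
    and b: "lbal \<beta>"
  shows "(\<ointegral>V W\<in>rep (plus_minus L X). \<ointegral>V1 V2\<in>D V. \<beta> V1 (V2 \<cdot>\<^sub>L W)) = \<beta> X (unt L)"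
proof -
  have "dcls L (\<lambda>b X. s b \<cdot>\<^sub>L X) (frag_of (X, unt L)) \<in> hopf_map L ` carrier (tens_Bop L)"
    unfolding hopf_map_onto[OF ff] carrier_diamond by blast
  then have "hopf_map L (plus_minus L X) = dcls L (\<lambda>b X. s b \<cdot>\<^sub>L X) (frag_of (X, unt L))"
    unfolding plus_minus_def by (rule f_inv_into_f)
  then have "dcls L (\<lambda>b X. s b \<cdot>\<^sub>L X) (hopff (rep (plus_minus L X))) = dcls L (\<lambda>b X. s b \<cdot>\<^sub>L X) (frag_of (X, unt L))"
    unfolding hopf_map_def hopff_def .
  from dcls_eqD[OF this b] show ?thesis unfolding sw_hopff by simp
qed

end

section \<open>The twisted Galois extension\<close>

context cocycle_galois
begin

lemma tw_emb_fun [simp]: "tw (e b) = (\<cdot>\<^sub>P) (e b)"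
  by (intro ext) simp

text \<open>
  Coaction, tensor product over \<open>B\<close> and the class of \<open>1 \<otimes> p\<close> are the same before and after twisting.
\<close>

lemma twist_coinvariants: "coinvariants L\<Gamma> P\<Gamma> = N"
  unfolding N coinvariants_def by (simp add: twist_dcls)

lemma twist_tens_N: "tens_N P\<Gamma> N = tens_N P N" "ncls P\<Gamma> N = ncls P N"
  unfolding tens_N_def ncls_def by (rule tensor_tmod_cong; simp)+

lemma twist_left_can: "left_can L\<Gamma> P\<Gamma> (ncls P N x) = dcls L (blact P) (canf tw x)"
proof -
  have "left_can L\<Gamma> P\<Gamma> (ncls P N x) = dcls L (blact P) (canf tw (rep (ncls P N x)))"
    unfolding left_can_def canf_def by (simp add: twist_dcls)
  also have "\<dots> = dcls L (blact P) (canf tw x)"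
  proof (rule dcls_eqI)
    fix \<beta> :: "'l \<Rightarrow> 'p \<Rightarrow> ('l \<times> 'p \<Rightarrow>\<^sub>0 int) quo"
    assume "pbal \<beta>"
    from twisted_can_test[OF this]
    show "(\<ointegral>V r\<in>canf tw (rep (ncls P N x)). \<beta> V r) = (\<ointegral>V r\<in>canf tw x. \<beta> V r)"
      unfolding sw_canf ncls_def by (rule sw_rep_tcls)
  qed
  finally show ?thesis .
qed

lemma twist_left_can_inj: "inj_on (left_can L\<Gamma> P\<Gamma>) (range (ncls P N))"
proof (rule inj_onI, clarify)
  fix x y assume "left_can L\<Gamma> P\<Gamma> (ncls P N x) = left_can L\<Gamma> P\<Gamma> (ncls P N y)"
  then have eq: "dcls L (blact P) (canf tw x) = dcls L (blact P) (canf tw y)" by (simp only: twist_left_can)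
  show "ncls P N x = ncls P N y"
    unfolding ncls_def
  proof (rule tcls_eqI)
    fix \<gamma> :: "'p \<Rightarrow> 'p \<Rightarrow> ('p \<times> 'p \<Rightarrow>\<^sub>0 int) quo"
    assume g: "nbal \<gamma>"
    from dcls_eqD[OF eq twisted_can_left_inverse(1)[OF g]]
    show "(\<ointegral>p q\<in>x. \<gamma> p q) = (\<ointegral>p q\<in>y. \<gamma> p q)"
      unfolding sw_canf twisted_can_left_inverse(2)[OF g] .
  qed
qed

text \<open>
  The twisted translation map of the theorem, as a formal sum.
\<close>

definition ttrans where
  "ttrans X = frag_extend (\<lambda>(X1, X2). frag_extend (\<lambda>(X1p, X1m).
     fmap2 id (\<lambda>q. e (\<Gamma>i X1m X2) \<cdot>\<^sub>P q) (T X1p)) (rep (plus_minus L X1))) (D X)"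

text \<open>
  \<open>T_plus_minus\<close> replaces \<open>X\<^sub>1\<^sub>+\<close> and \<open>X\<^sub>1\<^sub>-\<close> by the translation of \<open>X\<^sub>1\<close> and the coaction of its second leg; the rest is
  \<open>twisted_can_right_inverse\<close>.
\<close>

lemma twisted_can_ttrans:
  assumes ff: "faithfully_flat TYPE('l universe) (ring_of B UNIV) (tmod (blact P))"
    and b: "pbal \<beta>"
  shows "(\<ointegral>p q\<in>ttrans X. \<ointegral>V p0\<in>C p. \<beta> V (tw p0 q)) = \<beta> X (unt P)"
proof -
  note g = twisted_can_test[OF b]
  have pm: "(\<ointegral>V W\<in>rep (plus_minus L X1). \<ointegral>p q\<in>T V. \<ointegral>U p0\<in>C p. \<beta> U (tw p0 (e (\<Gamma>i W X2) \<cdot>\<^sub>P q))) =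
    (\<ointegral>p q\<in>T X1. \<ointegral>Y q0\<in>C q. \<ointegral>U p0\<in>C p. \<beta> U (tw p0 (e (\<Gamma>i Y X2) \<cdot>\<^sub>P q0)))" for X1 X2
  proof -
    have "ptest (\<lambda>p W q. \<ointegral>V p0\<in>C p. \<beta> V (tw p0 (e (\<Gamma>i W X2) \<cdot>\<^sub>P q)))"
      unfolding ptest_def triadd_def using balD[OF g] by simp
    from T_plus_minus[OF plus_minus_hopf[OF ff] this] show ?thesis .
  qed
  have "(\<ointegral>p q\<in>ttrans X. \<ointegral>V p0\<in>C p. \<beta> V (tw p0 q)) =
     (\<ointegral>X1 X2\<in>D X. \<ointegral>V W\<in>rep (plus_minus L X1). \<ointegral>p q\<in>T V. \<ointegral>U p0\<in>C p. \<beta> U (tw p0 (e (\<Gamma>i W X2) \<cdot>\<^sub>P q)))"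
    unfolding ttrans_def sw_extend by simp
  also have "\<dots> = \<beta> X (unt P)"
    unfolding pm by (rule twisted_can_right_inverse[OF b])
  finally show ?thesis .
qed

text \<open>
  The twisted canonical map is right \<open>P\<close>-linear for the twisted product, so it is enough to reach \<open>X \<otimes> 1\<close>.
\<close>

lemma twist_left_can_surj:
  assumes ff: "faithfully_flat TYPE('l universe) (ring_of B UNIV) (tmod (blact P))"
  shows "\<exists>x. left_can L\<Gamma> P\<Gamma> (ncls P N x) = dcls L (blact P) y"
proof -
  let ?x = "frag_extend (\<lambda>(X, r). fmap2 id (\<lambda>q. tw q r) (ttrans X)) y"
  have "left_can L\<Gamma> P\<Gamma> (ncls P N ?x) = dcls L (blact P) y"
    unfolding twist_left_can
  proof (rule dcls_eqI)
    fix \<beta> :: "'l \<Rightarrow> 'p \<Rightarrow> ('l \<times> 'p \<Rightarrow>\<^sub>0 int) quo"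
    assume b: "pbal \<beta>"
    note bs = balD(1,2)[OF b] balD(3)[OF b UNIV_I]
    have b': "pbal (\<lambda>V w. \<beta> V (tw w r))" for r by standard (simp_all add: bs)
    have "(\<ointegral>V w\<in>canf tw ?x. \<beta> V w) = (\<ointegral>X r\<in>y. \<ointegral>p q\<in>ttrans X. \<ointegral>V p0\<in>C p. \<beta> V (tw (tw p0 q) r))"
      unfolding sw_canf sw_extend by (simp add: tw_assoc)
    then show "(\<ointegral>V w\<in>canf tw ?x. \<beta> V w) = (\<ointegral>X r\<in>y. \<beta> X r)"
      unfolding twisted_can_ttrans[OF ff b'] by simp
  qed
  then show ?thesis ..
qed

theorem twist_galois:
  assumes ff: "faithfully_flat TYPE('l universe) (ring_of B UNIV) (tmod (blact P))"
  shows "left_galois B L\<Gamma> P\<Gamma> N" "left_trans L\<Gamma> P\<Gamma> N X = ncls P\<Gamma> N (ttrans X)"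
proof -
  have car: "carrier (tens_N P\<Gamma> N) = range (ncls P N)" unfolding twist_tens_N by (rule carrier_tens_N)
  have car': "carrier (diamond L\<Gamma> (blact P\<Gamma>)) = range (dcls L (blact P))"
    by (simp add: twist_diamond carrier_diamond)
  have "left_can L\<Gamma> P\<Gamma> ` range (ncls P N) = range (dcls L (blact P))"
    using twist_left_can_surj[OF ff] by (fastforce simp: twist_left_can)
  then have "bij_betw (left_can L\<Gamma> P\<Gamma>) (carrier (tens_N P\<Gamma> N)) (carrier (diamond L\<Gamma> (blact P\<Gamma>)))"
    unfolding car car' bij_betw_def using twist_left_can_inj by blast
  then show "left_galois B L\<Gamma> P\<Gamma> N"
    unfolding left_galois_def using twist_left_bialgebroid twist_comodule_algebra twist_coinvariants by blast
  have "left_can L\<Gamma> P\<Gamma> (ncls P N (ttrans X)) = dcls L (blact P) (frag_of (X, unt P))"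
    unfolding twist_left_can
    by (rule dcls_eqI) (simp add: sw_canf twisted_can_ttrans[OF ff])
  then have "inv_into (range (ncls P N)) (left_can L\<Gamma> P\<Gamma>) (dcls L (blact P) (frag_of (X, unt P))) = ncls P N (ttrans X)"
    by (intro inv_into_f_eq[OF twist_left_can_inj]) auto
  then show "left_trans L\<Gamma> P\<Gamma> N X = ncls P\<Gamma> N (ttrans X)"
    unfolding left_trans_def twist_tens_N carrier_tens_N by (simp add: twist_dcls)
qed

end

theorem theorem4p4:
  fixes B :: "('k::field, 'b::ab_group_add) alg"
    and L :: "('k, 'b, 'l::ab_group_add) bialgd"
    and P :: "('k, 'b, 'l, 'p::ab_group_add) comodalg"
    and N :: "'p set"
    and \<Gamma> :: "'l \<Rightarrow> 'l \<Rightarrow> 'b"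
  assumes "left_bialgebroid B L"
    and "base_faithfully_flat B L P"
    and "invertible_normalised_cocycle B L \<Gamma>"
    and "left_galois B L P N"
    and "N_faithfully_flat P N"
  shows "left_galois B (twist_bialgd B \<Gamma> L) (twist_comodalg \<Gamma> P) N \<and>
    (\<forall>X. left_trans (twist_bialgd B \<Gamma> L) (twist_comodalg \<Gamma> P) N X =
       ncls (twist_comodalg \<Gamma> P) N
         (frag_extend (\<lambda>(X1, X2).
            frag_extend (\<lambda>(X1p, X1m).
              fmap2 id (\<lambda>q. emb P (conv_inv B L \<Gamma> X1m X2) \<cdot>\<^bsub>P\<^esub> q) (rep (left_trans L P N X1p)))
            (rep (plus_minus L X1)))
          (rep (cop L X))))"
proof -
  interpret cocycle_galois B L \<Gamma> P N
    using assms(1,3,4) unfolding left_galois_def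
    by (intro cocycle_galois.intro cocycle_comodalg.intro cocycle.intro cocycle_axioms.intro galois.intro
        galois_axioms.intro comodalg.intro comodalg_axioms.intro bialgebroid.intro) blast+
  have "faithfully_flat TYPE('l universe) (ring_of B UNIV) (tmod (blact P))"
    using assms(2) unfolding base_faithfully_flat_def Let_def by blast
  from twist_galois[OF this] show ?thesis
    unfolding twist_bialgd_eq twist_comodalg_eq ttrans_def by blast
qed

end
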